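(* Each of the eleven lists $D_1,\dots,D_{11}$ given in the context defines (in the encoding explained there) a matroid of rank three. The eleven matroids are pairwise non-isomorphic; one of them has $16$ lines, four of them have $21$ lines and six of them have $23$ lines. Each of them is combinatorially simplicial and has a $1$-dimensional moduli space $\mathcal{V}_{\mathbb{C}}(L)$ over $\mathbb{C}$. None of them admits a realization over $\mathbb{R}$.
   Context: Matroids of rank three are viewed as (abstract) intersection lattices of line arrangements in a projective plane: the elements of the ground set $\{1,\dots,n\}$ are called lines, and the rank-two flats are called points; a line $i$ passes through a point $v$ if $i\in v$. All matroids are simple (no loops or parallel elements). Combinatorially simplicial: for a rank-three matroid $L$ put $\sigma(L)=3+\sum_{v}(|v|-3)$, where $v$ runs over all points (rank-two flats, including those with exactly two lines) and $|v|$ is the number of lines through $v$. $L$ is combinatorially simplicial if $\sigma(L)=0$. Moduli space: for a field $K$ and a rank-three matroid $L$ on $\{1,\dots,\ell\}$, let $\mathcal{U}(L)$ be the set of matrices $M=[m_1,\dots,m_\ell]\in K^{3\times\ell}$ such that the kernels $\ker(m_i)$ of the linear forms on $K^3$ given by the columns are $\ell$ distinct hyperplanes and sending $i$ to $\ker(m_i)$ extends to an isomorphism of graded lattices from $L$ to the intersection lattice of $\{\ker(m_1),\dots,\ker(m_\ell)\}$ (equivalently, the $m_i$ are a vector realization of the labelled matroid). Then $\mathcal{V}_K(L):=\mathrm{PGL}(3,K)\backslash(\mathcal{U}(L)/(K^\times)^\ell)$, where $(K^\times)^\ell$ acts by rescaling columns. $L$ admits a realization over $K$ if $\mathcal{U}(L)\neq\emptyset$.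 Encoding: let $T=[t_1,t_2,\dots]$ be the lexicographically ordered sequence of all triples $(a,b,c)$ with $1\le a<b<c\le n$ (e.g. for $n=4$, $T=[(1,2,3),(1,2,4),(1,3,4),(2,3,4)]$). A list $D$ of indices encodes the rank-three matroid on $\{1,\dots,n\}$ in which, for $a<b<c$, the lines $a,b,c$ are linearly dependent if and only if $(a,b,c)=t_i$ for some $i\in D$. $D_1$ ($n=16$): 96, 97, 98, 99, 100, 101, 102, 103, 104, 105, 108, 109, 110, 127, 137, 142, 143, 152, 173, 180, 186, 206, 219, 220, 221, 230, 249, 256, 263, 278, 279, 280, 291, 304, 311, 313, 314, 320, 349, 356, 365, 368, 369, 375, 396, 419, 423, 427, 454, 457, 464, 480, 489, 490, 505, 551, 552, 553, 554, 555, 556, 557, 558, 559, 560. $D_2$ ($n=21$): 188, 189, 190, 194, 199, 213, 223, 231, 235, 251, 253, 261, 279, 293, 310, 332, 340, 348, 394, 403, 414, 428, 431, 441, 444, 449, 458, 468, 481, 489, 509, 525, 541, 546, 559, 572, 582, 587, 592, 596, 619, 623, 628, 634, 652, 658, 671, 685, 695, 711, 713, 719, 762, 766, 782, 790, 808, 811, 820, 822, 839, 862, 888, 889, 914, 948, 952, 955, 959, 975, 983, 997, 1007, 1011, 1060, 1076, 1082, 1085, 1095, 1119, 1129, 1134, 1139, 1157, 1201, 1204, 1207, 1214, 1222, 1226, 1229, 1234, 1251, 1259, 1279, 1298, 1313, 1323, 1330. $D_3$ ($n=21$): 188, 189, 190, 201, 209, 225, 241, 246, 259, 269, 271, 279,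 291, 305, 319, 330, 349, 368, 374, 386, 393, 409, 410, 445, 453, 457, 465, 473, 485, 497, 530, 536, 543, 552, 556, 561, 579, 601, 612, 626, 634, 658, 661, 670, 687, 693, 719, 741, 745, 765, 772, 778, 803, 812, 837, 850, 862, 864, 871, 894, 910, 913, 916, 933, 942, 958, 974, 990, 998, 1007, 1009, 1014, 1021, 1026, 1029, 1041, 1063, 1066, 1074, 1082, 1088, 1117, 1122, 1148, 1151, 1155, 1159, 1173, 1177, 1189, 1218, 1237, 1251, 1255, 1275, 1307, 1314, 1316, 1330. $D_4$ ($n=21$): 188, 189, 190, 195, 196, 211, 239, 248, 250, 271, 301, 306, 313, 318, 327, 351, 354, 374, 387, 388, 420, 421, 424, 451, 469, 473, 477, 487, 503, 509, 518, 520, 538, 544, 567, 574, 586, 592, 611, 620, 628, 635, 651, 683, 694, 714, 739, 742, 743, 756, 767, 793, 794, 798, 825, 828, 839, 841, 853, 863, 866, 888, 899, 901, 904, 914, 922, 926, 934, 946, 961, 983, 991, 998, 1015, 1021, 1035, 1068, 1072, 1085, 1089, 1093, 1097, 1104, 1113, 1126, 1155, 1157, 1181, 1191, 1198, 1214, 1229, 1235, 1248, 1271, 1289, 1306, 1330. $D_5$ ($n=21$): 188, 189, 190, 221, 223, 234, 251, 253, 261, 269, 283, 284, 308, 310, 324, 327, 348, 353, 371, 377, 386, 389, 396, 405, 412, 413, 432, 439, 449, 481, 492, 497, 511, 518, 527, 536, 546, 581, 589, 595, 600, 628, 635, 642, 664, 677, 683, 686, 701, 711, 725, 728, 737, 772,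 784, 793, 809, 812, 828, 848, 862, 900, 901, 929, 935, 940, 947, 970, 976, 984, 988, 992, 1002, 1014, 1033, 1064, 1080, 1085, 1090, 1141, 1142, 1150, 1154, 1160, 1170, 1171, 1176, 1201, 1211, 1218, 1225, 1234, 1237, 1253, 1267, 1290, 1306, 1314, 1330. $D_6$ ($n=23$): 185, 186, 231, 366, 370, 375, 382, 383, 384, 400, 405, 406, 407, 412, 414, 419, 425, 431, 432, 433, 436, 456, 460, 462, 473, 485, 506, 513, 520, 533, 537, 547, 557, 567, 607, 625, 629, 639, 647, 653, 658, 667, 702, 710, 716, 733, 741, 755, 765, 776, 796, 815, 818, 830, 843, 850, 851, 878, 908, 911, 934, 937, 948, 957, 959, 977, 983, 988, 1005, 1029, 1052, 1071, 1084, 1090, 1108, 1123, 1148, 1156, 1169, 1173, 1183, 1186, 1194, 1207, 1214, 1215, 1232, 1249, 1251, 1277, 1286, 1295, 1302, 1342, 1370, 1375, 1383, 1392, 1395, 1412, 1417, 1425, 1429, 1445, 1462, 1474, 1482, 1500, 1502, 1510, 1515, 1528, 1532, 1541, 1578, 1595, 1597, 1598, 1601, 1608, 1618, 1620, 1632, 1638, 1651, 1670, 1677, 1688, 1693, 1699, 1702, 1720, 1762. $D_7$ ($n=23$): 185, 186, 231, 368, 369, 371, 377, 384, 385, 403, 404, 408, 410, 413, 414, 416, 422, 428, 431, 438, 439, 450, 470, 471, 482, 489, 496, 509, 524, 537, 539, 547, 556, 571, 596, 625, 627, 636, 644, 651, 668, 682, 711, 719, 728, 734, 740, 760, 763, 772,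 784, 795, 803, 840, 841, 853, 860, 872, 886, 896, 901, 920, 939, 954, 988, 990, 1007, 1015, 1033, 1048, 1055, 1062, 1070, 1077, 1079, 1083, 1104, 1120, 1126, 1132, 1134, 1162, 1163, 1170, 1177, 1189, 1202, 1212, 1245, 1249, 1255, 1261, 1262, 1284, 1292, 1301, 1305, 1331, 1348, 1363, 1384, 1387, 1403, 1419, 1420, 1422, 1432, 1445, 1463, 1480, 1521, 1524, 1526, 1532, 1540, 1553, 1568, 1569, 1591, 1604, 1625, 1634, 1642, 1651, 1666, 1669, 1685, 1702, 1705, 1712, 1717, 1753, 1758. $D_8$ ($n=23$): 175, 176, 231, 366, 367, 370, 389, 392, 396, 397, 400, 408, 416, 420, 423, 424, 425, 435, 436, 437, 439, 445, 451, 467, 475, 487, 491, 497, 517, 546, 547, 564, 573, 581, 599, 604, 630, 636, 650, 666, 682, 688, 707, 709, 726, 739, 741, 768, 778, 791, 794, 805, 818, 820, 863, 883, 889, 897, 901, 908, 917, 920, 940, 941, 971, 975, 999, 1008, 1011, 1018, 1043, 1049, 1059, 1079, 1122, 1123, 1141, 1142, 1146, 1168, 1174, 1181, 1189, 1191, 1202, 1212, 1213, 1226, 1263, 1270, 1287, 1293, 1297, 1303, 1306, 1313, 1317, 1345, 1347, 1356, 1368, 1379, 1381, 1399, 1420, 1449, 1454, 1458, 1473, 1478, 1494, 1507, 1510, 1518, 1536, 1542, 1566, 1572, 1580, 1606, 1613, 1622, 1626, 1630, 1645, 1654, 1665, 1730, 1746, 1747, 1749, 1758, 1768. $D_9$ ($n=23$):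 200, 202, 227, 340, 344, 350, 354, 356, 361, 364, 370, 371, 381, 382, 390, 396, 398, 403, 418, 426, 427, 458, 460, 466, 477, 485, 490, 508, 517, 518, 529, 547, 564, 581, 587, 606, 630, 641, 653, 655, 678, 681, 683, 694, 708, 713, 730, 750, 761, 795, 801, 813, 816, 822, 825, 845, 848, 860, 867, 888, 893, 919, 937, 943, 963, 964, 985, 991, 1002, 1023, 1041, 1056, 1073, 1085, 1095, 1106, 1118, 1123, 1136, 1156, 1176, 1191, 1204, 1222, 1234, 1240, 1261, 1272, 1289, 1304, 1317, 1321, 1333, 1356, 1362, 1381, 1385, 1392, 1396, 1411, 1442, 1447, 1462, 1472, 1485, 1491, 1492, 1527, 1530, 1537, 1548, 1553, 1564, 1569, 1590, 1592, 1601, 1611, 1612, 1636, 1642, 1649, 1664, 1671, 1678, 1696, 1698, 1705, 1707, 1711, 1725, 1733, 1743. $D_{10}$ ($n=23$): 138, 139, 229, 351, 352, 356, 364, 368, 379, 392, 393, 396, 397, 399, 400, 407, 408, 421, 432, 435, 438, 457, 459, 462, 481, 486, 518, 519, 531, 553, 555, 563, 570, 584, 596, 617, 627, 638, 647, 651, 670, 676, 701, 703, 720, 730, 745, 749, 759, 792, 798, 818, 836, 837, 851, 880, 885, 898, 904, 915, 927, 929, 931, 942, 966, 969, 991, 1007, 1010, 1025, 1028, 1032, 1039, 1059, 1073, 1079, 1102, 1105, 1113, 1120, 1125, 1139, 1146, 1172, 1190, 1199, 1204, 1212, 1245, 1258, 1262, 1281, 1299, 1301, 1309, 1315, 1338,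 1347, 1354, 1386, 1388, 1405, 1408, 1412, 1423, 1435, 1439, 1447, 1467, 1474, 1489, 1504, 1511, 1522, 1569, 1570, 1574, 1606, 1640, 1642, 1645, 1648, 1653, 1654, 1667, 1687, 1695, 1710, 1720, 1723, 1728, 1750, 1764. $D_{11}$ ($n=23$): 18, 19, 20, 21, 226, 227, 228, 229, 230, 231, 398, 399, 408, 409, 414, 427, 436, 437, 438, 439, 440, 441, 442, 449, 467, 490, 492, 502, 507, 519, 528, 543, 552, 585, 591, 603, 614, 618, 638, 658, 659, 679, 687, 702, 711, 720, 730, 735, 766, 767, 786, 790, 813, 822, 845, 850, 854, 862, 880, 881, 908, 911, 933, 945, 946, 971, 972, 973, 987, 1021, 1023, 1026, 1054, 1056, 1078, 1083, 1098, 1105, 1114, 1115, 1135, 1149, 1154, 1171, 1182, 1188, 1191, 1212, 1247, 1255, 1257, 1278, 1287, 1297, 1306, 1344, 1360, 1371, 1383, 1387, 1400, 1412, 1414, 1421, 1427, 1439, 1446, 1455, 1459, 1470, 1496, 1507, 1525, 1535, 1543, 1567, 1583, 1587, 1595, 1610, 1617, 1620, 1626, 1630, 1633, 1645, 1660, 1697, 1701, 1730, 1768, 1769, 1770, 1771. *)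

theory Defs
  imports "HOL-Analysis.Analysis" "HOL-Library.Extended_Nat"
begin

section \<open>Matroids\<close>

text \<open>A matroid is given by its ground set and its family of independent sets.\<close>

record 'e matroid =
  ground :: "'e set"
  indep :: "'e set set"

definition is_matroid :: "'e matroid \<Rightarrow> bool" where
  "is_matroid L \<longleftrightarrow>
     finite (ground L) \<and>
     (\<forall>X \<in> indep L. X \<subseteq> ground L) \<and>
     {} \<in> indep L \<and>
     (\<forall>X \<in> indep L. \<forall>Y. Y \<subseteq> X \<longrightarrow> Y \<in> indep L) \<and>
     (\<forall>X \<in> indep L. \<forall>Y \<in> indep L. card X < card Y \<longrightarrow>
        (\<exists>y \<in> Y - X. insert y X \<in> indep L))"

definition rk :: "'e matroid \<Rightarrow> 'e set \<Rightarrow> nat" where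
  "rk L S = Max (card ` {X \<in> indep L. X \<subseteq> S})"

definition simple_matroid :: "'e matroid \<Rightarrow> bool" where
  "simple_matroid L \<longleftrightarrow> is_matroid L \<and> (\<forall>i \<in> ground L. \<forall>j \<in> ground L. {i, j} \<in> indep L)"

definition rank_three_matroid :: "'e matroid \<Rightarrow> bool" where
  "rank_three_matroid L \<longleftrightarrow> simple_matroid L \<and> rk L (ground L) = 3"

definition flats :: "'e matroid \<Rightarrow> 'e set set" where
  "flats L = {F. F \<subseteq> ground L \<and> (\<forall>x \<in> ground L - F. rk L F < rk L (insert x F))}"

definition points :: "'e matroid \<Rightarrow> 'e set set" where
  "points L = {v \<in> flats L. rk L v = 2}"

definition sigma :: "'e matroid \<Rightarrow> int" where
  "sigma L = 3 + (\<Sum>v \<in> points L. int (card v) - 3)"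

definition combinatorially_simplicial :: "'e matroid \<Rightarrow> bool" where
  "combinatorially_simplicial L \<longleftrightarrow> sigma L = 0"

definition matroid_isomorphic :: "'e matroid \<Rightarrow> 'f matroid \<Rightarrow> bool" where
  "matroid_isomorphic L L' \<longleftrightarrow>
     (\<exists>f. bij_betw f (ground L) (ground L') \<and>
          (\<forall>X. X \<subseteq> ground L \<longrightarrow> (X \<in> indep L \<longleftrightarrow> f ` X \<in> indep L')))"


section \<open>Realizations\<close>

text \<open>
  A \<open>3 \<times> \<ell>\<close> matrix over \<open>K\<close> is the family of its columns, indexed by the ground set of the
  matroid; it is \<open>undefined\<close> off the ground set, so that equality of functions is
  equality of matrices.
\<close>

type_synonym ('e, 'k) columns = "'e \<Rightarrow> 'k ^ 3"

definition matrices :: "'e set \<Rightarrow> ('e, 'k) columns set" where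
  "matrices E = E \<rightarrow>\<^sub>E UNIV"

definition form_kernel :: "'k::field ^ 3 \<Rightarrow> ('k ^ 3) set" where
  "form_kernel m = {x. (\<Sum>j\<in>UNIV. m $ j * x $ j) = 0}"

definition intersection_lattice :: "'e set \<Rightarrow> ('e, 'k::field) columns \<Rightarrow> ('k ^ 3) set set" where
  "intersection_lattice E M = {(\<Inter>i\<in>S. form_kernel (M i)) | S. S \<subseteq> E}"

text \<open>
  The intersection lattice is ordered by reverse inclusion and graded by codimension, the
  lattice of flats by inclusion and rank. As the matroids considered are simple, the atom
  belonging to the line \<open>i\<close> is the flat \<open>{i}\<close>.
\<close>

definition realizations :: "'e matroid \<Rightarrow> ('e, 'k::field) columns set" where
  "realizations L = {M \<in> matrices (ground L).
     (\<forall>i \<in> ground L. vec.dim (form_kernel (M i)) = 2) \<and>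
     inj_on (\<lambda>i. form_kernel (M i)) (ground L) \<and>
     (\<exists>\<phi>. bij_betw \<phi> (flats L) (intersection_lattice (ground L) M) \<and>
          (\<forall>F \<in> flats L. \<forall>G \<in> flats L. F \<subseteq> G \<longleftrightarrow> \<phi> G \<subseteq> \<phi> F) \<and>
          (\<forall>F \<in> flats L. rk L F + vec.dim (\<phi> F) = 3) \<and>
          (\<forall>i \<in> ground L. \<phi> {i} = form_kernel (M i)))}"

definition realizable_over :: "'k::field itself \<Rightarrow> 'e matroid \<Rightarrow> bool" where
  "realizable_over K L \<longleftrightarrow> (realizations L :: ('e, 'k) columns set) \<noteq> {}"


section \<open>Zariski topology and dimension\<close>

inductive_set polynomial_functions :: "'e set \<Rightarrow> (('e, 'k::field) columns \<Rightarrow> 'k) set"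
  for E :: "'e set" where
  const: "(\<lambda>M. c) \<in> polynomial_functions E"
| coord: "i \<in> E \<Longrightarrow> (\<lambda>M. M i $ j) \<in> polynomial_functions E"
| add: "f \<in> polynomial_functions E \<Longrightarrow> g \<in> polynomial_functions E \<Longrightarrow>
    (\<lambda>M. f M + g M) \<in> polynomial_functions E"
| mult: "f \<in> polynomial_functions E \<Longrightarrow> g \<in> polynomial_functions E \<Longrightarrow>
    (\<lambda>M. f M * g M) \<in> polynomial_functions E"

definition zariski_topology :: "'e set \<Rightarrow> ('e, 'k::field) columns topology" where
  "zariski_topology E =
     topology_generated_by {{M \<in> matrices E. f M \<noteq> 0} | f. f \<in> polynomial_functions E}"

definition quotient_topology :: "'a topology \<Rightarrow> ('a \<Rightarrow> 'b) \<Rightarrow> 'b topology" where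
  "quotient_topology X q =
     topology (\<lambda>V. V \<subseteq> q ` topspace X \<and> openin X {x \<in> topspace X. q x \<in> V})"

text \<open>The constant \<^const>\<open>topology\<close> is only meaningful on families satisfying
  \<^const>\<open>istopology\<close>, hence the next two facts.\<close>

lemma istopology_quotient:
  "istopology (\<lambda>V. V \<subseteq> q ` topspace X \<and> openin X {x \<in> topspace X. q x \<in> V})"
proof -
  have int: "{x \<in> topspace X. q x \<in> S \<inter> T} =
        {x \<in> topspace X. q x \<in> S} \<inter> {x \<in> topspace X. q x \<in> T}" for S T
    by blast
  have un: "{x \<in> topspace X. q x \<in> \<Union>\<K>} = \<Union>((\<lambda>V. {x \<in> topspace X. q x \<in> V}) ` \<K>)" for \<K>
    by blast
  show ?thesis
    unfolding istopology_def int un by (intro conjI allI impI openin_Int openin_Union) auto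
qed

lemma openin_quotient_topology:
  "openin (quotient_topology X q) V \<longleftrightarrow>
     V \<subseteq> q ` topspace X \<and> openin X {x \<in> topspace X. q x \<in> V}"
  unfolding quotient_topology_def by (simp only: topology_inverse'[OF istopology_quotient])

definition irreducible_closedin :: "'a topology \<Rightarrow> 'a set \<Rightarrow> bool" where
  "irreducible_closedin X Z \<longleftrightarrow> closedin X Z \<and> Z \<noteq> {} \<and>
     (\<forall>A B. closedin X A \<and> closedin X B \<and> Z = A \<union> B \<longrightarrow> Z = A \<or> Z = B)"

text \<open>
  The dimension of a variety is the Krull dimension of its underlying Zariski space. As a
  supremum in \<^typ>\<open>enat\<close>, it is \<open>0\<close> for the empty space.
\<close>

definition krull_dim :: "'a topology \<Rightarrow> enat" where
  "krull_dim X = Sup {enat n | n. \<exists>Z :: nat \<Rightarrow> 'a set.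
     (\<forall>i\<le>n. irreducible_closedin X (Z i)) \<and> (\<forall>i<n. Z i \<subset> Z (Suc i))}"


section \<open>The moduli space\<close>

definition torus_orbit :: "'e set \<Rightarrow> ('e, 'k::field) columns \<Rightarrow> ('e, 'k) columns set" where
  "torus_orbit E M = {(\<lambda>i\<in>E. c i *s M i) | c. \<forall>i\<in>E. c i \<noteq> 0}"

text \<open>An element of \<open>PGL(3,K)\<close> is the class of all non-zero multiples of an invertible matrix.\<close>

definition PGL3 :: "('k::field ^ 3 ^ 3) set set" where
  "PGL3 = {{(\<chi> i j. c * g $ i $ j) | c. c \<noteq> 0} | g. invertible g}"

text \<open>
  An element of \<open>PGL(3,K)\<close> acts on a torus orbit \<open>A\<close> through its representatives. They all
  give the same result, since \<open>A\<close> is closed under rescaling of columns.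
\<close>

definition PGL_act ::
    "'e set \<Rightarrow> ('k::field ^ 3 ^ 3) set \<Rightarrow> ('e, 'k) columns set \<Rightarrow> ('e, 'k) columns set" where
  "PGL_act E P A = {(\<lambda>i\<in>E. g *v M i) | g M. g \<in> P \<and> M \<in> A}"

definition PGL_orbit ::
    "'e set \<Rightarrow> ('e, 'k::field) columns set \<Rightarrow> ('e, 'k) columns set set" where
  "PGL_orbit E A = {PGL_act E P A | P. P \<in> PGL3}"

text \<open>
  The double quotient of the set of realizations, with the quotient of the Zariski topology.
  Its underlying set is the \<^const>\<open>topspace\<close>.
\<close>

definition moduli_space :: "'e matroid \<Rightarrow> ('e, 'k::field) columns set set topology" where
  "moduli_space L =
     quotient_topology
       (quotient_topology
          (subtopology (zariski_topology (ground L)) (realizations L))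
          (torus_orbit (ground L)))
       (PGL_orbit (ground L))"


section \<open>The eleven matroids\<close>

text \<open>All triples \<open>a < b < c\<close> in \<open>{1..n}\<close>, in lexicographic order.\<close>

definition triples :: "nat \<Rightarrow> (nat \<times> nat \<times> nat) list" where
  "triples n = [(a, b, c). a \<leftarrow> [1..<n + 1], b \<leftarrow> [a + 1..<n + 1], c \<leftarrow> [b + 1..<n + 1]]"

text \<open>The indices in \<open>D\<close> start from \<open>1\<close>, whereas list access starts from \<open>0\<close>.\<close>

definition encoded_triples :: "nat \<Rightarrow> nat list \<Rightarrow> (nat \<times> nat \<times> nat) set" where
  "encoded_triples n D = {triples n ! (i - 1) | i. i \<in> set D \<and> 1 \<le> i \<and> i \<le> length (triples n)}"

definition encoded_matroid :: "nat \<Rightarrow> nat list \<Rightarrow> nat matroid" where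
  "encoded_matroid n D =
     \<lparr> ground = {1..n},
       indep = {X. X \<subseteq> {1..n} \<and> card X \<le> 3 \<and>
         (\<forall>a b c. a < b \<and> b < c \<and> X = {a, b, c} \<longrightarrow> (a, b, c) \<notin> encoded_triples n D)} \<rparr>"

definition D1 :: "nat list" where
  "D1 =
    [96, 97, 98, 99, 100, 101, 102, 103, 104, 105, 108, 109, 110, 127, 137, 142, 143, 152, 173,
     180, 186, 206, 219, 220, 221, 230, 249, 256, 263, 278, 279, 280, 291, 304, 311, 313, 314,
     320, 349, 356, 365, 368, 369, 375, 396, 419, 423, 427, 454, 457, 464, 480, 489, 490, 505,
     551, 552, 553, 554, 555, 556, 557, 558, 559, 560]"

definition D2 :: "nat list" where
  "D2 =
    [188, 189, 190, 194, 199, 213, 223, 231, 235, 251, 253, 261, 279, 293, 310, 332, 340, 348,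
     394, 403, 414, 428, 431, 441, 444, 449, 458, 468, 481, 489, 509, 525, 541, 546, 559, 572,
     582, 587, 592, 596, 619, 623, 628, 634, 652, 658, 671, 685, 695, 711, 713, 719, 762, 766,
     782, 790, 808, 811, 820, 822, 839, 862, 888, 889, 914, 948, 952, 955, 959, 975, 983, 997,
     1007, 1011, 1060, 1076, 1082, 1085, 1095, 1119, 1129, 1134, 1139, 1157, 1201, 1204, 1207,
     1214, 1222, 1226, 1229, 1234, 1251, 1259, 1279, 1298, 1313, 1323, 1330]"

definition D3 :: "nat list" where
  "D3 =
    [188, 189, 190, 201, 209, 225, 241, 246, 259, 269, 271, 279, 291, 305, 319, 330, 349, 368,
     374, 386, 393, 409, 410, 445, 453, 457, 465, 473, 485, 497, 530, 536, 543, 552, 556, 561,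
     579, 601, 612, 626, 634, 658, 661, 670, 687, 693, 719, 741, 745, 765, 772, 778, 803, 812,
     837, 850, 862, 864, 871, 894, 910, 913, 916, 933, 942, 958, 974, 990, 998, 1007, 1009,
     1014, 1021, 1026, 1029, 1041, 1063, 1066, 1074, 1082, 1088, 1117, 1122, 1148, 1151, 1155,
     1159, 1173, 1177, 1189, 1218, 1237, 1251, 1255, 1275, 1307, 1314, 1316, 1330]"

definition D4 :: "nat list" where
  "D4 =
    [188, 189, 190, 195, 196, 211, 239, 248, 250, 271, 301, 306, 313, 318, 327, 351, 354, 374,
     387, 388, 420, 421, 424, 451, 469, 473, 477, 487, 503, 509, 518, 520, 538, 544, 567, 574,
     586, 592, 611, 620, 628, 635, 651, 683, 694, 714, 739, 742, 743, 756, 767, 793, 794, 798,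
     825, 828, 839, 841, 853, 863, 866, 888, 899, 901, 904, 914, 922, 926, 934, 946, 961, 983,
     991, 998, 1015, 1021, 1035, 1068, 1072, 1085, 1089, 1093, 1097, 1104, 1113, 1126, 1155,
     1157, 1181, 1191, 1198, 1214, 1229, 1235, 1248, 1271, 1289, 1306, 1330]"

definition D5 :: "nat list" where
  "D5 =
    [188, 189, 190, 221, 223, 234, 251, 253, 261, 269, 283, 284, 308, 310, 324, 327, 348, 353,
     371, 377, 386, 389, 396, 405, 412, 413, 432, 439, 449, 481, 492, 497, 511, 518, 527, 536,
     546, 581, 589, 595, 600, 628, 635, 642, 664, 677, 683, 686, 701, 711, 725, 728, 737, 772,
     784, 793, 809, 812, 828, 848, 862, 900, 901, 929, 935, 940, 947, 970, 976, 984, 988, 992,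
     1002, 1014, 1033, 1064, 1080, 1085, 1090, 1141, 1142, 1150, 1154, 1160, 1170, 1171, 1176,
     1201, 1211, 1218, 1225, 1234, 1237, 1253, 1267, 1290, 1306, 1314, 1330]"

definition D6 :: "nat list" where
  "D6 =
    [185, 186, 231, 366, 370, 375, 382, 383, 384, 400, 405, 406, 407, 412, 414, 419, 425, 431,
     432, 433, 436, 456, 460, 462, 473, 485, 506, 513, 520, 533, 537, 547, 557, 567, 607, 625,
     629, 639, 647, 653, 658, 667, 702, 710, 716, 733, 741, 755, 765, 776, 796, 815, 818, 830,
     843, 850, 851, 878, 908, 911, 934, 937, 948, 957, 959, 977, 983, 988, 1005, 1029, 1052,
     1071, 1084, 1090, 1108, 1123, 1148, 1156, 1169, 1173, 1183, 1186, 1194, 1207, 1214, 1215,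
     1232, 1249, 1251, 1277, 1286, 1295, 1302, 1342, 1370, 1375, 1383, 1392, 1395, 1412, 1417,
     1425, 1429, 1445, 1462, 1474, 1482, 1500, 1502, 1510, 1515, 1528, 1532, 1541, 1578, 1595,
     1597, 1598, 1601, 1608, 1618, 1620, 1632, 1638, 1651, 1670, 1677, 1688, 1693, 1699, 1702,
     1720, 1762]"

definition D7 :: "nat list" where
  "D7 =
    [185, 186, 231, 368, 369, 371, 377, 384, 385, 403, 404, 408, 410, 413, 414, 416, 422, 428,
     431, 438, 439, 450, 470, 471, 482, 489, 496, 509, 524, 537, 539, 547, 556, 571, 596, 625,
     627, 636, 644, 651, 668, 682, 711, 719, 728, 734, 740, 760, 763, 772, 784, 795, 803, 840,
     841, 853, 860, 872, 886, 896, 901, 920, 939, 954, 988, 990, 1007, 1015, 1033, 1048, 1055,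
     1062, 1070, 1077, 1079, 1083, 1104, 1120, 1126, 1132, 1134, 1162, 1163, 1170, 1177, 1189,
     1202, 1212, 1245, 1249, 1255, 1261, 1262, 1284, 1292, 1301, 1305, 1331, 1348, 1363, 1384,
     1387, 1403, 1419, 1420, 1422, 1432, 1445, 1463, 1480, 1521, 1524, 1526, 1532, 1540, 1553,
     1568, 1569, 1591, 1604, 1625, 1634, 1642, 1651, 1666, 1669, 1685, 1702, 1705, 1712, 1717,
     1753, 1758]"

definition D8 :: "nat list" where
  "D8 =
    [175, 176, 231, 366, 367, 370, 389, 392, 396, 397, 400, 408, 416, 420, 423, 424, 425, 435,
     436, 437, 439, 445, 451, 467, 475, 487, 491, 497, 517, 546, 547, 564, 573, 581, 599, 604,
     630, 636, 650, 666, 682, 688, 707, 709, 726, 739, 741, 768, 778, 791, 794, 805, 818, 820,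
     863, 883, 889, 897, 901, 908, 917, 920, 940, 941, 971, 975, 999, 1008, 1011, 1018, 1043,
     1049, 1059, 1079, 1122, 1123, 1141, 1142, 1146, 1168, 1174, 1181, 1189, 1191, 1202, 1212,
     1213, 1226, 1263, 1270, 1287, 1293, 1297, 1303, 1306, 1313, 1317, 1345, 1347, 1356, 1368,
     1379, 1381, 1399, 1420, 1449, 1454, 1458, 1473, 1478, 1494, 1507, 1510, 1518, 1536, 1542,
     1566, 1572, 1580, 1606, 1613, 1622, 1626, 1630, 1645, 1654, 1665, 1730, 1746, 1747, 1749,
     1758, 1768]"

definition D9 :: "nat list" where
  "D9 =
    [200, 202, 227, 340, 344, 350, 354, 356, 361, 364, 370, 371, 381, 382, 390, 396, 398, 403,
     418, 426, 427, 458, 460, 466, 477, 485, 490, 508, 517, 518, 529, 547, 564, 581, 587, 606,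
     630, 641, 653, 655, 678, 681, 683, 694, 708, 713, 730, 750, 761, 795, 801, 813, 816, 822,
     825, 845, 848, 860, 867, 888, 893, 919, 937, 943, 963, 964, 985, 991, 1002, 1023, 1041,
     1056, 1073, 1085, 1095, 1106, 1118, 1123, 1136, 1156, 1176, 1191, 1204, 1222, 1234, 1240,
     1261, 1272, 1289, 1304, 1317, 1321, 1333, 1356, 1362, 1381, 1385, 1392, 1396, 1411, 1442,
     1447, 1462, 1472, 1485, 1491, 1492, 1527, 1530, 1537, 1548, 1553, 1564, 1569, 1590, 1592,
     1601, 1611, 1612, 1636, 1642, 1649, 1664, 1671, 1678, 1696, 1698, 1705, 1707, 1711, 1725,
     1733, 1743]"

definition D10 :: "nat list" where
  "D10 =
    [138, 139, 229, 351, 352, 356, 364, 368, 379, 392, 393, 396, 397, 399, 400, 407, 408, 421,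
     432, 435, 438, 457, 459, 462, 481, 486, 518, 519, 531, 553, 555, 563, 570, 584, 596, 617,
     627, 638, 647, 651, 670, 676, 701, 703, 720, 730, 745, 749, 759, 792, 798, 818, 836, 837,
     851, 880, 885, 898, 904, 915, 927, 929, 931, 942, 966, 969, 991, 1007, 1010, 1025, 1028,
     1032, 1039, 1059, 1073, 1079, 1102, 1105, 1113, 1120, 1125, 1139, 1146, 1172, 1190, 1199,
     1204, 1212, 1245, 1258, 1262, 1281, 1299, 1301, 1309, 1315, 1338, 1347, 1354, 1386, 1388,
     1405, 1408, 1412, 1423, 1435, 1439, 1447, 1467, 1474, 1489, 1504, 1511, 1522, 1569, 1570,
     1574, 1606, 1640, 1642, 1645, 1648, 1653, 1654, 1667, 1687, 1695, 1710, 1720, 1723, 1728,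
     1750, 1764]"

definition D11 :: "nat list" where
  "D11 =
    [18, 19, 20, 21, 226, 227, 228, 229, 230, 231, 398, 399, 408, 409, 414, 427, 436, 437, 438,
     439, 440, 441, 442, 449, 467, 490, 492, 502, 507, 519, 528, 543, 552, 585, 591, 603, 614,
     618, 638, 658, 659, 679, 687, 702, 711, 720, 730, 735, 766, 767, 786, 790, 813, 822, 845,
     850, 854, 862, 880, 881, 908, 911, 933, 945, 946, 971, 972, 973, 987, 1021, 1023, 1026,
     1054, 1056, 1078, 1083, 1098, 1105, 1114, 1115, 1135, 1149, 1154, 1171, 1182, 1188, 1191,
     1212, 1247, 1255, 1257, 1278, 1287, 1297, 1306, 1344, 1360, 1371, 1383, 1387, 1400, 1412,
     1414, 1421, 1427, 1439, 1446, 1455, 1459, 1470, 1496, 1507, 1525, 1535, 1543, 1567, 1583,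
     1587, 1595, 1610, 1617, 1620, 1626, 1630, 1633, 1645, 1660, 1697, 1701, 1730, 1768, 1769,
     1770, 1771]"

definition matroids :: "nat matroid list" where
  "matroids =
    [encoded_matroid 16 D1,
     encoded_matroid 21 D2,
     encoded_matroid 21 D3,
     encoded_matroid 21 D4,
     encoded_matroid 21 D5,
     encoded_matroid 23 D6,
     encoded_matroid 23 D7,
     encoded_matroid 23 D8,
     encoded_matroid 23 D9,
     encoded_matroid 23 D10,
     encoded_matroid 23 D11]"

end

theory Submission
  imports Defs "HOL-Computational_Algebra.Fundamental_Theorem_Algebra" "HOL-Library.Code_Binary_Nat"
begin

text \<open>
  Each of the eleven arrangements splits into a rigid part and one free line. Line \<open>1\<close> passes
  through a single point with more than two lines, and nothing else restricts it, so it may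
  rotate in the pencil through that point. The remaining lines can be constructed from a
  projective frame and one further line by joining points and intersecting lines. The only
  parameter of the construction is the coordinate \<open>x\<close> of that further line, and one superfluous
  incidence forces \<open>x\<close> to be a root of a fixed monic integer polynomial: \<open>x\<^sup>4 - x\<^sup>3 + x\<^sup>2 - x + 1\<close>
  for \<open>D1\<close> (a primitive tenth root of unity) and \<open>x\<^sup>2 - x + 2\<close> for the others (the field
  \<open>\<rat>(\<surd>-7)\<close>). Neither has a real root, so there is no real realization. Over the complex numbers
  the moduli space is a finite disjoint union of curves, one for each root, and each curve is a
  line with finitely many points removed, parametrized by the position \<open>t\<close> of line \<open>1\<close>.

  The proof has a general part and a computation. The general part consists of four pieces.
  A linear space (lines and points, any two lines sharing exactly one point) defines a matroid
  whose rank-two flats are its points, and a realization is the same as a family of vectors whose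
  vanishing \<open>3 \<times> 3\<close> determinants are the prescribed ones (\<open>realizations_iff\<close>). Points of the
  moduli space are classes of realizations modulo projective maps and rescaling
  (\<open>moduli_point_eq_iff\<close>). A space that is a finite union of closed curves, on each of which
  closed sets are finite or everything, has dimension one (\<open>krull_dim_curves\<close>); two cross ratios
  separate the curves and their points (\<open>krull_dim_moduli_space_pencils\<close>). Finally, a certificate
  consisting of the points, of coordinates in \<open>\<int>[x]\<close> and of two construction sequences implies all
  the claims about one matroid (\<open>certificate.certified\<close>).

  The computation checks eleven certificates by rewriting. The matroids are told apart by an
  isomorphism invariant in the style of colour refinement (\<open>matroid_isomorphic_weight\<close>).
\<close>

section \<open>Vectors in three-space over a field\<close>

definition dot3 :: "'k::field ^ 3 \<Rightarrow> 'k ^ 3 \<Rightarrow> 'k" where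
  "dot3 u v = u $ 1 * v $ 1 + u $ 2 * v $ 2 + u $ 3 * v $ 3"

definition cross_prod :: "'k::field ^ 3 \<Rightarrow> 'k ^ 3 \<Rightarrow> 'k ^ 3" where
  "cross_prod u v = vector [u $ 2 * v $ 3 - u $ 3 * v $ 2,
                            u $ 3 * v $ 1 - u $ 1 * v $ 3,
                            u $ 1 * v $ 2 - u $ 2 * v $ 1]"

definition det3 :: "'k::field ^ 3 \<Rightarrow> 'k ^ 3 \<Rightarrow> 'k ^ 3 \<Rightarrow> 'k" where
  "det3 u v w = dot3 (cross_prod u v) w"

definition parallel :: "'k::field ^ 3 \<Rightarrow> 'k ^ 3 \<Rightarrow> bool" where
  "parallel u v \<longleftrightarrow> (\<exists>c. c \<noteq> 0 \<and> u = c *s v)"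

lemma form_kernel_iff: "x \<in> form_kernel m \<longleftrightarrow> dot3 m x = 0"
  by (simp add: form_kernel_def dot3_def sum_3)

lemma vec3_eq_iff: "u = (v :: 'k ^ 3) \<longleftrightarrow> u $ 1 = v $ 1 \<and> u $ 2 = v $ 2 \<and> u $ 3 = v $ 3"
  by (simp add: vec_eq_iff forall_3)

lemma cross_prod_nth [simp]:
  "cross_prod u v $ 1 = u $ 2 * v $ 3 - u $ 3 * v $ 2"
  "cross_prod u v $ 2 = u $ 3 * v $ 1 - u $ 1 * v $ 3"
  "cross_prod u v $ 3 = u $ 1 * v $ 2 - u $ 2 * v $ 1"
  by (simp_all add: cross_prod_def)

lemma cross_prod_eq_0_imp_multiple:
  assumes "cross_prod x y = 0" and "y \<noteq> 0"
  shows "\<exists>c. x = c *s y"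
proof -
  have eqs: "x $ 2 * y $ 3 = x $ 3 * y $ 2" "x $ 3 * y $ 1 = x $ 1 * y $ 3"
      "x $ 1 * y $ 2 = x $ 2 * y $ 1"
    using assms(1) by (simp_all add: vec3_eq_iff)
  have "y $ 1 \<noteq> 0 \<or> y $ 2 \<noteq> 0 \<or> y $ 3 \<noteq> 0"
    using assms(2) by (simp add: vec3_eq_iff)
  then obtain j where j: "j = 1 \<or> j = 2 \<or> j = 3" "y $ j \<noteq> 0" by blast
  have "x = (x $ j / y $ j) *s y"
    using j eqs by (auto simp: vec3_eq_iff field_simps)
  then show ?thesis by blast
qed

lemma cross_prod_0 [simp]: "cross_prod 0 u = 0" "cross_prod u 0 = 0" "cross_prod u u = 0"
  by (simp_all add: vec3_eq_iff)

lemma dot3_cross_prod [simp]: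
  "dot3 (cross_prod u v) u = 0" "dot3 (cross_prod u v) v = 0"
  "dot3 u (cross_prod u v) = 0" "dot3 v (cross_prod u v) = 0"
  by (simp_all add: dot3_def algebra_simps)

lemma dot3_commute: "dot3 u v = dot3 v u"
  by (simp add: dot3_def mult.commute)

lemma dot3_scale [simp]: "dot3 (c *s u) v = c * dot3 u v" "dot3 u (c *s v) = c * dot3 u v"
  by (simp_all add: dot3_def algebra_simps)

lemma dot3_add: "dot3 u (x + y) = dot3 u x + dot3 u y"
  and dot3_diff: "dot3 u (x - y) = dot3 u x - dot3 u y"
  by (simp_all add: dot3_def algebra_simps)

lemma dot3_0 [simp]: "dot3 0 u = 0" "dot3 u 0 = 0"
  by (simp_all add: dot3_def)

lemma cross_prod_cross_prod:
  "cross_prod x (cross_prod u v) = dot3 x v *s u - dot3 x u *s v"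
  by (simp add: vec3_eq_iff dot3_def algebra_simps)

lemma cross_prod_scale:
  "cross_prod (c *s u) v = c *s cross_prod u v" "cross_prod u (c *s v) = c *s cross_prod u v"
  by (simp_all add: vec3_eq_iff algebra_simps)

text \<open>Two independent forms vanish together exactly on the line spanned by their cross product.\<close>

lemma orthogonal_to_both:
  assumes "dot3 u x = 0" "dot3 v x = 0" "cross_prod u v \<noteq> 0"
  shows "\<exists>c. x = c *s cross_prod u v"
  by (rule cross_prod_eq_0_imp_multiple)
     (use assms in \<open>simp_all add: cross_prod_cross_prod dot3_commute[of x]\<close>)

lemma det3_cyclic: "det3 u v w = det3 v w u"
  and det3_swap: "det3 v u w = - det3 u v w"
  by (simp_all add: det3_def dot3_def algebra_simps)

lemma det3_same [simp]: "det3 u u w = 0" "det3 u w u = 0" "det3 w u u = 0"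
  by (simp_all add: det3_def dot3_def algebra_simps)

lemma det3_scale:
  "det3 (a *s u) (b *s v) (c *s w) = a * b * c * det3 u v w"
  by (simp add: det3_def dot3_def algebra_simps)

lemma det3_swap': "det3 u w v = - det3 u v w"
  by (simp add: det3_def dot3_def algebra_simps)

lemma det3_eq_0_perm:
  "det3 u v w = 0 \<longleftrightarrow> det3 v u w = 0"
  "det3 u v w = 0 \<longleftrightarrow> det3 u w v = 0"
  by (simp_all add: det3_swap[of u v] det3_swap'[of u w])

lemma det3_nonzero_imp:
  assumes "det3 u v w \<noteq> 0"
  shows "cross_prod u v \<noteq> 0" "cross_prod v w \<noteq> 0" "cross_prod w u \<noteq> 0" "u \<noteq> 0" "v \<noteq> 0" "w \<noteq> 0"
proof -
  have *: "det3 v w u \<noteq> 0" "det3 w u v \<noteq> 0"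
    using assms det3_cyclic[of u v w] det3_cyclic[of v w u] by auto
  show "cross_prod u v \<noteq> 0" "cross_prod v w \<noteq> 0" "cross_prod w u \<noteq> 0"
      "u \<noteq> 0" "v \<noteq> 0" "w \<noteq> 0"
    using assms * unfolding det3_def by auto
qed

lemma det3_matrix_mult:
  fixes g :: "'k::field ^ 3 ^ 3"
  shows "det3 (g *v u) (g *v v) (g *v w) = det g * det3 u v w"
  unfolding det3_def dot3_def cross_prod_nth matrix_vector_mult_def det_3 sum_3
  by (simp add: algebra_simps)

lemma subspace_form_kernel: "vec.subspace (form_kernel m)"
  by (simp add: vec.subspace_def form_kernel_iff dot3_add)

text \<open>A non-zero form is non-zero on some coordinate vector, which spans a complement of its kernel.
  This gives the dimension of the kernel below.\<close>

lemma exists_nonorthogonal: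
  assumes "m \<noteq> 0" shows "\<exists>p. dot3 m p \<noteq> 0"
proof -
  have "dot3 m (vector [1, 0, 0]) = m $ 1" "dot3 m (vector [0, 1, 0]) = m $ 2"
      "dot3 m (vector [0, 0, 1]) = m $ 3"
    by (simp_all add: dot3_def)
  then show ?thesis using assms by (metis vec3_eq_iff zero_index)
qed

lemma dim_form_kernel: "vec.dim (form_kernel m) = 2 \<longleftrightarrow> m \<noteq> (0 :: 'k::field ^ 3)"
proof (cases "m = 0")
  case True
  then have "form_kernel m = UNIV" by (auto simp: form_kernel_iff)
  then show ?thesis using True by (simp add: vec_dim_card del: vec.dim_UNIV)
next
  case False
  then obtain p where mp: "dot3 m p \<noteq> 0"
    using exists_nonorthogonal by blast
  have "x \<in> vec.span (insert p (form_kernel m))" for x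
  proof -
    define q where "q = x - (dot3 m x / dot3 m p) *s p"
    have "dot3 m q = 0"
      using mp by (simp add: q_def dot3_diff)
    then have "q \<in> vec.span (insert p (form_kernel m))"
      by (intro vec.span_base) (simp add: form_kernel_iff)
    moreover have "(dot3 m x / dot3 m p) *s p \<in> vec.span (insert p (form_kernel m))"
      by (intro vec.span_scale vec.span_base) simp
    ultimately have "q + (dot3 m x / dot3 m p) *s p \<in> vec.span (insert p (form_kernel m))"
      by (rule vec.span_add)
    then show ?thesis by (simp add: q_def)
  qed
  then have "vec.span (insert p (form_kernel m)) = UNIV" by blast
  then have "vec.dim (insert p (form_kernel m)) = vec.dim (UNIV :: ('k ^ 3) set)"
    by (metis vec.dim_span)
  then have "vec.dim (insert p (form_kernel m)) = 3"
    by (simp add: vec_dim_card del: vec.dim_UNIV)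
  moreover have "p \<notin> vec.span (form_kernel m)"
    using mp subspace_form_kernel[of m] by (metis vec.span_eq_iff form_kernel_iff)
  ultimately show ?thesis using False by (simp add: vec.dim_insert)
qed

lemma form_kernel_Int:
  assumes "cross_prod u v \<noteq> 0"
  shows "form_kernel u \<inter> form_kernel v = vec.span {cross_prod u v}"
proof -
  have "x \<in> vec.span {cross_prod u v} \<longleftrightarrow> (\<exists>c. x = c *s cross_prod u v)" for x
    by (auto simp: vec.span_singleton)
  then show ?thesis
    using orthogonal_to_both[OF _ _ assms] by (auto simp: form_kernel_iff)
qed

lemma dim_form_kernel_Int:
  assumes "cross_prod u v \<noteq> 0"
  shows "vec.dim (form_kernel u \<inter> form_kernel v) = 1"
proof -
  have "vec.independent {cross_prod u v}"
    using assms by simp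
  then have "vec.dim {cross_prod u v} = card {cross_prod u v}"
    by (rule vec.dim_eq_card_independent)
  then show ?thesis
    by (simp only: form_kernel_Int[OF assms] vec.dim_span) simp
qed

text \<open>The common zeros of two independent forms are the multiples of their cross product, and the third
  form takes the value of the determinant on that vector.\<close>

lemma form_kernel_Int_subset:
  assumes "cross_prod u v \<noteq> 0"
  shows "form_kernel u \<inter> form_kernel v \<subseteq> form_kernel w \<longleftrightarrow> det3 u v w = 0"
proof
  show "det3 u v w = 0" if "form_kernel u \<inter> form_kernel v \<subseteq> form_kernel w"
  proof -
    have "cross_prod u v \<in> form_kernel u \<inter> form_kernel v" by (simp add: form_kernel_iff)
    then have "cross_prod u v \<in> form_kernel w" using that by blast
    then show ?thesis by (simp add: form_kernel_iff det3_def dot3_commute)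
  qed
  show "form_kernel u \<inter> form_kernel v \<subseteq> form_kernel w" if "det3 u v w = 0"
  proof
    fix x assume "x \<in> form_kernel u \<inter> form_kernel v"
    then obtain c where "x = c *s cross_prod u v"
      using orthogonal_to_both[OF _ _ assms] by (auto simp: form_kernel_iff)
    then show "x \<in> form_kernel w"
      using that by (simp add: form_kernel_iff det3_def dot3_commute)
  qed
qed

lemma form_kernel_eq:
  assumes "cross_prod u v = 0" "u \<noteq> 0" "v \<noteq> 0"
  shows "form_kernel u = form_kernel v"
proof -
  obtain c where c: "u = c *s v" using cross_prod_eq_0_imp_multiple assms by blast
  then have "c \<noteq> 0" using assms(2) by auto
  then show ?thesis unfolding c by (auto simp: form_kernel_iff)
qed

section \<open>Matroids of linear spaces\<close>

text \<open>Lines are the elements of \<open>E\<close>, points are the sets \<open>B \<in> BB\<close> of lines through them; double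
  points are included. As no point lies on all lines, the matroid has rank three.\<close>

locale linear_space =
  fixes E :: "'e set" and BB :: "'e set set"
  assumes finite_E: "finite E"
    and block_subset: "B \<in> BB \<Longrightarrow> B \<subset> E"
    and block_two: "B \<in> BB \<Longrightarrow> \<exists>i\<in>B. \<exists>j\<in>B. i \<noteq> j"
    and block_exists: "i \<in> E \<Longrightarrow> j \<in> E \<Longrightarrow> i \<noteq> j \<Longrightarrow> \<exists>B\<in>BB. i \<in> B \<and> j \<in> B"
    and block_unique: "\<lbrakk>B \<in> BB; B' \<in> BB; i \<noteq> j; {i, j} \<subseteq> B; {i, j} \<subseteq> B'\<rbrakk> \<Longrightarrow> B = B'"
    and block_nonempty: "BB \<noteq> {}"
begin

definition concurrent :: "'e set \<Rightarrow> bool" where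
  "concurrent X \<longleftrightarrow> (\<exists>B\<in>BB. X \<subseteq> B)"

definition L :: "'e matroid" where
  "L = \<lparr> ground = E, indep = {X. X \<subseteq> E \<and> card X \<le> 3 \<and> (card X = 3 \<longrightarrow> \<not> concurrent X)} \<rparr>"

lemma ground_L [simp]: "ground L = E"
  by (simp add: L_def)

lemma indep_L: "X \<in> indep L \<longleftrightarrow> X \<subseteq> E \<and> card X \<le> 3 \<and> (card X = 3 \<longrightarrow> \<not> concurrent X)"
  by (simp add: L_def)

lemma concurrent_mono: "concurrent Y \<Longrightarrow> X \<subseteq> Y \<Longrightarrow> concurrent X"
  unfolding concurrent_def by blast

lemma concurrent_pair:
  assumes "i \<in> E" "j \<in> E" shows "concurrent {i, j}"
proof (cases "i = j")
  case False
  then show ?thesis using block_exists assms unfolding concurrent_def by fastforce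
next
  case True
  obtain B where "B \<in> BB" using block_nonempty by blast
  obtain k where "k \<in> E" "k \<noteq> i"
    using block_two[OF \<open>B \<in> BB\<close>] block_subset[OF \<open>B \<in> BB\<close>] by blast
  then show ?thesis using True block_exists[OF assms(1) \<open>k \<in> E\<close>] unfolding concurrent_def by auto
qed

lemma not_concurrent_triple:
  assumes "\<not> concurrent {i, j, k}" "i \<in> E" "j \<in> E" "k \<in> E"
  shows "i \<noteq> j" "i \<noteq> k" "j \<noteq> k"
  using assms concurrent_pair[of i j] concurrent_pair[of i k] concurrent_pair[of j k]
  by (auto simp: insert_commute)

text \<open>Two lines have exactly one point in common, so every question about concurrency with two
  given lines is a question about that point.\<close>

lemma concurrent_iff_in_block:
  assumes "B \<in> BB" "i \<in> B" "j \<in> B" "i \<noteq> j"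
  shows "concurrent (insert i (insert j X)) \<longleftrightarrow> X \<subseteq> B"
proof
  assume "concurrent (insert i (insert j X))"
  then obtain B' where "B' \<in> BB" "insert i (insert j X) \<subseteq> B'" unfolding concurrent_def by blast
  then show "X \<subseteq> B" using block_unique[of B B' i j] assms by auto
qed (use assms in \<open>auto simp: concurrent_def\<close>)

lemma exists_not_concurrent:
  assumes "S \<subseteq> E" "\<not> concurrent S"
  shows "\<exists>i\<in>S. \<exists>j\<in>S. \<exists>k\<in>S. \<not> concurrent {i, j, k}"
proof -
  have "S \<noteq> {}" using assms block_nonempty unfolding concurrent_def by auto
  then obtain i where i: "i \<in> S" by blast
  have "S \<noteq> {i}" using concurrent_pair[of i i] i assms by auto
  then obtain j where j: "j \<in> S" "j \<noteq> i" using i by blast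
  obtain B where B: "B \<in> BB" "i \<in> B" "j \<in> B" using block_exists[of i j] i j assms by auto
  then obtain k where "k \<in> S" "k \<notin> B" using assms unfolding concurrent_def by blast
  then have "\<not> concurrent {i, j, k}"
    using concurrent_iff_in_block[of B i j "{k}"] B j by simp
  then show ?thesis using i j \<open>k \<in> S\<close> by blast
qed

lemma exists_third:
  assumes "i \<in> E" "j \<in> E" "i \<noteq> j"
  shows "\<exists>k\<in>E. \<not> concurrent {i, j, k}"
proof -
  obtain B where B: "B \<in> BB" "i \<in> B" "j \<in> B" using block_exists assms by blast
  then obtain k where "k \<in> E" "k \<notin> B" using block_subset by blast
  then show ?thesis using concurrent_iff_in_block[of B i j "{k}"] B assms by auto
qed

lemma card_triple:
  assumes "\<not> concurrent {i, j, k}" "i \<in> E" "j \<in> E" "k \<in> E"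
  shows "card {i, j, k} = 3"
  using not_concurrent_triple[OF assms] by simp

text \<open>Only the exchange of a pair against a triple has content: if no line of the triple could be
  added to the pair, all three would pass through the point of the pair.\<close>

lemma is_matroid_L: "is_matroid L"
  unfolding is_matroid_def
proof (intro conjI ballI allI impI)
  fix X Y assume XY: "X \<in> indep L" "Y \<in> indep L" "card X < card Y"
  have fin: "finite X" "finite Y" using XY finite_E by (auto simp: indep_L intro: finite_subset)
  show "\<exists>y\<in>Y - X. insert y X \<in> indep L"
  proof (cases "card X \<le> 1")
    case True
    obtain y where y: "y \<in> Y - X" using XY(3) fin by (metis card_mono not_le subsetI DiffI)
    then have "card (insert y X) \<le> 2" using True fin by simp
    then show ?thesis using y XY by (intro bexI[of _ y]) (auto simp: indep_L)
  next
    case False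
    then have card: "card X = 2" "card Y = 3" using XY by (auto simp: indep_L)
    then obtain i j where ij: "X = {i, j}" "i \<noteq> j" by (auto simp: card_2_iff)
    obtain B where B: "B \<in> BB" "i \<in> B" "j \<in> B"
      using block_exists[of i j] ij XY(1) by (auto simp: indep_L)
    have "\<not> Y \<subseteq> B" using XY(2) card B by (auto simp: indep_L concurrent_def)
    then obtain y where y: "y \<in> Y" "y \<notin> B" by blast
    then have "\<not> concurrent (insert y X)"
      using concurrent_iff_in_block[of B i j "{y}"] B ij by (simp add: insert_commute)
    moreover have "y \<noteq> i" "y \<noteq> j" using y B by auto
    then have "card (insert y X) = 3" using ij by simp
    ultimately show ?thesis
      using y B ij XY by (intro bexI[of _ y]) (auto simp: indep_L)
  qed
next
  fix X Y assume XY: "X \<in> indep L" "Y \<subseteq> X"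
  have X: "X \<subseteq> E" "card X \<le> 3" "card X = 3 \<longrightarrow> \<not> concurrent X"
    using XY(1) by (simp_all add: indep_L)
  have "finite X" using X(1) finite_E finite_subset by blast
  have "card Y \<le> card X" using card_mono[OF \<open>finite X\<close> XY(2)] .
  moreover have "Y = X" if "card Y = card X" using card_subset_eq[OF \<open>finite X\<close> XY(2) that] .
  ultimately have "card Y \<le> 3" "card Y = 3 \<longrightarrow> \<not> concurrent Y" using X by (linarith, force)
  then show "Y \<in> indep L" using XY(2) X(1) by (simp add: indep_L)
qed (use finite_E in \<open>auto simp: indep_L\<close>)

subsection \<open>Rank\<close>

lemma rk_eqI:
  assumes "X \<in> indep L" "X \<subseteq> S" "card X = k"
    and "\<And>Y. Y \<in> indep L \<Longrightarrow> Y \<subseteq> S \<Longrightarrow> card Y \<le> k"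
  shows "rk L S = k"
  unfolding rk_def
proof (rule Max_eqI)
  have "{X \<in> indep L. X \<subseteq> S} \<subseteq> Pow E" by (auto simp: indep_L)
  then show "finite (card ` {X \<in> indep L. X \<subseteq> S})"
    using finite_E by (meson finite_Pow_iff finite_imageI finite_subset)
qed (use assms in auto)

lemma rk_empty: "rk L {} = 0"
  by (rule rk_eqI[of "{}"]) (auto simp: indep_L)

lemma rk_singleton: "i \<in> E \<Longrightarrow> rk L {i} = 1"
  by (rule rk_eqI[of "{i}"]) (auto simp: indep_L dest!: card_mono[rotated])

lemma rk_concurrent:
  assumes "S \<subseteq> E" "concurrent S" "i \<in> S" "j \<in> S" "i \<noteq> j"
  shows "rk L S = 2"
proof (rule rk_eqI[of "{i, j}"])
  show "card Y \<le> 2" if "Y \<in> indep L" "Y \<subseteq> S" for Y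
  proof -
    have "concurrent Y" using that(2) assms(2) concurrent_mono by blast
    then have "card Y \<noteq> 3" "card Y \<le> 3" using that(1) by (auto simp: indep_L)
    then show ?thesis by linarith
  qed
qed (use assms in \<open>auto simp: indep_L\<close>)

lemma rk_not_concurrent:
  assumes "S \<subseteq> E" "\<not> concurrent S"
  shows "rk L S = 3"
proof -
  obtain i j k where ijk: "i \<in> S" "j \<in> S" "k \<in> S" "\<not> concurrent {i, j, k}"
    using exists_not_concurrent[OF assms] by blast
  then have "card {i, j, k} = 3" using card_triple assms(1) by blast
  with ijk assms(1) show ?thesis
    by (intro rk_eqI[of "{i, j, k}"]) (auto simp: indep_L)
qed

lemma not_concurrent_E: "\<not> concurrent E"
  using block_subset unfolding concurrent_def by blast

lemma rank_three_L: "rank_three_matroid L"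
proof -
  have "{i, j} \<in> indep L" if "i \<in> E" "j \<in> E" for i j
  proof -
    have "card {i, j} \<le> 2" by (cases "i = j") auto
    then have "card {i, j} \<le> 3" "card {i, j} \<noteq> 3" by linarith+
    then show ?thesis using that by (simp add: indep_L)
  qed
  then show ?thesis
    unfolding rank_three_matroid_def simple_matroid_def
    using is_matroid_L rk_not_concurrent[OF subset_refl not_concurrent_E] by simp
qed

lemma rank_cases:
  assumes "S \<subseteq> E"
  obtains (empty) "S = {}" | (single) i where "i \<in> E" "S = {i}"
  | (two) i j where "i \<in> S" "j \<in> S" "i \<noteq> j" "concurrent S"
  | (three) i j k where "i \<in> S" "j \<in> S" "k \<in> S" "\<not> concurrent {i, j, k}"
proof (cases "concurrent S")
  case False
  then show thesis using exists_not_concurrent[OF assms] three by blast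
next
  case True
  show thesis
  proof (cases "\<exists>i\<in>S. \<exists>j\<in>S. i \<noteq> j")
    case True
    then show thesis using two \<open>concurrent S\<close> by blast
  next
    case False
    then have "S = {} \<or> (\<exists>i. S = {i})" by blast
    then show thesis using empty single assms by auto
  qed
qed

lemma points_L: "points L = BB"
proof (intro equalityI subsetI)
  fix F assume "F \<in> points L"
  then have F: "F \<subseteq> E" "\<And>x. x \<in> E - F \<Longrightarrow> rk L F < rk L (insert x F)" "rk L F = 2"
    by (auto simp: points_def flats_def)
  from F(1) show "F \<in> BB"
  proof (cases rule: rank_cases)
    case (two i j)
    then obtain B where B: "B \<in> BB" "F \<subseteq> B" unfolding concurrent_def by blast
    have "x \<in> F" if "x \<in> B" for x
    proof (rule ccontr)
      assume "x \<notin> F"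
      have "x \<in> E" using that B block_subset by blast
      have "concurrent (insert x F)" using that B unfolding concurrent_def by blast
      then have "rk L (insert x F) = 2"
        using rk_concurrent[of "insert x F" i j] two \<open>x \<in> E\<close> F(1) by auto
      then show False using F(2)[of x] F(3) \<open>x \<in> E\<close> \<open>x \<notin> F\<close> by simp
    qed
    then have "F = B" using B by blast
    then show ?thesis using B by simp
  next
    case (three i j k)
    then have "\<not> concurrent F" using concurrent_mono[of F "{i, j, k}"] by blast
    then show ?thesis using F rk_not_concurrent by fastforce
  qed (use F rk_empty rk_singleton in fastforce)+
next
  fix B assume B: "B \<in> BB"
  then obtain i j where ij: "i \<in> B" "j \<in> B" "i \<noteq> j" using block_two by blast
  have rB: "rk L B = 2"
    using rk_concurrent[of B i j] B ij block_subset unfolding concurrent_def by blast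
  have "rk L (insert x B) = 3" if "x \<in> E - B" for x
  proof (rule rk_not_concurrent)
    show "insert x B \<subseteq> E" using that B block_subset by blast
    have "\<not> concurrent {i, j, x}" using concurrent_iff_in_block[of B i j "{x}"] B ij that by simp
    then show "\<not> concurrent (insert x B)"
      using concurrent_mono[of "insert x B" "{i, j, x}"] ij by blast
  qed
  then show "B \<in> points L"
    using rB B block_subset by (auto simp: points_def flats_def)
qed

lemma singleton_flat:
  assumes "i \<in> E" shows "{i} \<in> flats L"
proof -
  have "rk L (insert x {i}) = 2" if "x \<in> E - {i}" for x
    using rk_concurrent[of "{x, i}" x i] concurrent_pair[of x i] that assms by auto
  then show ?thesis using rk_singleton[OF assms] assms by (auto simp: flats_def)
qed

subsection \<open>Realizations\<close>

definition represents :: "('e, 'k::field) columns \<Rightarrow> bool" where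
  "represents M \<longleftrightarrow> (\<forall>i\<in>E. \<forall>j\<in>E. \<forall>k\<in>E. det3 (M i) (M j) (M k) = 0 \<longleftrightarrow> concurrent {i, j, k})"

lemma representsD:
  "\<lbrakk>represents M; i \<in> E; j \<in> E; k \<in> E\<rbrakk> \<Longrightarrow> det3 (M i) (M j) (M k) = 0 \<longleftrightarrow> concurrent {i, j, k}"
  unfolding represents_def by blast

lemma represents_cross_prod:
  assumes "represents M" "i \<in> E" "j \<in> E" "i \<noteq> j"
  shows "cross_prod (M i) (M j) \<noteq> 0"
proof -
  obtain k where "k \<in> E" "\<not> concurrent {i, j, k}" using exists_third assms by blast
  then have "det3 (M i) (M j) (M k) \<noteq> 0" using assms representsD by metis
  then show ?thesis by (rule det3_nonzero_imp)
qed

lemma represents_nonzero: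
  assumes "represents M" "i \<in> E"
  shows "M i \<noteq> 0"
proof -
  obtain B where "B \<in> BB" using block_nonempty by blast
  then obtain j where "j \<in> E" "j \<noteq> i" using block_two block_subset by blast
  then show ?thesis using represents_cross_prod[OF assms] by force
qed

text \<open>The codimension of an intersection of kernels is the rank. This single fact gives the grading,
  the order and the surjectivity of the lattice isomorphism below.\<close>

lemma rank_plus_dim:
  assumes M: "represents M" and S: "S \<subseteq> E"
  shows "rk L S + vec.dim (\<Inter>i\<in>S. form_kernel (M i)) = 3"
  using S
proof (cases rule: rank_cases)
  case empty
  then show ?thesis by (simp add: rk_empty vec_dim_card del: vec.dim_UNIV)
next
  case (single i)
  then show ?thesis
    using rk_singleton[of i] dim_form_kernel[THEN iffD2, OF represents_nonzero[OF M single(1)]]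
    by simp
next
  case (two i j)
  have ij: "cross_prod (M i) (M j) \<noteq> 0" using two S represents_cross_prod[OF M] by blast
  have "form_kernel (M i) \<inter> form_kernel (M j) \<subseteq> form_kernel (M k)" if "k \<in> S" for k
  proof -
    have "concurrent {i, j, k}" using two that by (intro concurrent_mono[OF two(4)]) simp
    moreover have "i \<in> E" "j \<in> E" "k \<in> E" using two S that by auto
    ultimately show ?thesis
      unfolding form_kernel_Int_subset[OF ij] using representsD[OF M, of i j k] by simp
  qed
  then have "(\<Inter>k\<in>S. form_kernel (M k)) = form_kernel (M i) \<inter> form_kernel (M j)"
    using two(1,2) by (intro equalityI Int_greatest INT_greatest INF_lower)
  then show ?thesis using dim_form_kernel_Int[OF ij] rk_concurrent[OF S two(4,1,2,3)] by simp
next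
  case (three i j k)
  have "i \<in> E" "j \<in> E" "k \<in> E" using three S by auto
  then have "det3 (M i) (M j) (M k) \<noteq> 0" using three representsD[OF M, of i j k] by simp
  note nz = this det3_nonzero_imp(1)[OF this]
  have "x = 0" if "x \<in> (\<Inter>k\<in>S. form_kernel (M k))" for x
  proof -
    have x: "dot3 (M i) x = 0" "dot3 (M j) x = 0" "dot3 (M k) x = 0"
      using that three by (auto simp: form_kernel_iff)
    then obtain c where c: "x = c *s cross_prod (M i) (M j)" using orthogonal_to_both nz by blast
    then have "c * det3 (M i) (M j) (M k) = 0" using x(3) by (simp add: det3_def dot3_commute)
    then show ?thesis using c nz by simp
  qed
  moreover have "0 \<in> (\<Inter>k\<in>S. form_kernel (M k))" by (simp add: form_kernel_iff)
  ultimately have "(\<Inter>k\<in>S. form_kernel (M k)) = {0}" by blast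
  moreover have "rk L S = 3"
    using rk_not_concurrent[OF S] concurrent_mono[of S "{i, j, k}"] three by blast
  ultimately show ?thesis by simp
qed

text \<open>
  For a given lattice isomorphism, the image of the point of two lines \<open>i\<close> and \<open>j\<close> is the
  one-dimensional intersection of their kernels, and it lies in a third kernel if and only if the
  determinant vanishes. Conversely, a flat is sent to the intersection of the kernels of its lines.
  This is an order embedding since adding a line to a flat raises the rank and so lowers the
  dimension, and it is onto since the lines whose kernels contain a given intersection form a flat.
\<close>

theorem realizations_iff:
  "M \<in> realizations L \<longleftrightarrow> M \<in> matrices E \<and> represents M"
proof
  assume "M \<in> realizations L"
  then obtain \<phi> where mat: "M \<in> matrices E"
    and d2: "\<And>i. i \<in> E \<Longrightarrow> vec.dim (form_kernel (M i)) = 2"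
    and inj: "inj_on (\<lambda>i. form_kernel (M i)) E"
    and bij: "bij_betw \<phi> (flats L) (intersection_lattice E M)"
    and ord: "\<And>F G. F \<in> flats L \<Longrightarrow> G \<in> flats L \<Longrightarrow> F \<subseteq> G \<longleftrightarrow> \<phi> G \<subseteq> \<phi> F"
    and grade: "\<And>F. F \<in> flats L \<Longrightarrow> rk L F + vec.dim (\<phi> F) = 3"
    and atom: "\<And>i. i \<in> E \<Longrightarrow> \<phi> {i} = form_kernel (M i)"
    by (auto simp: realizations_def)
  have *: "det3 (M i) (M j) (M k) = 0 \<longleftrightarrow> concurrent {i, j, k}"
    if ijk: "i \<in> E" "j \<in> E" "k \<in> E" "i \<noteq> j" for i j k
  proof -
    have "M i \<noteq> 0" "M j \<noteq> 0" using d2 ijk dim_form_kernel by blast+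
    moreover have "form_kernel (M i) \<noteq> form_kernel (M j)" using inj ijk by (auto dest: inj_onD)
    ultimately have cr: "cross_prod (M i) (M j) \<noteq> 0" using form_kernel_eq by blast
    obtain B where B: "B \<in> BB" "i \<in> B" "j \<in> B" using block_exists ijk by blast
    then have Bf: "B \<in> flats L" "rk L B = 2" using points_L by (auto simp: points_def)
    then have "\<phi> B \<in> intersection_lattice E M" using bij by (auto simp: bij_betw_def)
    then have sub: "vec.subspace (\<phi> B)"
      by (auto simp: intersection_lattice_def intro!: vec.subspace_Inter subspace_form_kernel)
    have in_iff: "k \<in> B \<longleftrightarrow> \<phi> B \<subseteq> form_kernel (M k)" if "k \<in> E" for k
      using ord[OF singleton_flat[OF that] Bf(1)] atom[OF that] by simp
    have "\<phi> B \<subseteq> form_kernel (M i) \<inter> form_kernel (M j)" using in_iff ijk B by blast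
    moreover have "vec.dim (form_kernel (M i) \<inter> form_kernel (M j)) \<le> vec.dim (\<phi> B)"
      using dim_form_kernel_Int[OF cr] grade[OF Bf(1)] Bf(2) by simp
    ultimately have "\<phi> B = form_kernel (M i) \<inter> form_kernel (M j)"
      using vec.subspace_dim_equal[OF sub vec.subspace_inter[OF subspace_form_kernel subspace_form_kernel]]
      by blast
    then have "det3 (M i) (M j) (M k) = 0 \<longleftrightarrow> k \<in> B"
      using form_kernel_Int_subset[OF cr] in_iff ijk by simp
    also have "\<dots> \<longleftrightarrow> concurrent {i, j, k}"
      using concurrent_iff_in_block[of B i j "{k}"] B ijk by simp
    finally show ?thesis .
  qed
  have "represents M"
    unfolding represents_def
  proof (intro ballI)
    fix i j k assume ijk: "i \<in> E" "j \<in> E" "k \<in> E"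
    show "det3 (M i) (M j) (M k) = 0 \<longleftrightarrow> concurrent {i, j, k}"
    proof (cases "i = j")
      case True
      then show ?thesis using concurrent_pair[of i k] ijk by simp
    qed (use * ijk in blast)
  qed
  then show "M \<in> matrices E \<and> represents M" using mat by blast
next
  assume M: "M \<in> matrices E \<and> represents M"
  then have rep: "represents M" by blast
  define \<phi> where "\<phi> F = (\<Inter>i\<in>F. form_kernel (M i))" for F
  have sub: "vec.subspace (\<phi> F)" for F
    by (auto simp: \<phi>_def intro!: vec.subspace_Inter subspace_form_kernel)
  have grade: "rk L F + vec.dim (\<phi> F) = 3" if "F \<subseteq> E" for F
    using rank_plus_dim[OF rep that] by (simp add: \<phi>_def)
  have ord: "F \<subseteq> G \<longleftrightarrow> \<phi> G \<subseteq> \<phi> F" if "F \<in> flats L" "G \<in> flats L" for F G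
  proof
    assume le: "\<phi> G \<subseteq> \<phi> F"
    show "F \<subseteq> G"
    proof
      fix x assume "x \<in> F"
      then have "\<phi> (insert x G) = \<phi> G" using le by (auto simp: \<phi>_def)
      moreover have "x \<in> E" "G \<subseteq> E" using that \<open>x \<in> F\<close> by (auto simp: flats_def)
      ultimately have "rk L (insert x G) = rk L G"
        using grade[of G] grade[of "insert x G"] by simp
      then show "x \<in> G" using that(2) \<open>x \<in> E\<close> by (force simp: flats_def)
    qed
  qed (auto simp: \<phi>_def)
  have "bij_betw \<phi> (flats L) (intersection_lattice E M)"
    unfolding bij_betw_def
  proof
    show "inj_on \<phi> (flats L)" using ord by (intro inj_onI) blast
    show "\<phi> ` flats L = intersection_lattice E M"
    proof (intro equalityI subsetI)
      fix Z assume "Z \<in> intersection_lattice E M"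
      then obtain S where S: "S \<subseteq> E" "Z = \<phi> S" by (auto simp: intersection_lattice_def \<phi>_def)
      define F where "F = {x \<in> E. \<phi> S \<subseteq> form_kernel (M x)}"
      have FZ: "\<phi> F = \<phi> S" using S by (auto simp: F_def \<phi>_def)
      have "rk L F < rk L (insert x F)" if "x \<in> E - F" for x
      proof -
        have "\<phi> (insert x F) \<subset> \<phi> F" using that FZ by (auto simp: F_def \<phi>_def)
        then have "vec.dim (\<phi> (insert x F)) < vec.dim (\<phi> F)"
          using vec.subspace_dim_equal[OF sub sub] by (metis not_le psubset_eq)
        then show ?thesis using grade[of F] grade[of "insert x F"] that by (auto simp: F_def)
      qed
      then have "F \<in> flats L" by (auto simp: flats_def F_def)
      then show "Z \<in> \<phi> ` flats L" using FZ S by blast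
    qed (auto simp: intersection_lattice_def \<phi>_def flats_def)
  qed
  moreover have "inj_on (\<lambda>i. form_kernel (M i)) E"
  proof (intro inj_onI, rule ccontr)
    fix i j assume ij: "i \<in> E" "j \<in> E" "form_kernel (M i) = form_kernel (M j)" "i \<noteq> j"
    then have "vec.dim (form_kernel (M i)) = 1"
      using dim_form_kernel_Int[OF represents_cross_prod[OF rep ij(1,2,4)]] by simp
    then show False
      using dim_form_kernel[of "M i"] represents_nonzero[OF rep ij(1)] by simp
  qed
  moreover have "vec.dim (form_kernel (M i)) = 2" if "i \<in> E" for i
    using dim_form_kernel represents_nonzero[OF rep that] by blast
  moreover have "F \<subseteq> E" if "F \<in> flats L" for F using that by (auto simp: flats_def)
  ultimately show "M \<in> realizations L"
    using M ord grade by (auto simp: realizations_def intro!: exI[of _ \<phi>]) (auto simp: \<phi>_def)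
qed

end

section \<open>Dimension of a union of curves\<close>

text \<open>Here an irreducible closed set lies in one curve, and it is either a single point or that
  whole curve. Hence chains have length at most one.\<close>

lemma irreducible_closedin_Union_subset:
  assumes "irreducible_closedin X Z" "finite S" "\<And>A. A \<in> S \<Longrightarrow> closedin X A" "Z \<subseteq> \<Union>S"
  shows "\<exists>A\<in>S. Z \<subseteq> A"
  using assms(2-4)
proof (induction S rule: finite_induct)
  case empty
  then show ?case using assms(1) by (auto simp: irreducible_closedin_def)
next
  case (insert A S)
  have irr: "closedin X Z" "\<And>A B. closedin X A \<Longrightarrow> closedin X B \<Longrightarrow> Z = A \<union> B \<Longrightarrow> Z = A \<or> Z = B"
    using assms(1) by (auto simp: irreducible_closedin_def)
  have "closedin X (Z \<inter> A)" "closedin X (Z \<inter> \<Union>S)"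
    using insert irr(1) by (auto intro: closedin_Int closedin_Union)
  moreover have "Z = (Z \<inter> A) \<union> (Z \<inter> \<Union>S)" using insert by auto
  ultimately have "Z = Z \<inter> A \<or> Z = Z \<inter> \<Union>S" using irr(2) by blast
  then have "Z \<subseteq> A \<or> Z \<subseteq> \<Union>S" by blast
  then show ?case using insert.IH insert.prems(1) by blast
qed

lemma irreducible_closedin_finite:
  assumes "irreducible_closedin X Z" "finite Z" "\<And>x. x \<in> Z \<Longrightarrow> closedin X {x}"
  shows "\<exists>x. Z = {x}"
proof -
  have "\<exists>A\<in>(\<lambda>x. {x}) ` Z. Z \<subseteq> A"
    by (rule irreducible_closedin_Union_subset[OF assms(1)]) (use assms(2,3) in auto)
  moreover have "Z \<noteq> {}" using assms(1) by (simp add: irreducible_closedin_def)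
  ultimately show ?thesis by auto
qed

theorem krull_dim_curves:
  fixes X :: "'x topology" and I :: "'w \<Rightarrow> 'x set"
  assumes fin: "finite \<Omega>" and ne: "\<Omega> \<noteq> {}"
    and closed_I: "\<And>\<omega>. \<omega> \<in> \<Omega> \<Longrightarrow> closedin X (I \<omega>)"
    and inf: "\<And>\<omega>. \<omega> \<in> \<Omega> \<Longrightarrow> infinite (I \<omega>)"
    and cover: "topspace X \<subseteq> (\<Union>\<omega>\<in>\<Omega>. I \<omega>)"
    and closed_point: "\<And>x. x \<in> topspace X \<Longrightarrow> closedin X {x}"
    and closed_sets: "\<And>\<omega> C. \<omega> \<in> \<Omega> \<Longrightarrow> closedin X C \<Longrightarrow> finite (C \<inter> I \<omega>) \<or> I \<omega> \<subseteq> C"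
  shows "krull_dim X = 1"
proof -
  define chain where "chain n \<longleftrightarrow> (\<exists>Z :: nat \<Rightarrow> 'x set.
     (\<forall>i\<le>n. irreducible_closedin X (Z i)) \<and> (\<forall>i<n. Z i \<subset> Z (Suc i)))" for n
  have sub: "Z \<subseteq> topspace X" if "irreducible_closedin X Z" for Z
    using that closedin_subset by (auto simp: irreducible_closedin_def)
  have in_curve: "\<exists>\<omega>\<in>\<Omega>. Z \<subseteq> I \<omega>" if "irreducible_closedin X Z" for Z
  proof -
    have "\<exists>A\<in>I ` \<Omega>. Z \<subseteq> A"
      by (rule irreducible_closedin_Union_subset[OF that]) (use fin closed_I cover sub[OF that] in auto)
    then show ?thesis by blast
  qed
  have irr_I: "irreducible_closedin X (I \<omega>)" if "\<omega> \<in> \<Omega>" for \<omega>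
    unfolding irreducible_closedin_def
  proof (intro conjI allI impI)
    show "closedin X (I \<omega>)" using closed_I that .
    show "I \<omega> \<noteq> {}" using inf[OF that] by auto
    fix A B assume AB: "closedin X A \<and> closedin X B \<and> I \<omega> = A \<union> B"
    then have "\<not> (finite (A \<inter> I \<omega>) \<and> finite (B \<inter> I \<omega>))"
      using inf[OF that] by (metis Int_absorb1 finite_Un sup_ge1 sup_ge2 inf_commute)
    then show "I \<omega> = A \<or> I \<omega> = B" using closed_sets[OF that] AB by blast
  qed
  have chain1: "chain 1"
  proof -
    obtain \<omega> where \<omega>: "\<omega> \<in> \<Omega>" using ne by blast
    then obtain x where x: "x \<in> I \<omega>" using inf by fastforce
    have "I \<omega> \<noteq> {x}" using inf[OF \<omega>] by auto
    moreover have "x \<in> topspace X" using x closedin_subset[OF closed_I[OF \<omega>]] by blast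
    then have "irreducible_closedin X {x}"
      using closed_point by (auto simp: irreducible_closedin_def singleton_Un_iff)
    ultimately show ?thesis
      unfolding chain_def using irr_I[OF \<omega>] x
      by (intro exI[of _ "\<lambda>i. if i = 0 then {x} else I \<omega>"]) (auto simp: less_Suc_eq_0_disj)
  qed
  have le1: "n \<le> 1" if "chain n" for n
  proof (rule ccontr)
    assume "\<not> n \<le> 1"
    from that obtain Z where Z: "\<And>i. i \<le> n \<Longrightarrow> irreducible_closedin X (Z i)"
      "\<And>i. i < n \<Longrightarrow> Z i \<subset> Z (Suc i)" unfolding chain_def by blast
    have "2 \<le> n" using \<open>\<not> n \<le> 1\<close> by simp
    then have irr: "irreducible_closedin X (Z 0)" "irreducible_closedin X (Z 1)" "irreducible_closedin X (Z 2)"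
      and lt: "Z 0 \<subset> Z 1" "Z 1 \<subset> Z 2"
      using Z(1)[of 0] Z(1)[of 1] Z(1)[of 2] Z(2)[of 0] Z(2)[of 1] by (simp_all add: numeral_2_eq_2)
    have "Z 0 \<noteq> {}" using irr(1) by (simp add: irreducible_closedin_def)
    have "infinite (Z 1)"
    proof
      assume "finite (Z 1)"
      then obtain x where "Z 1 = {x}"
        using irreducible_closedin_finite[OF irr(2)] closed_point sub[OF irr(2)] by blast
      then show False using lt(1) \<open>Z 0 \<noteq> {}\<close> by auto
    qed
    obtain \<omega> where \<omega>: "\<omega> \<in> \<Omega>" "Z 2 \<subseteq> I \<omega>" using in_curve[OF irr(3)] by blast
    then have "Z 1 \<inter> I \<omega> = Z 1" using lt by blast
    then have "I \<omega> \<subseteq> Z 1"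
      using closed_sets[OF \<omega>(1), of "Z 1"] irr(2) \<open>infinite (Z 1)\<close>
      by (auto simp: irreducible_closedin_def)
    then show False using \<omega> lt by blast
  qed
  have "krull_dim X = Sup {enat n | n. chain n}"
    by (simp add: krull_dim_def chain_def)
  also have "\<dots> = 1"
  proof (rule antisym)
    show "Sup {enat n | n. chain n} \<le> 1"
      using le1 by (auto intro!: Sup_least simp: one_enat_def)
    show "1 \<le> Sup {enat n | n. chain n}"
      using chain1 by (auto intro!: Sup_upper simp: one_enat_def)
  qed
  finally show ?thesis .
qed

section \<open>Points of the moduli space\<close>

text \<open>The equivalence relation behind the double quotient.\<close>

definition proj_equiv :: "'e set \<Rightarrow> ('e, 'k::field) columns \<Rightarrow> ('e, 'k) columns \<Rightarrow> bool" where
  "proj_equiv E M M' \<longleftrightarrow> (\<exists>g c. invertible g \<and> (\<forall>i\<in>E. c i \<noteq> 0 \<and> M' i = c i *s (g *v M i)))"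

abbreviation moduli_point :: "'e set \<Rightarrow> ('e, 'k::field) columns \<Rightarrow> ('e, 'k) columns set set" where
  "moduli_point E M \<equiv> PGL_orbit E (torus_orbit E M)"

lemma invertible_mat_1: "invertible (mat 1 :: 'k::semiring_1 ^ 'n ^ 'n)"
  unfolding invertible_def by (rule exI[of _ "mat 1"]) simp

lemma proj_equiv_refl: "proj_equiv E M M"
  unfolding proj_equiv_def
  by (rule exI[of _ "mat 1"], rule exI[of _ "\<lambda>_. 1"]) (simp add: invertible_mat_1)

lemma proj_equiv_trans:
  assumes "proj_equiv E M M'" "proj_equiv E M' M''" shows "proj_equiv E M M''"
proof -
  obtain g c h d where g: "invertible g" "\<And>i. i \<in> E \<Longrightarrow> c i \<noteq> 0 \<and> M' i = c i *s (g *v M i)"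
    and h: "invertible h" "\<And>i. i \<in> E \<Longrightarrow> d i \<noteq> 0 \<and> M'' i = d i *s (h *v M' i)"
    using assms unfolding proj_equiv_def by metis
  show ?thesis
    unfolding proj_equiv_def
    by (rule exI[of _ "h ** g"], rule exI[of _ "\<lambda>i. d i * c i"])
       (use g h in \<open>auto simp: invertible_mult matrix_vector_mul_assoc matrix_vector_mult_scaleR
          vector_scalar_commute\<close>)
qed

lemma proj_equiv_sym:
  assumes "proj_equiv E M M'" shows "proj_equiv E M' M"
proof -
  obtain g c where g: "invertible g" "\<And>i. i \<in> E \<Longrightarrow> c i \<noteq> 0 \<and> M' i = c i *s (g *v M i)"
    using assms unfolding proj_equiv_def by metis
  obtain h where h: "h ** g = mat 1" "g ** h = mat 1" using g(1) by (auto simp: invertible_def)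
  then have "invertible h" by (auto simp: invertible_def)
  moreover have "inverse (c i) \<noteq> 0 \<and> M i = inverse (c i) *s (h *v M' i)" if "i \<in> E" for i
    using g(2)[OF that] h by (simp add: vector_scalar_commute matrix_vector_mul_assoc)
  ultimately show ?thesis unfolding proj_equiv_def by (intro exI[of _ h] exI[of _ "\<lambda>i. inverse (c i)"]) simp
qed

lemma scaled_matrix_vector: "(\<chi> i j. c * g $ i $ j) *v x = c *s (g *v (x :: 'k::field ^ 'n))"
  by (simp add: vec_eq_iff matrix_vector_mult_def sum_distrib_left mult.assoc)

text \<open>All representatives of an element of \<open>PGL(3,K)\<close> act in the same way on a torus orbit, so one
  matrix suffices.\<close>

lemma mem_PGL_orbit:
  assumes "M \<in> matrices E"
  shows "A \<in> moduli_point E M \<longleftrightarrow> (\<exists>g. invertible g \<and> A = torus_orbit E (\<lambda>i\<in>E. g *v M i))"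
proof -
  have act: "PGL_act E {(\<chi> i j. a * g $ i $ j) | a. a \<noteq> 0} (torus_orbit E M)
      = torus_orbit E (\<lambda>i\<in>E. g *v M i)" for g :: "'b ^ 3 ^ 3"
  proof (intro equalityI subsetI)
    fix N assume "N \<in> PGL_act E {(\<chi> i j. a * g $ i $ j) | a. a \<noteq> 0} (torus_orbit E M)"
    then obtain a c where "a \<noteq> 0" "\<And>i. i \<in> E \<Longrightarrow> c i \<noteq> 0"
      "N = (\<lambda>i\<in>E. (\<chi> i j. a * g $ i $ j) *v (\<lambda>i\<in>E. c i *s M i) i)"
      unfolding PGL_act_def torus_orbit_def by blast
    then show "N \<in> torus_orbit E (\<lambda>i\<in>E. g *v M i)"
      unfolding torus_orbit_def
      by (intro CollectI exI[of _ "\<lambda>i. a * c i"])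
         (auto simp: scaled_matrix_vector vector_scalar_commute intro!: restrict_ext)
  next
    fix N assume "N \<in> torus_orbit E (\<lambda>i\<in>E. g *v M i)"
    then obtain c where c: "\<And>i. i \<in> E \<Longrightarrow> c i \<noteq> 0" "N = (\<lambda>i\<in>E. c i *s (\<lambda>i\<in>E. g *v M i) i)"
      by (auto simp: torus_orbit_def)
    have g: "g \<in> {(\<chi> i j. a * g $ i $ j) | a. a \<noteq> 0}"
      by (intro CollectI exI[of _ 1]) (simp add: vec_eq_iff)
    have cM: "(\<lambda>i\<in>E. c i *s M i) \<in> torus_orbit E M" using c(1) by (auto simp: torus_orbit_def)
    have N: "N = (\<lambda>i\<in>E. g *v (\<lambda>i\<in>E. c i *s M i) i)"
      using c(2) by (auto simp: vector_scalar_commute intro!: restrict_ext)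
    show "N \<in> PGL_act E {(\<chi> i j. a * g $ i $ j) | a. a \<noteq> 0} (torus_orbit E M)"
      unfolding PGL_act_def
      by (rule CollectI, rule exI[of _ g], rule exI[of _ "\<lambda>i\<in>E. c i *s M i"])
         (intro conjI g cM N)
  qed
  have "A \<in> moduli_point E M \<longleftrightarrow>
      (\<exists>g. invertible g \<and> A = PGL_act E {(\<chi> i j. a * g $ i $ j) | a. a \<noteq> 0} (torus_orbit E M))"
    unfolding PGL_orbit_def PGL3_def by auto
  then show ?thesis by (simp only: act)
qed

lemma torus_orbit_refl: "M \<in> matrices E \<Longrightarrow> M \<in> torus_orbit E M"
  unfolding torus_orbit_def matrices_def
  by (intro CollectI exI[of _ "\<lambda>_. 1"]) (auto simp: PiE_def extensional_restrict)

lemma moduli_point_subset: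
  assumes "M \<in> matrices E" "M' \<in> matrices E" "proj_equiv E M M'"
  shows "moduli_point E M' \<subseteq> moduli_point E M"
proof
  obtain g c where g: "invertible g" "\<And>i. i \<in> E \<Longrightarrow> c i \<noteq> 0 \<and> M' i = c i *s (g *v M i)"
    using assms(3) unfolding proj_equiv_def by metis
  fix A assume "A \<in> moduli_point E M'"
  then obtain h where h: "invertible h" "A = torus_orbit E (\<lambda>i\<in>E. h *v M' i)"
    using mem_PGL_orbit[OF assms(2)] by blast
  have "torus_orbit E (\<lambda>i\<in>E. h *v M' i) = torus_orbit E (\<lambda>i\<in>E. (h ** g) *v M i)"
  proof (intro equalityI subsetI)
    fix N assume "N \<in> torus_orbit E (\<lambda>i\<in>E. h *v M' i)"
    then obtain d where "\<And>i. i \<in> E \<Longrightarrow> d i \<noteq> 0" "N = (\<lambda>i\<in>E. d i *s (\<lambda>i\<in>E. h *v M' i) i)"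
      by (auto simp: torus_orbit_def)
    then show "N \<in> torus_orbit E (\<lambda>i\<in>E. (h ** g) *v M i)"
      unfolding torus_orbit_def using g
      by (intro CollectI exI[of _ "\<lambda>i. d i * c i"])
         (auto simp: vector_scalar_commute matrix_vector_mul_assoc intro!: restrict_ext)
  next
    fix N assume "N \<in> torus_orbit E (\<lambda>i\<in>E. (h ** g) *v M i)"
    then obtain d where "\<And>i. i \<in> E \<Longrightarrow> d i \<noteq> 0" "N = (\<lambda>i\<in>E. d i *s (\<lambda>i\<in>E. (h ** g) *v M i) i)"
      by (auto simp: torus_orbit_def)
    then show "N \<in> torus_orbit E (\<lambda>i\<in>E. h *v M' i)"
      unfolding torus_orbit_def using g
      by (intro CollectI exI[of _ "\<lambda>i. d i / c i"])
         (auto simp: vector_scalar_commute matrix_vector_mul_assoc intro!: restrict_ext)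
  qed
  then show "A \<in> moduli_point E M"
    using h g(1) mem_PGL_orbit[OF assms(1)] invertible_mult by blast
qed

theorem moduli_point_eq_iff:
  assumes "M \<in> matrices E" "M' \<in> matrices E"
  shows "moduli_point E M = moduli_point E M' \<longleftrightarrow> proj_equiv E M M'"
proof
  assume "proj_equiv E M M'"
  then show "moduli_point E M = moduli_point E M'"
    using moduli_point_subset assms proj_equiv_sym by blast
next
  assume eq: "moduli_point E M = moduli_point E M'"
  define M1 where "M1 = (\<lambda>i\<in>E. mat 1 *v M' i)"
  have "M1 = M'" using assms(2) by (auto simp: M1_def matrices_def PiE_def extensional_restrict)
  moreover have "torus_orbit E M1 \<in> moduli_point E M'"
    using mem_PGL_orbit[OF assms(2)] M1_def invertible_mat_1 by blast
  ultimately have "torus_orbit E M' \<in> moduli_point E M" using eq by simp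
  then obtain g where g: "invertible g" "torus_orbit E M' = torus_orbit E (\<lambda>i\<in>E. g *v M i)"
    using mem_PGL_orbit[OF assms(1)] by blast
  then have "M' \<in> torus_orbit E (\<lambda>i\<in>E. g *v M i)" using torus_orbit_refl[OF assms(2)] by simp
  then obtain c where "\<And>i. i \<in> E \<Longrightarrow> c i \<noteq> 0" "M' = (\<lambda>i\<in>E. c i *s (\<lambda>i\<in>E. g *v M i) i)"
    by (auto simp: torus_orbit_def)
  then show "proj_equiv E M M'" using g(1) by (auto simp: proj_equiv_def intro!: exI[of _ g] exI[of _ c])
qed

section \<open>Closed sets of the moduli space\<close>

lemma topspace_quotient_topology: "topspace (quotient_topology X q) = q ` topspace X"
proof
  show "topspace (quotient_topology X q) \<subseteq> q ` topspace X"
    using openin_quotient_topology openin_topspace by metis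
  have "{x \<in> topspace X. q x \<in> q ` topspace X} = topspace X" by blast
  then have "openin (quotient_topology X q) (q ` topspace X)"
    by (simp add: openin_quotient_topology)
  then show "q ` topspace X \<subseteq> topspace (quotient_topology X q)" by (rule openin_subset)
qed

lemma closedin_quotient_topology:
  "closedin (quotient_topology X q) C \<longleftrightarrow>
     C \<subseteq> q ` topspace X \<and> closedin X {x \<in> topspace X. q x \<in> C}"
proof -
  have "{x \<in> topspace X. q x \<in> q ` topspace X - C} = topspace X - {x \<in> topspace X. q x \<in> C}"
    by blast
  then show ?thesis
    by (auto simp: closedin_def topspace_quotient_topology openin_quotient_topology)
qed

lemma topspace_zariski_topology: "topspace (zariski_topology E) = matrices E"
proof -
  let ?S = "{{M \<in> matrices E. f M \<noteq> (0 :: 'b)} | f. f \<in> polynomial_functions E}"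
  have "{M \<in> matrices E. (\<lambda>M. 1) M \<noteq> (0 :: 'b)} \<in> ?S"
    using polynomial_functions.const[of 1 E] by (intro CollectI exI conjI) (rule refl)
  then have "matrices E \<subseteq> \<Union>?S" by (intro Union_upper) simp
  moreover have "\<Union>?S \<subseteq> matrices E" by (intro Union_least) auto
  ultimately show ?thesis unfolding zariski_topology_def topology_generated_by_topspace by (rule antisym[rotated])
qed

lemma closedin_zariski_zero_set:
  assumes "f \<in> polynomial_functions E"
  shows "closedin (zariski_topology E) {M \<in> matrices E. f M = 0}"
proof -
  have "openin (zariski_topology E) {M \<in> matrices E. f M \<noteq> 0}"
    unfolding zariski_topology_def using assms
    by (intro topology_generated_by_Basis CollectI exI[of _ f] conjI refl)
  moreover have "matrices E - {M \<in> matrices E. f M = 0} = {M \<in> matrices E. f M \<noteq> 0}" by blast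
  ultimately show ?thesis by (simp add: closedin_def topspace_zariski_topology)
qed

lemma topspace_moduli_space:
  "topspace (moduli_space L) = moduli_point (ground L) ` realizations L"
  by (auto simp: moduli_space_def topspace_quotient_topology topspace_zariski_topology realizations_def)

lemma closedin_moduli_space:
  "closedin (moduli_space L) C \<longleftrightarrow>
     C \<subseteq> moduli_point (ground L) ` realizations L \<and>
     closedin (subtopology (zariski_topology (ground L)) (realizations L))
       {M \<in> realizations L. moduli_point (ground L) M \<in> C}"
proof -
  have top: "topspace (subtopology (zariski_topology (ground L)) (realizations L)) = realizations L"
    by (auto simp: topspace_zariski_topology realizations_def)
  have "{M \<in> realizations L. torus_orbit (ground L) M \<in>
          {A \<in> torus_orbit (ground L) ` realizations L. PGL_orbit (ground L) A \<in> C}} =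
      {M \<in> realizations L. moduli_point (ground L) M \<in> C}"
    by blast
  moreover have "{A \<in> torus_orbit (ground L) ` realizations L. PGL_orbit (ground L) A \<in> C}
      \<subseteq> torus_orbit (ground L) ` realizations L"
    by blast
  ultimately show ?thesis
    unfolding moduli_space_def closedin_quotient_topology topspace_quotient_topology top image_image
    by simp
qed

lemma closedin_moduli_spaceI:
  fixes L :: "'e matroid" and C :: "('e, 'k::field) columns set set set"
  assumes "C \<subseteq> moduli_point (ground L) ` realizations L"
    and "\<And>M. M \<in> realizations L \<Longrightarrow> moduli_point (ground L) M \<in> C \<longleftrightarrow> (\<forall>f\<in>F. f M = 0)"
    and "F \<subseteq> polynomial_functions (ground L)" "F \<noteq> {}"
  shows "closedin (moduli_space L) C"
proof -
  have "closedin (zariski_topology (ground L)) (\<Inter>f\<in>F. {M \<in> matrices (ground L). f M = 0})"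
    using assms(3,4) by (intro closedin_INT closedin_zariski_zero_set) auto
  moreover have "{M \<in> realizations L. moduli_point (ground L) M \<in> C} =
      (\<Inter>f\<in>F. {M \<in> matrices (ground L). f M = 0}) \<inter> realizations L"
    using assms(2,4) by (auto simp: realizations_def)
  ultimately show ?thesis
    using assms(1) unfolding closedin_moduli_space closedin_subtopology by blast
qed

text \<open>Along a polynomial curve the Zariski topology is at most as fine as the cofinite one.\<close>

lemma polynomial_function_on_curve:
  assumes "f \<in> polynomial_functions E"
    and "\<And>i j. i \<in> E \<Longrightarrow> \<exists>p. \<forall>t. \<psi> t i $ j = poly p (t :: 'k::field)"
  shows "\<exists>p. \<forall>t. f (\<psi> t) = poly p t"
  using assms(1)
proof induction
  case (const c)
  show ?case by (intro exI[of _ "[:c:]"]) simp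
next
  case (add f g)
  then show ?case by (metis poly_add)
next
  case (mult f g)
  then show ?case by (metis poly_mult)
qed (use assms(2) in blast)

lemma open_on_curve:
  fixes \<psi> :: "'k::field \<Rightarrow> ('e, 'k) columns"
  assumes poly: "\<And>i j. i \<in> E \<Longrightarrow> \<exists>p. \<forall>t. \<psi> t i $ j = poly p t"
    and mat: "\<And>t. \<psi> t \<in> matrices E"
    and "openin (zariski_topology E) W"
  shows "{t. \<psi> t \<in> W} = {} \<or> finite {t. \<psi> t \<notin> W}"
  using assms(3) unfolding zariski_topology_def openin_topology_generated_by_iff
proof induction
  case (Int a b)
  have "{t. \<psi> t \<notin> a \<inter> b} = {t. \<psi> t \<notin> a} \<union> {t. \<psi> t \<notin> b}" by blast
  then show ?case using Int by auto
next
  case (UN K)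
  show ?case
  proof (cases "\<exists>k\<in>K. {t. \<psi> t \<in> k} \<noteq> {}")
    case True
    then obtain k where "k \<in> K" "finite {t. \<psi> t \<notin> k}" using UN by blast
    moreover have "{t. \<psi> t \<notin> \<Union>K} \<subseteq> {t. \<psi> t \<notin> k}" using \<open>k \<in> K\<close> by blast
    ultimately show ?thesis using finite_subset by blast
  qed auto
next
  case (Basis s)
  then obtain f where f: "s = {M \<in> matrices E. f M \<noteq> 0}" "f \<in> polynomial_functions E" by blast
  obtain p where p: "\<And>t. f (\<psi> t) = poly p t"
    using polynomial_function_on_curve[OF f(2), of \<psi>] poly by blast
  show ?case
  proof (cases "p = 0")
    case True
    then show ?thesis using f p by simp
  next
    case False
    then show ?thesis using f p mat poly_roots_finite[OF False] by simp
  qed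
qed auto

context linear_space
begin

lemma represents_proj_equiv:
  assumes "proj_equiv E M M'" "represents M"
  shows "represents M'"
proof -
  obtain g c where g: "invertible g" "\<And>i. i \<in> E \<Longrightarrow> c i \<noteq> 0 \<and> M' i = c i *s (g *v M i)"
    using assms(1) unfolding proj_equiv_def by metis
  have "det3 (M' i) (M' j) (M' k) = 0 \<longleftrightarrow> det3 (M i) (M j) (M k) = 0"
    if "i \<in> E" "j \<in> E" "k \<in> E" for i j k
    using g(2)[OF that(1)] g(2)[OF that(2)] g(2)[OF that(3)] g(1)
    by (simp add: det3_scale det3_matrix_mult invertible_det_nz)
  then show ?thesis using assms(2) unfolding represents_def by simp
qed

text \<open>The functions in the last two assumptions are cross ratios. They recover the parameters
  \<open>\<omega>\<close> and \<open>t\<close> of a realization up to equivalence, so their zero sets show that the curves and the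
  points are closed in the moduli space and that the parametrization is injective.\<close>

theorem krull_dim_moduli_space_pencils:
  fixes \<psi> :: "'k \<Rightarrow> 'k \<Rightarrow> ('e, 'k::field_char_0) columns"
  assumes fin: "finite \<Omega>" and ne: "\<Omega> \<noteq> {}"
    and mat: "\<And>\<omega> t. \<psi> \<omega> t \<in> matrices (ground L)"
    and poly: "\<And>\<omega> i j. i \<in> ground L \<Longrightarrow> \<exists>p. \<forall>t. \<psi> \<omega> t i $ j = poly p t"
    and generic: "\<And>\<omega>. \<omega> \<in> \<Omega> \<Longrightarrow> finite {t. \<psi> \<omega> t \<notin> realizations L}"
    and cover: "\<And>M. M \<in> realizations L \<Longrightarrow> \<exists>\<omega>\<in>\<Omega>. \<exists>t. proj_equiv (ground L) (\<psi> \<omega> t) M"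
    and sep\<omega>: "\<And>\<omega>. \<exists>f\<in>polynomial_functions (ground L). \<forall>\<omega>'\<in>\<Omega>. \<forall>t. \<forall>M\<in>realizations L.
        proj_equiv (ground L) (\<psi> \<omega>' t) M \<longrightarrow> (f M = 0 \<longleftrightarrow> \<omega>' = \<omega>)"
    and sept: "\<And>t. \<exists>f\<in>polynomial_functions (ground L). \<forall>\<omega>'\<in>\<Omega>. \<forall>t'. \<forall>M\<in>realizations L.
        proj_equiv (ground L) (\<psi> \<omega>' t') M \<longrightarrow> (f M = 0 \<longleftrightarrow> t' = t)"
  shows "krull_dim (moduli_space L :: ('e, 'k) columns set set topology) = 1"
proof -
  let ?E = "ground L" and ?U = "realizations L :: ('e, 'k) columns set"
  let ?q = "moduli_point ?E" and ?X = "moduli_space L :: ('e, 'k) columns set set topology"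
  define I where "I \<omega> = {?q (\<psi> \<omega> t) | t. \<psi> \<omega> t \<in> ?U}" for \<omega>
  have Umat: "M \<in> matrices ?E" if "M \<in> ?U" for M using that by (simp add: realizations_def)
  have eq: "?q M = ?q M' \<longleftrightarrow> proj_equiv ?E M M'" if "M \<in> matrices ?E" "M' \<in> matrices ?E"
    for M M' :: "('e, 'k) columns" using moduli_point_eq_iff that .
  obtain f where f: "\<And>\<omega>. f \<omega> \<in> polynomial_functions ?E"
    "\<And>\<omega> \<omega>' t M. \<omega>' \<in> \<Omega> \<Longrightarrow> M \<in> ?U \<Longrightarrow> proj_equiv ?E (\<psi> \<omega>' t) M \<Longrightarrow> f \<omega> M = 0 \<longleftrightarrow> \<omega>' = \<omega>"
    using sep\<omega> by metis
  obtain h where h: "\<And>t. h t \<in> polynomial_functions ?E"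
    "\<And>t \<omega>' t' M. \<omega>' \<in> \<Omega> \<Longrightarrow> M \<in> ?U \<Longrightarrow> proj_equiv ?E (\<psi> \<omega>' t') M \<Longrightarrow> h t M = 0 \<longleftrightarrow> t' = t"
    using sept by metis
  have coords: "\<exists>\<omega>'\<in>\<Omega>. \<exists>t'. proj_equiv ?E (\<psi> \<omega>' t') M \<and> (\<forall>\<omega>. f \<omega> M = 0 \<longleftrightarrow> \<omega>' = \<omega>)
      \<and> (\<forall>t. h t M = 0 \<longleftrightarrow> t' = t)" if "M \<in> ?U" for M
    using cover[OF that] f(2)[OF _ that] h(2)[OF _ that] by blast
  have in_I: "?q M \<in> I \<omega> \<longleftrightarrow> f \<omega> M = 0" if \<omega>: "\<omega> \<in> \<Omega>" and M: "M \<in> ?U" for M \<omega>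
  proof
    assume "?q M \<in> I \<omega>"
    then obtain t where "\<psi> \<omega> t \<in> ?U" "?q M = ?q (\<psi> \<omega> t)" by (auto simp: I_def)
    then have "proj_equiv ?E (\<psi> \<omega> t) M" using eq Umat M by metis
    then show "f \<omega> M = 0" using f(2) \<omega> M by blast
  next
    assume "f \<omega> M = 0"
    obtain \<omega>' t where "proj_equiv ?E (\<psi> \<omega>' t) M" "\<And>\<omega>. f \<omega> M = 0 \<longleftrightarrow> \<omega>' = \<omega>"
      using coords[OF M] by blast
    then have t: "proj_equiv ?E (\<psi> \<omega> t) M" using \<open>f \<omega> M = 0\<close> by simp
    then have "?q M = ?q (\<psi> \<omega> t)" using eq Umat[OF M] mat by blast
    moreover have "\<psi> \<omega> t \<in> ?U"
      using M mat t represents_proj_equiv proj_equiv_sym unfolding realizations_iff ground_L by blast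
    ultimately show "?q M \<in> I \<omega>" by (auto simp: I_def)
  qed
  show ?thesis
  proof (rule krull_dim_curves[OF fin ne, of ?X I])
    fix \<omega> assume \<omega>: "\<omega> \<in> \<Omega>"
    show "closedin ?X (I \<omega>)"
      by (rule closedin_moduli_spaceI[of _ _ "{f \<omega>}"]) (use in_I[OF \<omega>] f(1) in \<open>auto simp: I_def\<close>)
    have "inj_on (\<lambda>t. ?q (\<psi> \<omega> t)) {t. \<psi> \<omega> t \<in> ?U}"
    proof (rule inj_onI)
      fix t t' assume t: "t \<in> {t. \<psi> \<omega> t \<in> ?U}" "t' \<in> {t. \<psi> \<omega> t \<in> ?U}" "?q (\<psi> \<omega> t) = ?q (\<psi> \<omega> t')"
      then have "proj_equiv ?E (\<psi> \<omega> t) (\<psi> \<omega> t')" using eq mat by blast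
      then have "h t (\<psi> \<omega> t') = 0" using h(2)[OF \<omega>] t(2) by blast
      moreover have "h t (\<psi> \<omega> t') = 0 \<longleftrightarrow> t' = t" using h(2)[OF \<omega>] t(2) proj_equiv_refl by blast
      ultimately show "t = t'" by simp
    qed
    moreover have "infinite {t. \<psi> \<omega> t \<in> ?U}"
    proof
      assume "finite {t. \<psi> \<omega> t \<in> ?U}"
      then have "finite ({t. \<psi> \<omega> t \<in> ?U} \<union> {t. \<psi> \<omega> t \<notin> ?U})" using generic[OF \<omega>] by simp
      moreover have "{t. \<psi> \<omega> t \<in> ?U} \<union> {t. \<psi> \<omega> t \<notin> ?U} = UNIV" by blast
      ultimately show False using infinite_UNIV_char_0[where 'a = 'k] by simp
    qed
    ultimately have "infinite ((\<lambda>t. ?q (\<psi> \<omega> t)) ` {t. \<psi> \<omega> t \<in> ?U})"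
      using finite_image_iff by blast
    moreover have "I \<omega> = (\<lambda>t. ?q (\<psi> \<omega> t)) ` {t. \<psi> \<omega> t \<in> ?U}" by (auto simp: I_def)
    ultimately show "infinite (I \<omega>)" by simp
  next
    show "topspace ?X \<subseteq> (\<Union>\<omega>\<in>\<Omega>. I \<omega>)"
    proof
      fix x assume "x \<in> topspace ?X"
      then obtain M where M: "M \<in> ?U" "x = ?q M" by (auto simp: topspace_moduli_space)
      then obtain \<omega> where "\<omega> \<in> \<Omega>" "f \<omega> M = 0" using coords by blast
      then show "x \<in> (\<Union>\<omega>\<in>\<Omega>. I \<omega>)" using in_I M by blast
    qed
  next
    fix x assume "x \<in> topspace ?X"
    then obtain M where M: "M \<in> ?U" "x = ?q M" by (auto simp: topspace_moduli_space)
    obtain \<omega> t where \<omega>t: "\<omega> \<in> \<Omega>" "proj_equiv ?E (\<psi> \<omega> t) M" using cover[OF M(1)] by blast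
    have "?q N \<in> {x} \<longleftrightarrow> (\<forall>k\<in>{f \<omega>, h t}. k N = 0)" if N: "N \<in> ?U" for N
    proof
      assume "?q N \<in> {x}"
      then have "proj_equiv ?E M N" using eq[OF Umat[OF M(1)] Umat[OF N]] M(2) by simp
      then have "proj_equiv ?E (\<psi> \<omega> t) N" using \<omega>t proj_equiv_trans by blast
      then show "\<forall>k\<in>{f \<omega>, h t}. k N = 0" using f(2) h(2) \<omega>t N by blast
    next
      assume "\<forall>k\<in>{f \<omega>, h t}. k N = 0"
      then have "f \<omega> N = 0" "h t N = 0" by simp_all
      then have "proj_equiv ?E (\<psi> \<omega> t) N" using coords[OF N] by auto
      then have "proj_equiv ?E N M" using \<omega>t proj_equiv_sym proj_equiv_trans by blast
      then show "?q N \<in> {x}" using eq[OF Umat[OF N] Umat[OF M(1)]] M(2) by simp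
    qed
    then show "closedin ?X {x}"
      by (intro closedin_moduli_spaceI[of _ _ "{f \<omega>, h t}"]) (use M f(1) h(1) in auto)
  next
    fix \<omega> C assume \<omega>: "\<omega> \<in> \<Omega>" and C: "closedin ?X C"
    then obtain Z where Z: "closedin (zariski_topology ?E) Z"
        "{M \<in> ?U. ?q M \<in> C} = Z \<inter> ?U"
      unfolding closedin_moduli_space closedin_subtopology by auto
    have "openin (zariski_topology ?E) (matrices ?E - Z)"
      using Z(1) by (simp add: closedin_def topspace_zariski_topology)
    then have "{t. \<psi> \<omega> t \<in> matrices ?E - Z} = {} \<or> finite {t. \<psi> \<omega> t \<notin> matrices ?E - Z}"
      using open_on_curve[of ?E "\<psi> \<omega>"] poly mat by blast
    then show "finite (C \<inter> I \<omega>) \<or> I \<omega> \<subseteq> C"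
    proof
      assume "{t. \<psi> \<omega> t \<in> matrices ?E - Z} = {}"
      then have "\<psi> \<omega> t \<in> Z" for t using mat by blast
      then have "I \<omega> \<subseteq> C" using Z(2) by (auto simp: I_def)
      then show ?thesis by simp
    next
      assume "finite {t. \<psi> \<omega> t \<notin> matrices ?E - Z}"
      moreover have "C \<inter> I \<omega> \<subseteq> (\<lambda>t. ?q (\<psi> \<omega> t)) ` {t. \<psi> \<omega> t \<notin> matrices ?E - Z}"
      proof
        fix y assume y: "y \<in> C \<inter> I \<omega>"
        then obtain t where t: "y = ?q (\<psi> \<omega> t)" "\<psi> \<omega> t \<in> ?U" by (auto simp: I_def)
        then have "\<psi> \<omega> t \<in> {M \<in> ?U. ?q M \<in> C}" using y by simp
        then have "\<psi> \<omega> t \<in> Z" unfolding Z(2) by simp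
        then show "y \<in> (\<lambda>t. ?q (\<psi> \<omega> t)) ` {t. \<psi> \<omega> t \<notin> matrices ?E - Z}" using t by simp
      qed
      ultimately show ?thesis using finite_subset by blast
    qed
  qed
qed

end

section \<open>Projective frames and constructible lines\<close>

lemma parallel_refl [simp]: "parallel u u"
  unfolding parallel_def by (rule exI[of _ 1]) simp

lemma parallel_sym: "parallel u v \<Longrightarrow> parallel v u"
  unfolding parallel_def by (metis left_inverse nonzero_imp_inverse_nonzero vector_smult_assoc vector_smult_lid)

lemma parallel_trans [trans]: "parallel u v \<Longrightarrow> parallel v w \<Longrightarrow> parallel u w"
  unfolding parallel_def by (metis mult_eq_0_iff vector_smult_assoc)

lemma parallel_cross_prod:
  assumes "parallel u u'" "parallel v v'"
  shows "parallel (cross_prod u v) (cross_prod u' v')"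
proof -
  obtain c d where "c \<noteq> 0" "u = c *s u'" "d \<noteq> 0" "v = d *s v'"
    using assms unfolding parallel_def by blast
  then show ?thesis
    unfolding parallel_def by (intro exI[of _ "c * d"]) (simp add: cross_prod_scale)
qed

lemma parallel_det3:
  assumes "parallel u u'" "parallel v v'" "parallel w w'"
  shows "det3 u v w = 0 \<longleftrightarrow> det3 u' v' w' = 0"
  using assms by (auto simp: parallel_def det3_scale)

text \<open>The vector \<open>i\<close> is orthogonal to the two normals \<open>a \<times> b\<close> and \<open>c \<times> d\<close>, which are independent
  under the stated conditions.\<close>

lemma parallel_meet:
  assumes "det3 a b i = 0" "det3 c d i = 0" "det3 a b c \<noteq> 0" "det3 a c d \<noteq> 0" "i \<noteq> 0"
  shows "parallel i (cross_prod (cross_prod a b) (cross_prod c d))"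
proof -
  let ?u = "cross_prod a b" and ?w = "cross_prod c d"
  have "cross_prod ?u ?w \<noteq> 0"
  proof
    assume *: "cross_prod ?u ?w = 0"
    then have "dot3 ?u d *s c = dot3 ?u c *s d" by (simp add: cross_prod_cross_prod)
    then have "det3 a c (dot3 ?u c *s d) = det3 a c (dot3 ?u d *s c)" by simp
    also have "\<dots> = dot3 ?u d * det3 a c c" by (simp only: det3_def dot3_scale)
    finally have "dot3 ?u c * det3 a c d = 0" by (simp add: det3_def)
    then show False using assms(3,4) by (simp add: det3_def)
  qed
  moreover have "dot3 ?u i = 0" "dot3 ?w i = 0" using assms by (simp_all add: det3_def)
  ultimately obtain k where "i = k *s cross_prod ?u ?w" using orthogonal_to_both by blast
  moreover from this have "k \<noteq> 0" using assms(5) by auto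
  ultimately show ?thesis unfolding parallel_def by blast
qed

text \<open>The matrix that sends a vector to its three coordinate ratios with respect to the frame; its rows
  are cross products by Cramer's rule.\<close>

lemma frame_normalization:
  fixes p q r s :: "'k::field ^ 3"
  assumes "det3 p q r \<noteq> 0" "det3 s q r \<noteq> 0" "det3 p s r \<noteq> 0" "det3 p q s \<noteq> 0"
  obtains g where "invertible g" "parallel (g *v p) (vector [1, 0, 0])"
    "parallel (g *v q) (vector [0, 1, 0])" "parallel (g *v r) (vector [0, 0, 1])"
    "g *v s = vector [1, 1, 1]"
proof -
  define g :: "'k ^ 3 ^ 3" where
    "g = vector [(1 / det3 s q r) *s cross_prod q r, (1 / det3 p s r) *s cross_prod r p,
                 (1 / det3 p q s) *s cross_prod p q]"
  have g: "g *v x = vector [det3 x q r / det3 s q r, det3 p x r / det3 p s r, det3 p q x / det3 p q s]" for x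
    by (simp add: vec3_eq_iff g_def matrix_vector_mult_def sum_3 det3_def dot3_def divide_inverse algebra_simps)
  have par: "parallel (g *v p) (vector [1, 0, 0])" "parallel (g *v q) (vector [0, 1, 0])"
      "parallel (g *v r) (vector [0, 0, 1])"
    unfolding g parallel_def using assms
    by (intro exI[of _ "det3 p q r / det3 s q r"] exI[of _ "det3 p q r / det3 p s r"]
          exI[of _ "det3 p q r / det3 p q s"]; simp add: vec3_eq_iff)+
  have "det3 (g *v p) (g *v q) (g *v r) \<noteq> 0"
    unfolding parallel_det3[OF par] by (simp add: det3_def dot3_def)
  then have "invertible g" by (auto simp: det3_matrix_mult invertible_det_nz)
  moreover have "g *v s = vector [1, 1, 1]" using assms by (simp add: g)
  ultimately show thesis using that par by blast
qed

context linear_space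
begin

text \<open>Line \<open>i\<close> passes through the point of \<open>a\<close>, \<open>b\<close> and through the point of \<open>c\<close>, \<open>d\<close>, and these points
  differ. The last condition ensures that the vector of \<open>i\<close> is non-zero whenever the determinants of
  the five lines are the prescribed ones.\<close>

definition constructible :: "'e \<Rightarrow> 'e \<Rightarrow> 'e \<Rightarrow> 'e \<Rightarrow> 'e \<Rightarrow> bool" where
  "constructible i a b c d \<longleftrightarrow> concurrent {a, b, i} \<and> concurrent {c, d, i} \<and>
     \<not> concurrent {a, b, c} \<and> \<not> concurrent {a, c, d} \<and> \<not> concurrent {a, c, i}"

lemma constructible_parallel:
  fixes M :: "'e \<Rightarrow> 'k::field ^ 3"
  assumes "\<And>i j k. \<lbrakk>i \<in> S; j \<in> S; k \<in> S\<rbrakk> \<Longrightarrow> det3 (M i) (M j) (M k) = 0 \<longleftrightarrow> concurrent {i, j, k}"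
    and "constructible i a b c d" "{i, a, b, c, d} \<subseteq> S"
  shows "parallel (M i) (cross_prod (cross_prod (M a) (M b)) (cross_prod (M c) (M d)))"
proof (rule parallel_meet)
  have S: "i \<in> S" "a \<in> S" "b \<in> S" "c \<in> S" "d \<in> S" using assms(3) by auto
  note con = assms(2)[unfolded constructible_def]
  show "det3 (M a) (M b) (M i) = 0" using assms(1)[OF S(2,3,1)] con by simp
  show "det3 (M c) (M d) (M i) = 0" using assms(1)[OF S(4,5,1)] con by simp
  show "det3 (M a) (M b) (M c) \<noteq> 0" using assms(1)[OF S(2,3,4)] con by simp
  show "det3 (M a) (M c) (M d) \<noteq> 0" using assms(1)[OF S(2,4,5)] con by simp
  have "det3 (M a) (M c) (M i) \<noteq> 0" using assms(1)[OF S(2,4,1)] con by simp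
  then show "M i \<noteq> 0" by (rule det3_nonzero_imp)
qed

end

text \<open>Both sides are invariant under permutations and hold when two lines coincide.\<close>

lemma det3_concurrent_of_increasing:
  fixes M :: "'e::linorder \<Rightarrow> 'k::field ^ 3"
  assumes "linear_space E BB" "S \<subseteq> E"
    and inc: "\<And>i j k. \<lbrakk>i \<in> S; j \<in> S; k \<in> S; i < j; j < k\<rbrakk> \<Longrightarrow>
          det3 (M i) (M j) (M k) = 0 \<longleftrightarrow> linear_space.concurrent BB {i, j, k}"
    and ijk: "i \<in> S" "j \<in> S" "k \<in> S"
  shows "det3 (M i) (M j) (M k) = 0 \<longleftrightarrow> linear_space.concurrent BB {i, j, k}"
proof -
  interpret linear_space E BB by fact
  let ?P = "\<lambda>i j k. det3 (M i) (M j) (M k) = 0 \<longleftrightarrow> concurrent {i, j, k}"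
  have swap: "?P i j k \<longleftrightarrow> ?P j i k" "?P i j k \<longleftrightarrow> ?P i k j" for i j k
  proof -
    have "{i, j, k} = {j, i, k}" "{i, j, k} = {i, k, j}" by auto
    then show "?P i j k \<longleftrightarrow> ?P j i k" "?P i j k \<longleftrightarrow> ?P i k j"
      using det3_eq_0_perm[of "M i" "M j" "M k"] by (simp_all only:)
  qed
  have E: "i \<in> E" "j \<in> E" "k \<in> E" using ijk assms(2) by auto
  show ?thesis
  proof (cases "i = j \<or> i = k \<or> j = k")
    case True
    then show ?thesis
      using concurrent_pair[OF E(1,2)] concurrent_pair[OF E(1,3)] by (auto simp: insert_commute)
  next
    case False
    then consider "i < j" "j < k" | "i < k" "k < j" | "j < i" "i < k" | "j < k" "k < i"
      | "k < i" "i < j" | "k < j" "j < i"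
      by (metis linorder_cases)
    then show ?thesis
    proof cases
      case 1 then show ?thesis using inc ijk by blast
    next
      case 2 then show ?thesis using inc[of i k j] ijk swap(2)[of i j k] by blast
    next
      case 3 then show ?thesis using inc[of j i k] ijk swap(1)[of i j k] by blast
    next
      case 4 then show ?thesis using inc[of j k i] ijk swap(1)[of i j k] swap(2)[of j i k] by blast
    next
      case 5 then show ?thesis using inc[of k i j] ijk swap(2)[of i j k] swap(1)[of i k j] by blast
    next
      case 6
      then show ?thesis
        using inc[of k j i] ijk swap(1)[of i j k] swap(2)[of j i k] swap(1)[of j k i] by blast
    qed
  qed
qed

section \<open>Integer polynomials as coefficient lists\<close>

fun peval :: "int list \<Rightarrow> 'k::comm_ring_1 \<Rightarrow> 'k" where
  "peval [] x = 0"
| "peval (a # p) x = of_int a + x * peval p x"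

fun padd :: "int list \<Rightarrow> int list \<Rightarrow> int list" where
  "padd [] q = q"
| "padd p [] = p"
| "padd (a # p) (b # q) = (a + b) # padd p q"

definition pscale :: "int \<Rightarrow> int list \<Rightarrow> int list" where
  "pscale c p = map ((*) c) p"

definition psub :: "int list \<Rightarrow> int list \<Rightarrow> int list" where
  "psub p q = padd p (pscale (-1) q)"

fun pmul :: "int list \<Rightarrow> int list \<Rightarrow> int list" where
  "pmul [] q = []"
| "pmul (a # p) q = padd (pscale a q) (0 # pmul p q)"

definition is_zero :: "int list \<Rightarrow> bool" where
  "is_zero p \<longleftrightarrow> list_all (\<lambda>c. c = 0) p"

text \<open>The remainder modulo \<open>x\<^sup>d - s(x)\<close>, where \<open>d\<close> is the length of \<open>s\<close>. The list \<open>s\<close> thus stands for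
  a monic polynomial, and remainders have exactly \<open>d\<close> coefficients.\<close>

fun reduce_mod :: "int list \<Rightarrow> int list \<Rightarrow> int list" where
  "reduce_mod s [] = map (\<lambda>_. 0) s"
| "reduce_mod s (a # p) = (let q = reduce_mod s p in padd (a # butlast q) (pscale (last q) s))"

lemma peval_padd [simp]: "peval (padd p q) x = peval p x + peval q x"
  by (induction p q rule: padd.induct) (simp_all add: algebra_simps)

lemma peval_pscale [simp]: "peval (pscale c p) x = of_int c * peval p x"
  by (induction p) (simp_all add: pscale_def algebra_simps)

lemma peval_psub [simp]: "peval (psub p q) x = peval p x - peval q x"
  by (simp add: psub_def)

lemma peval_pmul [simp]: "peval (pmul p q) x = peval p x * peval q x"
  by (induction p) (simp_all add: algebra_simps)

lemma peval_append: "peval (p @ q) x = peval p x + x ^ length p * peval q x"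
  by (induction p) (simp_all add: algebra_simps)

lemma is_zero_peval: "is_zero p \<Longrightarrow> peval p x = 0"
  by (induction p) (simp_all add: is_zero_def)

lemma length_padd: "length (padd p q) = max (length p) (length q)"
  by (induction p q rule: padd.induct) auto

lemma length_reduce_mod: "s \<noteq> [] \<Longrightarrow> length (reduce_mod s p) = length s"
  by (induction p) (auto simp: Let_def length_padd pscale_def)

lemma peval_reduce_mod:
  assumes "s \<noteq> []" "x ^ length s = peval s x"
  shows "peval (reduce_mod s p) x = peval p x"
proof (induction p)
  case Nil
  have "is_zero (map (\<lambda>_. 0) s)" by (simp add: is_zero_def list_all_iff)
  then show ?case using is_zero_peval by auto
next
  case (Cons a p)
  define q where "q = reduce_mod s p"
  have len: "length q = length s" using length_reduce_mod[OF assms(1)] by (simp add: q_def)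
  then have "q \<noteq> []" using assms(1) by auto
  then have "peval q x = peval (butlast q @ [last q]) x" by simp
  also have "\<dots> = peval (butlast q) x + x ^ (length s - 1) * of_int (last q)"
    by (simp add: peval_append len del: append_butlast_last_id)
  finally have "x * peval q x = x * peval (butlast q) x + (x * x ^ (length s - 1)) * of_int (last q)"
    by (simp add: algebra_simps)
  also have "x * x ^ (length s - 1) = peval s x"
    using assms by (metis length_greater_0_conv power_Suc Suc_diff_1)
  finally show ?case
    using Cons by (simp add: q_def[symmetric] Let_def algebra_simps)
qed

text \<open>The powers of the root \<open>x\<close> below its degree are linearly independent over the integers, so that
  zero tests in \<open>\<int>[x]\<close> can be carried out on remainders.\<close>

definition integral_basis :: "int list \<Rightarrow> 'k::comm_ring_1 \<Rightarrow> bool" where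
  "integral_basis s x \<longleftrightarrow> x ^ length s = peval s x \<and>
     (\<forall>p. length p = length s \<longrightarrow> peval p x = 0 \<longrightarrow> is_zero p)"

definition vanishes :: "int list \<Rightarrow> int list \<Rightarrow> bool" where
  "vanishes s p \<longleftrightarrow> is_zero (reduce_mod s p)"

lemma vanishes_iff:
  assumes "s \<noteq> []" "integral_basis s x"
  shows "vanishes s p \<longleftrightarrow> peval p x = 0"
  using assms peval_reduce_mod[OF assms(1), of x p] length_reduce_mod[OF assms(1), of p] is_zero_peval[of "reduce_mod s p" x]
  unfolding integral_basis_def vanishes_def by metis

type_synonym pvec = "int list \<times> int list \<times> int list"

fun veval :: "pvec \<Rightarrow> 'k::field \<Rightarrow> 'k ^ 3" where
  "veval (p, q, r) x = vector [peval p x, peval q x, peval r x]"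

fun pcross :: "pvec \<Rightarrow> pvec \<Rightarrow> pvec" where
  "pcross (a, b, c) (d, e, f) =
     (psub (pmul b f) (pmul c e), psub (pmul c d) (pmul a f), psub (pmul a e) (pmul b d))"

fun pdot :: "pvec \<Rightarrow> pvec \<Rightarrow> int list" where
  "pdot (a, b, c) (d, e, f) = padd (pmul a d) (padd (pmul b e) (pmul c f))"

lemma veval_pcross: "veval (pcross u v) x = cross_prod (veval u x) (veval v x)"
  by (cases u; cases v) (simp add: vec3_eq_iff)

lemma peval_pdot: "peval (pdot u v) x = dot3 (veval u x) (veval v x)"
  by (cases u; cases v) (simp add: dot3_def)

section \<open>Lists of points\<close>

fun pairs :: "'a list \<Rightarrow> ('a \<times> 'a) list" where
  "pairs [] = []"
| "pairs (x # xs) = map (Pair x) xs @ pairs xs"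

fun trips :: "'a list \<Rightarrow> ('a \<times> 'a \<times> 'a) list" where
  "trips [] = []"
| "trips (x # xs) = map (Pair x) (pairs xs) @ trips xs"

lemma set_pairs:
  "sorted_wrt (<) xs \<Longrightarrow> set (pairs xs) = {(x, y). x \<in> set xs \<and> y \<in> set xs \<and> x < (y :: 'a::linorder)}"
  by (induction xs) auto

lemma set_trips:
  "sorted_wrt (<) xs \<Longrightarrow> set (trips xs) =
     {(x, y, z). x \<in> set xs \<and> y \<in> set xs \<and> z \<in> set xs \<and> x < y \<and> y < (z :: 'a::linorder)}"
  by (induction xs) (auto simp: set_pairs)

lemma distinct_pairs: "sorted_wrt (<) (xs :: 'a::linorder list) \<Longrightarrow> distinct (pairs xs)"
proof (induction xs)
  case (Cons x xs)
  then have "distinct xs" by (simp add: strict_sorted_iff)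
  then show ?case using Cons by (auto simp: distinct_map set_pairs inj_on_def)
qed simp

text \<open>Two arrangements of the same pairs or triples are compared by merging sorted lists. Only the
  multiset of the result matters for the proofs.\<close>

fun merge_by :: "('a \<Rightarrow> 'a \<Rightarrow> bool) \<Rightarrow> 'a list \<Rightarrow> 'a list \<Rightarrow> 'a list" where
  "merge_by le [] ys = ys"
| "merge_by le xs [] = xs"
| "merge_by le (x # xs) (y # ys) =
     (if le x y then x # merge_by le xs (y # ys) else y # merge_by le (x # xs) ys)"

fun merge_adjacent :: "('a \<Rightarrow> 'a \<Rightarrow> bool) \<Rightarrow> 'a list list \<Rightarrow> 'a list list" where
  "merge_adjacent le (xs # ys # zss) = merge_by le xs ys # merge_adjacent le zss"
| "merge_adjacent le xss = xss"

lemma length_merge_adjacent: "length (merge_adjacent le xss) \<le> length xss"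
  by (induction le xss rule: merge_adjacent.induct) auto

function merge_all :: "('a \<Rightarrow> 'a \<Rightarrow> bool) \<Rightarrow> 'a list list \<Rightarrow> 'a list" where
  "merge_all le [] = []"
| "merge_all le [xs] = xs"
| "merge_all le (xs # ys # zss) = merge_all le (merge_by le xs ys # merge_adjacent le zss)"
  by pat_completeness auto
termination
  by (relation "Wellfounded.measure (\<lambda>(le, xss). length xss)") (simp_all add: length_merge_adjacent less_Suc_eq_le)

lemma mset_merge_by: "mset (merge_by le xs ys) = mset xs + mset ys"
  by (induction le xs ys rule: merge_by.induct) auto

lemma mset_merge_adjacent: "mset (concat (merge_adjacent le xss)) = mset (concat xss)"
  by (induction le xss rule: merge_adjacent.induct) (auto simp: mset_merge_by)

lemma mset_merge_all: "mset (merge_all le xss) = mset (concat xss)"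
  by (induction le xss rule: merge_all.induct) (simp_all add: mset_merge_by mset_merge_adjacent)

fun lex2 :: "nat \<times> nat \<Rightarrow> nat \<times> nat \<Rightarrow> bool" where
  "lex2 (a, b) (c, d) \<longleftrightarrow> (if a < c then True else if a = c then b \<le> d else False)"

fun lex3 :: "nat \<times> nat \<times> nat \<Rightarrow> nat \<times> nat \<times> nat \<Rightarrow> bool" where
  "lex3 (a, b) (c, d) \<longleftrightarrow> (if a < c then True else if a = c then lex2 b d else False)"

text \<open>The pairs of lines sharing a point are all pairs, each of them once.\<close>

definition point_list :: "nat \<Rightarrow> nat list list \<Rightarrow> bool" where
  "point_list n Bs \<longleftrightarrow> Bs \<noteq> [] \<and>
     list_all (\<lambda>B. successively (<) (0 # B) \<and> list_all (\<lambda>i. i \<le> n) B \<and>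
       2 \<le> length B \<and> length B < n) Bs \<and>
     merge_all lex2 (map pairs Bs) = pairs [1..<Suc n]"

locale points_of_lines =
  fixes n :: nat and Bs :: "nat list list"
  assumes point_list: "point_list n Bs"
begin

lemma block_props:
  assumes "B \<in> set Bs"
  shows "sorted_wrt (<) B" "set B \<subseteq> {1..n}" "2 \<le> length B" "length B < n" "distinct B"
proof -
  have B: "successively (<) (0 # B)" "\<forall>i\<in>set B. i \<le> n" "2 \<le> length B" "length B < n"
    using point_list assms by (auto simp: point_list_def list_all_iff)
  then have "sorted_wrt (<) (0 # B)" by (simp add: successively_conv_sorted_wrt del: successively.simps)
  then show "sorted_wrt (<) B" "set B \<subseteq> {1..n}" using B by (auto simp: Suc_le_eq)
  then show "distinct B" by (simp add: strict_sorted_iff)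
qed (use point_list assms in \<open>auto simp: point_list_def list_all_iff\<close>)

lemma mset_pairs: "mset (concat (map pairs Bs)) = mset (pairs [1..<Suc n])"
  using mset_merge_all[of lex2 "map pairs Bs"] point_list by (simp add: point_list_def)

lemma distinct_pairs_Bs: "distinct (concat (map pairs Bs))"
  using mset_eq_imp_distinct_iff[OF mset_pairs] distinct_pairs[OF sorted_wrt_upt] by (simp del: upt_Suc)

lemma pairs_unique:
  assumes "B \<in> set Bs" "B' \<in> set Bs" "p \<in> set (pairs B)" "p \<in> set (pairs B')"
  shows "pairs B = pairs B'"
proof (rule ccontr)
  assume "pairs B \<noteq> pairs B'"
  moreover note distinct_pairs_Bs
  ultimately have "set (pairs B) \<inter> set (pairs B') = {}"
    using assms(1,2) unfolding distinct_concat_iff by auto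
  then show False using assms by blast
qed

lemma two_elements:
  assumes "B \<in> set Bs" shows "\<exists>i j. i < j \<and> i \<in> set B \<and> j \<in> set B"
proof -
  obtain i j xs where "B = i # j # xs"
    using block_props(3)[OF assms] by (metis Suc_le_length_iff numeral_2_eq_2)
  then show ?thesis using block_props(1)[OF assms] by auto
qed

lemma set_eq_of_pairs_eq:
  assumes "B \<in> set Bs" "B' \<in> set Bs" "pairs B = pairs B'"
  shows "set B \<subseteq> set B'"
proof
  fix i assume i: "i \<in> set B"
  obtain j k where jk: "j < k" "j \<in> set B" "k \<in> set B" using two_elements[OF assms(1)] by blast
  have "(i, k) \<in> set (pairs B) \<or> (k, i) \<in> set (pairs B) \<or> (j, i) \<in> set (pairs B)"
    unfolding set_pairs[OF block_props(1)[OF assms(1)]] using i jk by simp linarith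
  then show "i \<in> set B'"
    unfolding assms(3) set_pairs[OF block_props(1)[OF assms(2)]] by auto
qed

lemma block_of_pair:
  assumes "B \<in> set Bs" "B' \<in> set Bs" "i \<noteq> j" "{i, j} \<subseteq> set B" "{i, j} \<subseteq> set B'"
  shows "pairs B = pairs B'"
proof -
  have "(min i j, max i j) \<in> set (pairs B)" "(min i j, max i j) \<in> set (pairs B')"
    using assms set_pairs[OF block_props(1)[OF assms(1)]] set_pairs[OF block_props(1)[OF assms(2)]]
    by (auto simp: min_def max_def)
  then show ?thesis using pairs_unique assms by blast
qed

lemma all_pairs: "(\<Union>B\<in>set Bs. set (pairs B)) = set (pairs [1..<Suc n])"
  using mset_eq_setD[OF mset_pairs] by (simp del: upt_Suc)

sublocale linear_space "{1..n}" "set ` set Bs"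
proof
  fix B assume "B \<in> set ` set Bs"
  then obtain B' where B': "B' \<in> set Bs" "B = set B'" by blast
  have "card B < card {1..n}" using block_props(4,5)[OF B'(1)] distinct_card B'(2) by fastforce
  then show "B \<subset> {1..n}" using block_props(2)[OF B'(1)] B'(2) by auto
  show "\<exists>i\<in>B. \<exists>j\<in>B. i \<noteq> j" using two_elements[OF B'(1)] B'(2) by (metis less_irrefl)
next
  fix i j :: nat assume ij: "i \<in> {1..n}" "j \<in> {1..n}" "i \<noteq> j"
  have "(min i j, max i j) \<in> set (pairs [1..<Suc n])"
    unfolding set_pairs[OF sorted_wrt_upt] using ij by (auto simp: min_def max_def)
  then obtain B where B: "B \<in> set Bs" "(min i j, max i j) \<in> set (pairs B)"
    unfolding all_pairs[symmetric] by blast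
  then have "i \<in> set B \<and> j \<in> set B"
    using set_pairs[OF block_props(1)[OF B(1)]] by (auto simp: min_def max_def split: if_splits)
  then show "\<exists>B\<in>set ` set Bs. i \<in> B \<and> j \<in> B" using B(1) by blast
next
  fix B B' i j assume *: "B \<in> set ` set Bs" "B' \<in> set ` set Bs" "i \<noteq> j" "{i, j} \<subseteq> B" "{i, j} \<subseteq> B'"
  then show "B = B'"
    using block_of_pair set_eq_of_pairs_eq by (smt (verit) imageE subset_antisym)
qed (use point_list in \<open>auto simp: point_list_def\<close>)

lemma inj_on_set_Bs: "inj_on set (set Bs)" and distinct_Bs: "distinct Bs"
proof -
  have ne: "[] \<notin> set (map pairs Bs)"
    using two_elements block_props(1) set_pairs by fastforce
  have "distinct (removeAll [] (map pairs Bs))"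
    using distinct_pairs_Bs by (simp only: distinct_concat_iff)
  then have d: "distinct (map pairs Bs)" using ne by (simp only: removeAll_id not_False_eq_True)
  then show "distinct Bs" by (simp add: distinct_map)
  show "inj_on set (set Bs)"
  proof (rule inj_onI)
    fix B B' assume B: "B \<in> set Bs" "B' \<in> set Bs" "set B = set B'"
    then obtain i j where "i < j" "{i, j} \<subseteq> set B" using two_elements by blast
    then have "pairs B = pairs B'" using block_of_pair[of B B' i j] B by auto
    then show "B = B'" using d B by (auto simp: distinct_map dest: inj_onD)
  qed
qed

lemma sigma_L: "sigma L = 3 + sum_list (map (\<lambda>B. int (length B) - 3) Bs)"
proof -
  have "sigma L = 3 + (\<Sum>B\<in>set Bs. int (card (set B)) - 3)"
    unfolding sigma_def points_L by (simp add: sum.reindex[OF inj_on_set_Bs])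
  also have "(\<Sum>B\<in>set Bs. int (card (set B)) - 3) = (\<Sum>B\<in>set Bs. int (length B) - 3)"
    using block_props(5) by (intro sum.cong) (simp_all add: distinct_card)
  finally show ?thesis using distinct_Bs by (simp add: sum_list_distinct_conv_sum_set)
qed

end

subsection \<open>Decoding\<close>

lemma pairs_upt:
  "pairs [i..<m] = concat (map (\<lambda>a. map (\<lambda>b. (a, b)) [a + 1..<m]) [i..<m])"
proof (induction "m - i" arbitrary: i)
  case (Suc k)
  then have "[i..<m] = i # [Suc i..<m]" "k = m - Suc i" by (simp_all add: upt_conv_Cons)
  then show ?case using Suc(1)[of "Suc i"] by simp
qed simp

lemma trips_upt:
  "trips [i..<m] =
     concat (map (\<lambda>a. concat (map (\<lambda>b. map (\<lambda>c. (a, b, c)) [b + 1..<m]) [a + 1..<m])) [i..<m])"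
proof (induction "m - i" arbitrary: i)
  case (Suc k)
  then have "[i..<m] = i # [Suc i..<m]" "k = m - Suc i" by (simp_all add: upt_conv_Cons)
  then show ?case using Suc(1)[of "Suc i"] by (simp add: pairs_upt map_concat o_def)
qed simp

text \<open>The list of all triples is never computed: a triple is decoded by computing its position.\<close>

lemma triples_eq_trips: "triples n = trips [1..<Suc n]"
  by (simp add: triples_def trips_upt del: upt_Suc)

fun pos :: "'a list \<Rightarrow> 'a \<Rightarrow> nat" where
  "pos [] a = 0"
| "pos (x # xs) a = (if a = x then 0 else Suc (pos xs a))"

fun pair_pos :: "'a list \<Rightarrow> 'a \<times> 'a \<Rightarrow> nat" where
  "pair_pos [] p = 0"
| "pair_pos (x # xs) (a, b) = (if a = x then pos xs b else length xs + pair_pos xs (a, b))"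

fun triple_pos :: "'a list \<Rightarrow> 'a \<times> 'a \<times> 'a \<Rightarrow> nat" where
  "triple_pos [] p = 0"
| "triple_pos (x # xs) (a, b) =
     (if a = x then pair_pos xs b else length xs * (length xs - 1) div 2 + triple_pos xs (a, b))"

lemma nth_pos: "a \<in> set xs \<Longrightarrow> pos xs a < length xs \<and> xs ! pos xs a = a"
  by (induction xs) auto

lemma length_pairs: "length (pairs xs) = length xs * (length xs - 1) div 2"
proof (induction xs)
  case (Cons x xs)
  have "length xs * (length xs - 1) div 2 + length xs = Suc (length xs) * length xs div 2"
    by (cases "length xs") (simp_all add: algebra_simps)
  then show ?case using Cons by simp
qed simp

lemma nth_pair_pos:
  "distinct xs \<Longrightarrow> p \<in> set (pairs xs) \<Longrightarrow> pair_pos xs p < length (pairs xs) \<and> pairs xs ! pair_pos xs p = p"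
proof (induction xs)
  case (Cons x xs)
  obtain a b where p: "p = (a, b)" by (cases p)
  have sub: "fst q \<in> set ys" if "q \<in> set (pairs ys)" for q and ys :: "'a list"
    using that by (induction ys) auto
  show ?case
  proof (cases "a = x")
    case True
    then have "b \<in> set xs" using Cons(2,3) sub[of "(a, b)" xs] by (auto simp: p)
    then show ?thesis using True nth_pos[of b xs] by (simp add: p nth_append)
  next
    case False
    then have "p \<in> set (pairs xs)" using Cons(3) by (auto simp: p)
    then show ?thesis using Cons(1,2) False by (simp add: p nth_append)
  qed
qed simp

lemma nth_triple_pos:
  "distinct xs \<Longrightarrow> t \<in> set (trips xs) \<Longrightarrow> triple_pos xs t < length (trips xs) \<and> trips xs ! triple_pos xs t = t"
proof (induction xs)
  case (Cons x xs)
  obtain a p where t: "t = (a, p)" by (cases t)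
  have sub: "fst q \<in> set ys" if "q \<in> set (trips ys)" for q and ys :: "'a list"
    using that by (induction ys) auto
  show ?case
  proof (cases "a = x")
    case True
    then have "p \<in> set (pairs xs)" using Cons(2,3) sub[of "(a, p)" xs] by (auto simp: t)
    then show ?thesis using True nth_pair_pos[of xs p] Cons(2) by (simp add: t nth_append)
  next
    case False
    then have "t \<in> set (trips xs)" using Cons(3) by (auto simp: t)
    then show ?thesis using Cons(1,2) False by (simp add: t nth_append length_pairs)
  qed
qed simp

definition encodes :: "nat \<Rightarrow> nat list \<Rightarrow> nat list list \<Rightarrow> bool" where
  "encodes n D Bs \<longleftrightarrow> map (\<lambda>t. Suc (triple_pos [1..<Suc n] t)) (merge_all lex3 (map trips Bs)) = D"

lemma card_3_increasing:
  assumes "card X = 3" obtains a b c :: "'a::linorder" where "a < b" "b < c" "X = {a, b, c}"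
proof -
  have fin: "finite X" using assms card.infinite by fastforce
  define xs where "xs = sorted_list_of_set X"
  have xs: "length xs = 3" "set xs = X" "sorted_wrt (<) xs"
    using assms fin by (simp_all add: xs_def)
  then obtain a b c where "xs = [a, b, c]"
    by (auto simp: numeral_3_eq_3 length_Suc_conv)
  then show thesis using that xs by auto
qed

lemma (in points_of_lines) encoded_triples_eq:
  assumes "encodes n D Bs"
  shows "encoded_triples n D = set (concat (map trips Bs))"
proof -
  let ?N = "[1..<Suc n]"
  have sub: "t \<in> set (trips ?N)" if "t \<in> set (concat (map trips Bs))" for t
    using that block_props(2) unfolding set_trips[OF sorted_wrt_upt]
    by (fastforce simp: set_trips[OF block_props(1)])
  have T: "set (merge_all lex3 (map trips Bs)) = set (concat (map trips Bs))"
    by (rule mset_eq_setD[OF mset_merge_all])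
  have D: "D = map (\<lambda>t. Suc (triple_pos ?N t)) (merge_all lex3 (map trips Bs))"
    using assms by (simp only: encodes_def)
  have "encoded_triples n D = (\<lambda>i. triples n ! (i - 1)) ` {i \<in> set D. 1 \<le> i \<and> i \<le> length (triples n)}"
    unfolding encoded_triples_def by auto
  also have "{i \<in> set D. 1 \<le> i \<and> i \<le> length (triples n)} =
      (\<lambda>t. Suc (triple_pos ?N t)) ` set (concat (map trips Bs))"
    using nth_triple_pos[OF distinct_upt sub]
    unfolding D set_map T triples_eq_trips by (force simp: Suc_le_eq simp del: upt_Suc)
  also have "(\<lambda>i. triples n ! (i - 1)) ` \<dots> = (\<lambda>t. trips ?N ! triple_pos ?N t) ` set (concat (map trips Bs))"
    by (simp only: image_image triples_eq_trips diff_Suc_1)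
  also have "\<dots> = (\<lambda>t. t) ` set (concat (map trips Bs))"
    using nth_triple_pos[OF distinct_upt sub] by (intro image_cong refl) blast
  also have "\<dots> = set (concat (map trips Bs))" by simp
  finally show ?thesis .
qed

lemma (in points_of_lines) encoded_triples_iff:
  assumes "encodes n D Bs"
  shows "(i, j, k) \<in> encoded_triples n D \<longleftrightarrow> i < j \<and> j < k \<and> concurrent {i, j, k}"
proof -
  have "encoded_triples n D = set (concat (map trips Bs))" by (rule encoded_triples_eq[OF assms])
  also have "\<dots> = {(i, j, k). i < j \<and> j < k \<and> concurrent {i, j, k}}"
    using set_trips[OF block_props(1)] by (fastforce simp: concurrent_def)
  finally show ?thesis by simp
qed

lemma (in points_of_lines) encoded_matroid_eq:
  assumes "encodes n D Bs"
  shows "encoded_matroid n D = L"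
proof -
  have "(\<forall>a b c. a < b \<and> b < c \<and> X = {a, b, c} \<longrightarrow> (a, b, c) \<notin> encoded_triples n D)
      \<longleftrightarrow> (card X = 3 \<longrightarrow> \<not> concurrent X)" for X
  proof
    assume *: "\<forall>a b c. a < b \<and> b < c \<and> X = {a, b, c} \<longrightarrow> (a, b, c) \<notin> encoded_triples n D"
    show "card X = 3 \<longrightarrow> \<not> concurrent X"
    proof
      assume "card X = 3"
      then obtain a b c where "a < b" "b < c" "X = {a, b, c}" by (rule card_3_increasing)
      then show "\<not> concurrent X" using * encoded_triples_iff[OF assms] by blast
    qed
  next
    assume *: "card X = 3 \<longrightarrow> \<not> concurrent X"
    show "\<forall>a b c. a < b \<and> b < c \<and> X = {a, b, c} \<longrightarrow> (a, b, c) \<notin> encoded_triples n D"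
    proof (intro allI impI)
      fix a b c assume abc: "a < b \<and> b < c \<and> X = {a, b, c}"
      then have "card X = 3" by simp
      then show "(a, b, c) \<notin> encoded_triples n D" using * abc encoded_triples_iff[OF assms] by simp
    qed
  qed
  then show ?thesis unfolding encoded_matroid_def L_def by simp
qed

section \<open>Arrangements over a number field\<close>

text \<open>The triples of increasing keys whose values satisfy \<open>Q (f u v) w\<close>. With three nested recursions
  the cross product of a pair is computed once for all third lines.\<close>

fun select_thirds :: "('w \<Rightarrow> 'v \<Rightarrow> bool) \<Rightarrow> 'i \<Rightarrow> 'i \<Rightarrow> 'w \<Rightarrow> ('i \<times> 'v) list \<Rightarrow> ('i \<times> 'i \<times> 'i) list" where
  "select_thirds Q i j u [] = []"
| "select_thirds Q i j u ((k, w) # P) =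
     (if Q u w then (i, j, k) # select_thirds Q i j u P else select_thirds Q i j u P)"

fun select_seconds ::
    "('v \<Rightarrow> 'v \<Rightarrow> 'w) \<Rightarrow> ('w \<Rightarrow> 'v \<Rightarrow> bool) \<Rightarrow> 'i \<Rightarrow> 'v \<Rightarrow> ('i \<times> 'v) list \<Rightarrow> ('i \<times> 'i \<times> 'i) list" where
  "select_seconds f Q i v [] = []"
| "select_seconds f Q i v ((j, w) # P) = select_thirds Q i j (f v w) P @ select_seconds f Q i v P"

fun select_triples ::
    "('v \<Rightarrow> 'v \<Rightarrow> 'w) \<Rightarrow> ('w \<Rightarrow> 'v \<Rightarrow> bool) \<Rightarrow> ('i \<times> 'v) list \<Rightarrow> ('i \<times> 'i \<times> 'i) list" where
  "select_triples f Q [] = []"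
| "select_triples f Q ((i, v) # P) = select_seconds f Q i v P @ select_triples f Q P"

lemma set_select_thirds:
  "set (select_thirds Q i j u P) = {(i, j, k) | k w. (k, w) \<in> set P \<and> Q u w}"
  by (induction P) (auto split: if_splits)

lemma mem_select_seconds:
  fixes P :: "('i::linorder \<times> 'v) list"
  shows "sorted_wrt (<) (map fst P) \<Longrightarrow> (a, j, k) \<in> set (select_seconds f Q i v P) \<longleftrightarrow> a = i \<and> j < k \<and>
     (\<exists>w x. (j, w) \<in> set P \<and> (k, x) \<in> set P \<and> Q (f v w) x)"
proof (induction P)
  case (Cons q P)
  obtain j' w' where q: "q = (j', w')" by (cases q)
  have less: "j' < k'" if "(k', x) \<in> set P" for k' x
    using Cons(2) that by (auto simp: q)
  then have irr: "(j', x) \<notin> set P" for x by blast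
  show ?case
    using Cons(1) Cons(2) less irr by (auto simp: q set_select_thirds dest: less_asym)
qed simp

lemma mem_select_triples:
  fixes P :: "('i::linorder \<times> 'v) list"
  shows "sorted_wrt (<) (map fst P) \<Longrightarrow> (i, j, k) \<in> set (select_triples f Q P) \<longleftrightarrow> i < j \<and> j < k \<and>
     (\<exists>v w x. (i, v) \<in> set P \<and> (j, w) \<in> set P \<and> (k, x) \<in> set P \<and> Q (f v w) x)"
proof (induction P)
  case (Cons q P)
  obtain i' v' where q: "q = (i', v')" by (cases q)
  have less: "i' < k'" if "(k', x) \<in> set P" for k' x
    using Cons(2) that by (auto simp: q)
  have P: "sorted_wrt (<) (map fst P)" using Cons(2) by simp
  have tail: "(j, w) \<in> set P" if "(i, v) \<in> set (q # P)" "(j, w) \<in> set (q # P)" "i < j" for i j v w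
    using that less[of i v] by (auto simp: q)
  define A where "A v \<longleftrightarrow> (\<exists>w x. (j, w) \<in> set P \<and> (k, x) \<in> set P \<and> Q (f v w) x)" for v
  have "(i, j, k) \<in> set (select_triples f Q (q # P)) \<longleftrightarrow>
      i = i' \<and> j < k \<and> A v' \<or> i < j \<and> j < k \<and> (\<exists>v. (i, v) \<in> set P \<and> A v)"
    unfolding q A_def by (simp add: mem_select_seconds[OF P] Cons(1)[OF P])
  also have "\<dots> \<longleftrightarrow> i < j \<and> j < k \<and> (\<exists>v. (i, v) \<in> set (q # P) \<and> A v)"
    using less unfolding A_def q by auto
  also have "\<dots> \<longleftrightarrow> i < j \<and> j < k \<and> (\<exists>v w x. (i, v) \<in> set (q # P) \<and>
      (j, w) \<in> set (q # P) \<and> (k, x) \<in> set (q # P) \<and> Q (f v w) x)"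
    unfolding A_def using tail by (meson list.set_intros(2))
  finally show ?case .
qed simp

text \<open>Line \<open>1\<close> has coordinates \<open>(1, t, 0)\<close> with a free parameter. Its determinant with two other lines
  is \<open>p + t q\<close> where \<open>p\<close>, \<open>q\<close> are the first two coordinates of their cross product, so that it vanishes
  for all \<open>t\<close> or for at most one.\<close>

fun first_two_vanish :: "int list \<Rightarrow> pvec \<Rightarrow> bool" where
  "first_two_vanish s (p, q, r) \<longleftrightarrow> vanishes s p \<and> vanishes s q"

definition dependent_triples :: "int list \<Rightarrow> (nat \<times> pvec) list \<Rightarrow> (nat \<times> nat \<times> nat) list" where
  "dependent_triples s = select_triples pcross (\<lambda>u w. vanishes s (pdot u w))"

definition pencil_triples :: "int list \<Rightarrow> (nat \<times> pvec) list \<Rightarrow> (nat \<times> nat \<times> nat) list" where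
  "pencil_triples s =
     select_seconds (\<lambda>_ v. v) (\<lambda>v w. first_two_vanish s (pcross v w)) 1 ([], [], [])"

lemma mem_dependent_triples:
  "sorted_wrt (<) (map fst P) \<Longrightarrow> (i, j, k) \<in> set (dependent_triples s P) \<longleftrightarrow> i < j \<and> j < k \<and>
     (\<exists>v w x. (i, v) \<in> set P \<and> (j, w) \<in> set P \<and> (k, x) \<in> set P \<and> vanishes s (pdot (pcross v w) x))"
  unfolding dependent_triples_def by (rule mem_select_triples)

lemma mem_pencil_triples:
  "sorted_wrt (<) (map fst P) \<Longrightarrow> (i, j, k) \<in> set (pencil_triples s P) \<longleftrightarrow> i = 1 \<and> j < k \<and>
     (\<exists>v w. (j, v) \<in> set P \<and> (k, w) \<in> set P \<and> first_two_vanish s (pcross v w))"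
  unfolding pencil_triples_def by (rule mem_select_seconds)

definition line_vec :: "(nat \<times> pvec) list \<Rightarrow> nat \<Rightarrow> pvec" where
  "line_vec P i = the (map_of P i)"

lemma line_vec_mem: "i \<in> fst ` set P \<Longrightarrow> (i, line_vec P i) \<in> set P"
  unfolding line_vec_def by (metis map_of_SomeD map_of_eq_None_iff option.collapse)

lemma mem_iff_line_vec:
  assumes "distinct (map fst P)" "i \<in> fst ` set P"
  shows "(i, v) \<in> set P \<longleftrightarrow> v = line_vec P i"
  using assms line_vec_mem[OF assms(2)] by (metis eq_key_imp_eq_value)

text \<open>Among the given vectors together with the free line \<open>1\<close>, the dependent triples are exactly the
  triples through a common point, and both sides are listed in lexicographic order.\<close>

definition coordinates_ok :: "nat \<Rightarrow> nat list list \<Rightarrow> int list \<Rightarrow> (nat \<times> pvec) list \<Rightarrow> bool" where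
  "coordinates_ok n Bs s P \<longleftrightarrow> map fst P = [2..<Suc n] \<and>
     merge_all lex3 (map trips Bs) = pencil_triples s P @ dependent_triples s P"

definition dependent :: "int list \<Rightarrow> pvec \<Rightarrow> pvec \<Rightarrow> pvec \<Rightarrow> bool" where
  "dependent s u v w \<longleftrightarrow> vanishes s (pdot (pcross u v) w)"

definition constructs :: "int list \<Rightarrow> pvec \<Rightarrow> pvec \<Rightarrow> pvec \<Rightarrow> pvec \<Rightarrow> pvec \<Rightarrow> bool" where
  "constructs s i a b c d \<longleftrightarrow> dependent s a b i \<and> dependent s c d i \<and>
     \<not> dependent s a b c \<and> \<not> dependent s a c d \<and> \<not> dependent s a c i"

text \<open>Four lines have the coordinates of a projective frame. The fifth has coordinates \<open>(1, x, 0)\<close> and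
  passes, like line \<open>1\<close>, through the point of the first two.\<close>

definition frame_ok :: "nat \<Rightarrow> (nat \<times> pvec) list \<Rightarrow> nat list \<Rightarrow> bool" where
  "frame_ok n P F \<longleftrightarrow> list_all (\<lambda>i. 2 \<le> i \<and> i \<le> n) F \<and>
     map (line_vec P) F = [([1], [], []), ([], [1], []), ([], [], [1]), ([1], [1], [1]), ([1], [0, 1], [])]"

fun pvec_scale :: "int list \<Rightarrow> pvec \<Rightarrow> pvec" where
  "pvec_scale f (p, q, r) = (pmul f p, pmul f q, pmul f r)"

fun pvec_eq :: "pvec \<Rightarrow> pvec \<Rightarrow> bool" where
  "pvec_eq (p, q, r) (p', q', r') \<longleftrightarrow> is_zero (psub p p') \<and> is_zero (psub q q') \<and> is_zero (psub r r')"

lemma veval_pvec_scale: "veval (pvec_scale f q) x = peval f x *s veval q x"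
  by (cases q) (simp add: vec3_eq_iff)

lemma veval_eqI: "pvec_eq p q \<Longrightarrow> veval p x = veval q x"
  by (cases p; cases q) (auto simp: vec3_eq_iff dest!: is_zero_peval[where x = x])

text \<open>A construction with an indeterminate \<open>x\<close>: the table \<open>T\<close> holds the vectors found so far, each step
  adds the intersection of two points of known lines after removing a common factor \<open>f\<close>, and the
  final dependent triple \<open>u\<close>, \<open>v\<close>, \<open>w\<close> has determinant \<open>m (x\<^sup>d - s(x))\<close>. The incidences
  that justify a step are read off from the coordinates \<open>P\<close>, whose dependencies are the
  prescribed ones.\<close>

fun relation_ok :: "nat \<Rightarrow> (nat \<times> pvec) list \<Rightarrow> int list \<Rightarrow> nat \<times> nat \<times> nat \<times> int \<Rightarrow> (nat \<times> pvec) list \<Rightarrow>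
    ((nat \<times> nat \<times> nat \<times> nat \<times> nat) \<times> int list \<times> pvec) list \<Rightarrow> bool" where
  "relation_ok n P s (u, v, w, m) T [] \<longleftrightarrow>
     list_all (\<lambda>j. j \<in> fst ` set T) [u, v, w] \<and> dependent s (line_vec P u) (line_vec P v) (line_vec P w) \<and> m \<noteq> 0 \<and>
     is_zero (psub (pdot (pcross (line_vec T u) (line_vec T v)) (line_vec T w))
                   (pscale m (pscale (-1) s @ [1])))"
| "relation_ok n P s rel T (((i, a, b, c, d), f, q) # st) \<longleftrightarrow>
     list_all (\<lambda>j. j \<in> fst ` set T) [a, b, c, d] \<and> 2 \<le> i \<and> i \<le> n \<and>
     constructs s (line_vec P i) (line_vec P a) (line_vec P b) (line_vec P c) (line_vec P d) \<and>
     pvec_eq (pcross (pcross (line_vec T a) (line_vec T b)) (pcross (line_vec T c) (line_vec T d)))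
             (pvec_scale f q) \<and>
     relation_ok n P s rel ((i, q) # T) st"

text \<open>Every line other than \<open>1\<close> can be constructed from the lines in \<open>K\<close>.\<close>

fun determined :: "nat \<Rightarrow> (nat \<times> pvec) list \<Rightarrow> int list \<Rightarrow> nat list \<Rightarrow>
    (nat \<times> nat \<times> nat \<times> nat \<times> nat) list \<Rightarrow> bool" where
  "determined n P s K [] \<longleftrightarrow> list_all (\<lambda>i. i \<in> set K) [2..<Suc n]"
| "determined n P s K ((i, a, b, c, d) # st) \<longleftrightarrow>
     2 \<le> i \<and> i \<le> n \<and> list_all (\<lambda>j. j \<in> set K) [a, b, c, d] \<and>
     constructs s (line_vec P i) (line_vec P a) (line_vec P b) (line_vec P c) (line_vec P d) \<and>
     determined n P s (i # K) st"

definition nonreal_field :: "int list \<Rightarrow> bool" where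
  "nonreal_field s \<longleftrightarrow> s \<noteq> [] \<and> (\<forall>x :: real. x ^ length s \<noteq> peval s x) \<and>
     (\<forall>x :: complex. x ^ length s = peval s x \<longrightarrow> integral_basis s x)"

text \<open>Links coefficient lists to the library type of polynomials, which provides the fundamental theorem
  of algebra and the finiteness of the set of roots.\<close>

lemma peval_eq_poly: "peval s x = poly (Poly (map of_int s)) x"
  by (induction s) simp_all

lemma roots_of_monic:
  assumes "s \<noteq> []"
  shows "finite {x :: complex. x ^ length s = peval s x}" "\<exists>x :: complex. x ^ length s = peval s x"
proof -
  define p :: "complex poly" where "p = monom 1 (length s) - Poly (map of_int s)"
  have p: "poly p x = 0 \<longleftrightarrow> x ^ length s = peval s x" for x
    by (simp add: p_def peval_eq_poly poly_monom)
  have c: "coeff p (length s) = 1"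
    by (simp add: p_def coeff_Poly_eq nth_default_def)
  then have "p \<noteq> 0" by auto
  then show "finite {x :: complex. x ^ length s = peval s x}"
    using poly_roots_finite[OF \<open>p \<noteq> 0\<close>] by (simp only: p)
  have "0 < length s" using assms by simp
  moreover have "length s \<le> degree p" using c by (intro le_degree) simp
  ultimately have "degree p \<noteq> 0" by linarith
  then show "\<exists>x :: complex. x ^ length s = peval s x"
    using fundamental_theorem_of_algebra[of p] by (simp only: p constant_degree) simp
qed

lemma polynomial_functions_diff:
  assumes "f \<in> polynomial_functions E" "g \<in> polynomial_functions E"
  shows "(\<lambda>M. f M - g M) \<in> polynomial_functions E"
  using polynomial_functions.add[OF assms(1) polynomial_functions.mult[OF polynomial_functions.const[of "-1"] assms(2)]]
  by simp

lemma polynomial_functions_det3: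
  assumes "i \<in> E" "j \<in> E" "k \<in> E"
  shows "(\<lambda>M. det3 (M i) (M j) (M k)) \<in> polynomial_functions E"
  unfolding det3_def dot3_def cross_prod_nth
  using assms by (intro polynomial_functions.add polynomial_functions_diff polynomial_functions.mult
      polynomial_functions.coord)

locale certificate = points_of_lines +
  fixes D :: "nat list" and s :: "int list" and P :: "(nat \<times> pvec) list" and a b c d e :: nat
    and rel :: "nat \<times> nat \<times> nat \<times> int"
    and st1 :: "((nat \<times> nat \<times> nat \<times> nat \<times> nat) \<times> int list \<times> pvec) list"
    and st2 :: "(nat \<times> nat \<times> nat \<times> nat \<times> nat) list"
  assumes encodes: "encodes n D Bs"
    and field: "nonreal_field s"
    and coordinates_ok: "coordinates_ok n Bs s P"
    and frame_ok: "frame_ok n P [a, b, c, d, e]"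
    and relation_ok: "relation_ok n P s rel
      [(a, [1], [], []), (b, [], [1], []), (c, [], [], [1]), (d, [1], [1], [1]), (e, [1], [0, 1], [])] st1"
    and determined: "determined n P s [a, b, c, d, e] st2"
    and simplicial: "sum_list (map (\<lambda>B. int (length B) - 3) Bs) = - 3"
begin

lemma frame_range:
  "a \<in> {2..n}" "b \<in> {2..n}" "c \<in> {2..n}" "d \<in> {2..n}" "e \<in> {2..n}"
  and frame_vec:
  "line_vec P a = ([1], [], [])" "line_vec P b = ([], [1], [])" "line_vec P c = ([], [], [1])"
  "line_vec P d = ([1], [1], [1])" "line_vec P e = ([1], [0, 1], [])"
  using frame_ok by (simp_all add: frame_ok_def)

definition V :: "'k::field \<Rightarrow> nat \<Rightarrow> 'k ^ 3" where
  "V x i = veval (line_vec P i) x"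

lemma V_frame [simp]:
  "V x a = vector [1, 0, 0]" "V x b = vector [0, 1, 0]" "V x c = vector [0, 0, 1]"
  "V x d = vector [1, 1, 1]" "V x e = vector [1, x, 0]"
  by (simp_all add: V_def frame_vec)

lemma keys: "distinct (map fst P)" "sorted_wrt (<) (map fst P)" "i \<in> fst ` set P \<longleftrightarrow> i \<in> {2..n}"
proof -
  have "map fst P = [2..<Suc n]" using coordinates_ok by (simp only: coordinates_ok_def)
  moreover from this have "fst ` set P = {2..n}"
    by (metis atLeastLessThanSuc_atLeastAtMost set_map set_upt)
  ultimately show "distinct (map fst P)" "sorted_wrt (<) (map fst P)" "i \<in> fst ` set P \<longleftrightarrow> i \<in> {2..n}"
    by (simp_all del: upt_Suc)
qed

lemma mem_P: "i \<in> {2..n} \<Longrightarrow> (i, v) \<in> set P \<longleftrightarrow> v = line_vec P i"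
  using mem_iff_line_vec keys by blast

lemma encoded_eq:
  "encoded_triples n D = set (pencil_triples s P) \<union> set (dependent_triples s P)"
proof -
  have "encoded_triples n D = set (merge_all lex3 (map trips Bs))"
    using encoded_triples_eq[OF encodes] mset_eq_setD[OF mset_merge_all[of lex3 "map trips Bs"]] by simp
  then show ?thesis using coordinates_ok by (simp add: coordinates_ok_def)
qed

lemma vanishes_iff_concurrent:
  assumes "i \<in> {2..n}" "j \<in> {2..n}" "k \<in> {2..n}" "i < j" "j < k"
  shows "vanishes s (pdot (pcross (line_vec P i) (line_vec P j)) (line_vec P k)) \<longleftrightarrow> concurrent {i, j, k}"
proof -
  have "concurrent {i, j, k} \<longleftrightarrow> (i, j, k) \<in> encoded_triples n D"
    using encoded_triples_iff[OF encodes] assms by simp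
  also have "\<dots> \<longleftrightarrow> (i, j, k) \<in> set (dependent_triples s P)"
    using assms(1) by (simp add: encoded_eq mem_pencil_triples[OF keys(2)])
  finally show ?thesis
    using assms(4,5) unfolding mem_dependent_triples[OF keys(2)] mem_P[OF assms(1)] mem_P[OF assms(2)]
      mem_P[OF assms(3)] by metis
qed

lemma pencil_iff_concurrent:
  assumes "j \<in> {2..n}" "k \<in> {2..n}" "j < k"
  shows "first_two_vanish s (pcross (line_vec P j) (line_vec P k)) \<longleftrightarrow> concurrent {1, j, k}"
proof -
  have "concurrent {1, j, k} \<longleftrightarrow> (1, j, k) \<in> encoded_triples n D"
    using encoded_triples_iff[OF encodes] assms by simp
  also have "\<dots> \<longleftrightarrow> (1, j, k) \<in> set (pencil_triples s P)"
  proof -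
    have "(1, w) \<notin> set P" for w using keys(3)[of 1] by force
    then show ?thesis by (simp add: encoded_eq mem_dependent_triples[OF keys(2)])
  qed
  finally show ?thesis
    using assms(3) unfolding mem_pencil_triples[OF keys(2)] mem_P[OF assms(1)] mem_P[OF assms(2)]
    by metis
qed

lemma det3_V:
  assumes x: "integral_basis s (x :: 'k::field)" and ijk: "i \<in> {2..n}" "j \<in> {2..n}" "k \<in> {2..n}"
  shows "det3 (V x i) (V x j) (V x k) = 0 \<longleftrightarrow> concurrent {i, j, k}"
proof (rule det3_concurrent_of_increasing[OF linear_space_axioms _ _ ijk])
  have s: "s \<noteq> []" using field by (simp add: nonreal_field_def)
  show "det3 (V x i) (V x j) (V x k) = 0 \<longleftrightarrow> concurrent {i, j, k}"
    if "i \<in> {2..n}" "j \<in> {2..n}" "k \<in> {2..n}" "i < j" "j < k" for i j k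
    using vanishes_iff_concurrent[OF that] vanishes_iff[OF s x]
    by (simp add: peval_pdot veval_pcross V_def det3_def)
qed auto

lemma concurrent_1_iff:
  assumes x: "integral_basis s (x :: 'k::field)" and jk: "j \<in> {2..n}" "k \<in> {2..n}" "j \<noteq> k"
  shows "concurrent {1, j, k} \<longleftrightarrow>
      cross_prod (V x j) (V x k) $ 1 = 0 \<and> cross_prod (V x j) (V x k) $ 2 = 0"
proof -
  have s: "s \<noteq> []" using field by (simp add: nonreal_field_def)
  have less: "concurrent {1, j, k} \<longleftrightarrow>
      cross_prod (V x j) (V x k) $ 1 = 0 \<and> cross_prod (V x j) (V x k) $ 2 = 0"
    if "j \<in> {2..n}" "k \<in> {2..n}" "j < k" for j k
  proof -
    obtain p q r where pqr: "pcross (line_vec P j) (line_vec P k) = (p, q, r)" by (metis surj_pair)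
    then have eq: "cross_prod (V x j) (V x k) = veval (p, q, r) x"
      by (simp only: V_def flip: veval_pcross)
    show ?thesis
      unfolding eq using pencil_iff_concurrent[OF that] vanishes_iff[OF s x] by (simp add: pqr)
  qed
  have anti: "cross_prod (V x k) (V x j) = - cross_prod (V x j) (V x k)" by (simp add: vec3_eq_iff)
  show ?thesis
  proof (cases "j < k")
    case False
    then show ?thesis
      using less[OF jk(2,1)] jk(3) by (simp add: anti insert_commute del: cross_prod_nth)
  qed (use less jk in blast)
qed

lemma exists_root: "\<exists>x :: complex. x ^ length s = peval s x \<and> integral_basis s x"
  using field roots_of_monic(2)[of s] by (auto simp: nonreal_field_def)

text \<open>The incidences of the frame can be read off from the coordinates at one complex root.\<close>

lemma frame:
  "\<not> concurrent {a, b, c}" "\<not> concurrent {d, b, c}" "\<not> concurrent {a, d, c}" "\<not> concurrent {a, b, d}"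
  "concurrent {a, b, e}" "\<not> concurrent {e, b, c}" "concurrent {a, b, 1}" "\<not> concurrent {1, b, c}"
proof -
  obtain x :: complex where x: "integral_basis s x" using exists_root by blast
  note det = det3_V[OF x, symmetric]
  show "\<not> concurrent {a, b, c}" "\<not> concurrent {d, b, c}" "\<not> concurrent {a, d, c}"
      "\<not> concurrent {a, b, d}" "concurrent {a, b, e}" "\<not> concurrent {e, b, c}"
    using frame_range by (simp_all add: det) (simp_all add: det3_def dot3_def)
  have "a \<noteq> b" "b \<noteq> c" using frame_vec(1-3) by auto
  then have "concurrent {1, a, b}" "\<not> concurrent {1, b, c}"
    using concurrent_1_iff[OF x] frame_range by simp_all
  then show "concurrent {a, b, 1}" "\<not> concurrent {1, b, c}" by (simp_all add: insert_commute)
qed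

lemma dependent_iff:
  assumes "i \<in> {2..n}" "j \<in> {2..n}" "k \<in> {2..n}"
  shows "dependent s (line_vec P i) (line_vec P j) (line_vec P k) \<longleftrightarrow> concurrent {i, j, k}"
proof -
  obtain x :: complex where x: "integral_basis s x" using exists_root by blast
  have "s \<noteq> []" using field by (simp add: nonreal_field_def)
  then show ?thesis
    using det3_V[OF x assms] vanishes_iff[OF _ x]
    by (simp add: dependent_def peval_pdot veval_pcross V_def det3_def)
qed

lemma constructs_iff:
  assumes "i \<in> {2..n}" "p \<in> {2..n}" "q \<in> {2..n}" "p' \<in> {2..n}" "q' \<in> {2..n}"
  shows "constructs s (line_vec P i) (line_vec P p) (line_vec P q) (line_vec P p') (line_vec P q') \<longleftrightarrow>
    constructible i p q p' q'"
  unfolding constructs_def constructible_def using dependent_iff assms by simp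

definition pencil :: "'k::field \<Rightarrow> 'k \<Rightarrow> (nat, 'k) columns" where
  "pencil x t = (\<lambda>i\<in>{1..n}. if i = 1 then vector [1, t, 0] else V x i)"

lemma pencil_simps:
  "i \<in> {2..n} \<Longrightarrow> pencil x t i = V x i" "pencil x t 1 = vector [1, t, 0]"
  using frame_range(1) by (auto simp: pencil_def)

text \<open>Each triple consisting of line \<open>1\<close> and two lines not concurrent with it excludes the one root of a
  non-zero polynomial of degree at most one.\<close>

lemma finite_bad_parameters:
  assumes x: "integral_basis s (x :: 'k::field)"
  shows "finite {t. \<not> represents (pencil x t)}"
proof -
  let ?J = "{(j, k). j \<in> {2..n} \<and> k \<in> {2..n} \<and> j < k \<and> \<not> concurrent {1, j, k}}"
  let ?bad = "\<lambda>(j, k). {t. det3 (vector [1, t, 0]) (V x j) (V x k) = 0}"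
  have s: "s \<noteq> []" using field by (simp add: nonreal_field_def)
  have det: "det3 (vector [1, t, 0]) (V x j) (V x k) =
      cross_prod (V x j) (V x k) $ 1 + t * cross_prod (V x j) (V x k) $ 2" for t j k
    by (simp add: det3_def dot3_def algebra_simps)
  have vanish: "concurrent {1, j, k} \<longleftrightarrow>
      cross_prod (V x j) (V x k) $ 1 = 0 \<and> cross_prod (V x j) (V x k) $ 2 = 0"
    if "j \<in> {2..n}" "k \<in> {2..n}" "j < k" for j k
    using concurrent_1_iff[OF x that(1,2)] that(3) by simp
  have "finite (?bad (j, k))" if "(j, k) \<in> ?J" for j k
  proof -
    let ?p = "[:cross_prod (V x j) (V x k) $ 1, cross_prod (V x j) (V x k) $ 2:]"
    have "?p \<noteq> 0" using vanish that by auto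
    moreover have "?bad (j, k) = {t. poly ?p t = 0}" by (simp add: det del: cross_prod_nth)
    ultimately show ?thesis using poly_roots_finite by metis
  qed
  moreover have "finite ?J" by (rule finite_subset[of _ "{2..n} \<times> {2..n}"]) auto
  ultimately have "finite (\<Union>p\<in>?J. ?bad p)" by (intro finite_UN_I) auto
  moreover have "{t. \<not> represents (pencil x t)} \<subseteq> (\<Union>p\<in>?J. ?bad p)"
  proof (rule subsetI, rule ccontr)
    fix t assume t: "t \<in> {t. \<not> represents (pencil x t)}" "t \<notin> (\<Union>p\<in>?J. ?bad p)"
    have inc: "det3 (pencil x t i) (pencil x t j) (pencil x t k) = 0 \<longleftrightarrow> concurrent {i, j, k}"
      if "i \<in> {1..n}" "j \<in> {1..n}" "k \<in> {1..n}" "i < j" "j < k" for i j k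
    proof -
      have jk: "j \<in> {2..n}" "k \<in> {2..n}" using that by auto
      show ?thesis
      proof (cases "i = 1")
        case True
        have "det3 (vector [1, t, 0]) (V x j) (V x k) = 0 \<longleftrightarrow> concurrent {1, j, k}"
        proof (cases "concurrent {1, j, k}")
          case True
          then show ?thesis using vanish[OF jk that(5)] by (simp add: det del: cross_prod_nth)
        next
          case False
          then have "(j, k) \<in> ?J" using jk that(5) by simp
          then have "t \<notin> ?bad (j, k)" using t(2) by blast
          then show ?thesis using False by simp
        qed
        then show ?thesis unfolding True pencil_simps(2) pencil_simps(1)[OF jk(1)] pencil_simps(1)[OF jk(2)] .
      next
        case False
        then have "i \<in> {2..n}" using that by auto
        then show ?thesis using det3_V[OF x _ jk] jk by (simp add: pencil_simps)
      qed
    qed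
    have "represents (pencil x t)"
      unfolding represents_def
      by (intro ballI det3_concurrent_of_increasing[OF linear_space_axioms subset_refl inc])
    then show False using t(1) by simp
  qed
  ultimately show ?thesis by (rule finite_subset[rotated])
qed

subsection \<open>Normal form of a realization\<close>

lemma second_to_n: "i \<in> {2..n} \<Longrightarrow> i \<in> {1..n}"
  by auto

text \<open>The removed factors need no separate treatment: the constructed vector is non-zero, hence so are the
  factor and the remaining vector.\<close>

lemma relation_ok_imp_root:
  fixes M :: "nat \<Rightarrow> 'k::field_char_0 ^ 3"
  assumes M: "represents M" and "relation_ok n P s rel T st"
    and "\<And>i q. (i, q) \<in> set T \<Longrightarrow> i \<in> {2..n} \<and> parallel (M i) (veval q x)"
  shows "x ^ length s = peval s x"
  using assms(2,3)
proof (induction st arbitrary: T)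
  case Nil
  obtain u v w m where rel: "rel = (u, v, w, m)" by (cases rel)
  let ?q = "line_vec T"
  have uvw: "u \<in> fst ` set T" "v \<in> fst ` set T" "w \<in> fst ` set T" and dep: "dependent s (line_vec P u) (line_vec P v) (line_vec P w)"
    and "m \<noteq> 0"
    and zero: "is_zero (psub (pdot (pcross (?q u) (?q v)) (?q w)) (pscale m (pscale (-1) s @ [1])))"
    using Nil(1) by (simp_all add: rel)
  have "peval (pdot (pcross (?q u) (?q v)) (?q w)) x = peval (pscale m (pscale (-1) s @ [1])) x"
    using is_zero_peval[OF zero, of x] by (simp only: peval_psub right_minus_eq)
  also have "\<dots> = of_int m * (x ^ length s - peval s x)"
    by (simp add: peval_append) (simp add: pscale_def)
  finally have det: "det3 (veval (?q u) x) (veval (?q v) x) (veval (?q w) x)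
      = of_int m * (x ^ length s - peval s x)"
    by (simp add: peval_pdot veval_pcross det3_def)
  have par: "i \<in> {2..n} \<and> parallel (M i) (veval (?q i) x)" if "i \<in> fst ` set T" for i
    using Nil(2) line_vec_mem[OF that] by blast
  have "det3 (M u) (M v) (M w) = 0"
    using representsD[OF M second_to_n second_to_n second_to_n] dependent_iff[of u v w] par uvw dep by blast
  then have "of_int m * (x ^ length s - peval s x) = 0"
    using parallel_det3 par uvw unfolding det[symmetric] by blast
  then show ?case using \<open>m \<noteq> 0\<close> by simp
next
  case (Cons step st)
  obtain i a b c d f q where step: "step = ((i, a, b, c, d), f, q)" by (metis surj_pair)
  let ?q = "line_vec T"
  have T: "a \<in> fst ` set T" "b \<in> fst ` set T" "c \<in> fst ` set T" "d \<in> fst ` set T"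
    and i: "i \<in> {2..n}"
    and con: "constructs s (line_vec P i) (line_vec P a) (line_vec P b) (line_vec P c) (line_vec P d)"
    and eq: "pvec_eq (pcross (pcross (?q a) (?q b)) (pcross (?q c) (?q d))) (pvec_scale f q)"
    and rest: "relation_ok n P s rel ((i, q) # T) st"
    using Cons(2) by (simp_all add: step)
  have par: "j \<in> {2..n} \<and> parallel (M j) (veval (?q j) x)" if "j \<in> fst ` set T" for j
    using Cons(3) line_vec_mem[OF that] by blast
  have "parallel (M i) (cross_prod (cross_prod (M a) (M b)) (cross_prod (M c) (M d)))"
  proof (rule constructible_parallel[of "{2..n}"])
    show "constructible i a b c d" using con constructs_iff i par T by blast
    show "{i, a, b, c, d} \<subseteq> {2..n}" using i par T by blast
  qed (use representsD[OF M second_to_n second_to_n second_to_n] in blast)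
  also have "parallel (cross_prod (cross_prod (M a) (M b)) (cross_prod (M c) (M d)))
      (cross_prod (cross_prod (veval (?q a) x) (veval (?q b) x)) (cross_prod (veval (?q c) x) (veval (?q d) x)))"
    using par T by (intro parallel_cross_prod) blast+
  also have "\<dots> = peval f x *s veval q x"
    using veval_eqI[OF eq] by (simp add: veval_pcross veval_pvec_scale)
  finally obtain k where k: "k \<noteq> 0" "M i = k *s (peval f x *s veval q x)" unfolding parallel_def by blast
  have "M i \<noteq> 0" using represents_nonzero[OF M second_to_n[OF i]] .
  then have "k * peval f x \<noteq> 0" using k by auto
  then have "parallel (M i) (veval q x)" using k unfolding parallel_def by (metis vector_smult_assoc)
  then show ?case using Cons.IH[OF rest] i Cons(3) by auto
qed

text \<open>Two families with the same dependencies that agree on the lines in \<open>K\<close> agree on every line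
  constructed from them, because intersections of points are determined by the lines through them.\<close>

lemma determined_imp_parallel:
  fixes M N :: "nat \<Rightarrow> 'k::field ^ 3"
  assumes M: "\<And>i j k. \<lbrakk>i \<in> {2..n}; j \<in> {2..n}; k \<in> {2..n}\<rbrakk> \<Longrightarrow> det3 (M i) (M j) (M k) = 0 \<longleftrightarrow> concurrent {i, j, k}"
    and N: "\<And>i j k. \<lbrakk>i \<in> {2..n}; j \<in> {2..n}; k \<in> {2..n}\<rbrakk> \<Longrightarrow> det3 (N i) (N j) (N k) = 0 \<longleftrightarrow> concurrent {i, j, k}"
    and "determined n P s K st" "\<And>i. i \<in> set K \<Longrightarrow> i \<in> {2..n} \<and> parallel (M i) (N i)" "l \<in> {2..n}"
  shows "parallel (M l) (N l)"
  using assms(3,4)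
proof (induction st arbitrary: K)
  case Nil
  have "l \<in> set K" using Nil(1) assms(5) by (cases "l = n") (simp_all add: list_all_iff)
  then show ?case using Nil(2) by blast
next
  case (Cons step st)
  obtain i a b c d where step: "step = (i, a, b, c, d)" by (metis surj_pair)
  have K: "a \<in> set K" "b \<in> set K" "c \<in> set K" "d \<in> set K"
    and i: "i \<in> {2..n}" and rest: "determined n P s (i # K) st"
    and constr: "constructs s (line_vec P i) (line_vec P a) (line_vec P b) (line_vec P c) (line_vec P d)"
    using Cons(2) by (simp_all add: step)
  have S: "{i, a, b, c, d} \<subseteq> {2..n}" using Cons(3) K i by auto
  then have con: "constructible i a b c d" using constr constructs_iff by simp
  have "parallel (M i) (cross_prod (cross_prod (M a) (M b)) (cross_prod (M c) (M d)))"
    using constructible_parallel[OF M con S] by blast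
  also have "parallel (cross_prod (cross_prod (M a) (M b)) (cross_prod (M c) (M d)))
      (cross_prod (cross_prod (N a) (N b)) (cross_prod (N c) (N d)))"
    using Cons(3) K by (intro parallel_cross_prod) blast+
  also have "parallel (cross_prod (cross_prod (N a) (N b)) (cross_prod (N c) (N d))) (N i)"
    using constructible_parallel[OF N con S] parallel_sym by blast
  finally have "parallel (M i) (N i)" .
  then show ?case using Cons.IH[OF rest] Cons(3) i by auto
qed

lemma on_first_line:
  fixes N :: "nat \<Rightarrow> 'k::field ^ 3"
  assumes N: "represents N" and "parallel (N a) (vector [1, 0, 0])" "parallel (N b) (vector [0, 1, 0])"
    "parallel (N c) (vector [0, 0, 1])" and i: "i \<in> {1..n}" "concurrent {a, b, i}" "\<not> concurrent {i, b, c}"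
  shows "\<exists>x. parallel (N i) (vector [1, x, 0])"
proof -
  note abc = frame_range(1-3)[THEN second_to_n]
  have "det3 (N a) (N b) (N i) = 0" "det3 (N i) (N b) (N c) \<noteq> 0"
    using representsD[OF N] abc i by blast+
  then have "det3 (vector [1, 0, 0]) (vector [0, 1, 0]) (N i) = 0"
      "det3 (N i) (vector [0, 1, 0]) (vector [0, 0, 1]) \<noteq> 0"
    using parallel_det3 assms(2-4) parallel_refl by blast+
  then have "N i $ 3 = 0" "N i $ 1 \<noteq> 0" by (simp_all add: det3_def dot3_def)
  then have "N i = (N i $ 1) *s vector [1, N i $ 2 / N i $ 1, 0]" by (simp add: vec3_eq_iff)
  then show ?thesis using \<open>N i $ 1 \<noteq> 0\<close> unfolding parallel_def by blast
qed

text \<open>Normalizing the frame leaves two parameters, the coordinate \<open>x\<close> of line \<open>e\<close> and the coordinate \<open>t\<close>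
  of line \<open>1\<close>, of which \<open>x\<close> is a root of the relation. This holds over every field of
  characteristic zero and excludes the real numbers.\<close>

lemma normal_form:
  fixes M :: "nat \<Rightarrow> 'k::field_char_0 ^ 3"
  assumes M: "represents M"
  obtains g x t where "invertible g" "x ^ length s = peval s x"
    "\<And>i. i \<in> {a, b, c, d, e} \<Longrightarrow> parallel (g *v M i) (V x i)"
    "parallel (g *v M 1) (vector [1, t, 0])"
proof -
  note in_E = frame_range(1-5)[THEN second_to_n]
  have "det3 (M a) (M b) (M c) \<noteq> 0" "det3 (M d) (M b) (M c) \<noteq> 0" "det3 (M a) (M d) (M c) \<noteq> 0"
      "det3 (M a) (M b) (M d) \<noteq> 0"
    using representsD[OF M] in_E frame by blast+
  then obtain g where g: "invertible g" "parallel (g *v M a) (vector [1, 0, 0])"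
    "parallel (g *v M b) (vector [0, 1, 0])" "parallel (g *v M c) (vector [0, 0, 1])"
    "g *v M d = vector [1, 1, 1]" by (rule frame_normalization)
  define N where "N i = g *v M i" for i
  have "proj_equiv {1..n} M N"
    unfolding proj_equiv_def N_def using g(1) by (intro exI[of _ g] exI[of _ "\<lambda>_. 1"]) simp
  then have N: "represents N" using represents_proj_equiv M by blast
  note first = on_first_line[OF N g(2-4)[folded N_def]]
  obtain x where x: "parallel (N e) (vector [1, x, 0])" using first in_E frame by blast
  have "n \<ge> 1" using frame_range(1) by auto
  then obtain t where t: "parallel (N 1) (vector [1, t, 0])" using first[of 1] frame by auto
  have "x ^ length s = peval s x"
    by (rule relation_ok_imp_root[OF N relation_ok]) (use g(2-5) x frame_range in \<open>auto simp: N_def\<close>)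
  moreover have "parallel (N i) (V x i)" if "i \<in> {a, b, c, d, e}" for i
    using that g(2-5) x by (auto simp: N_def)
  ultimately show thesis using that g(1) t by (simp add: N_def)
qed

lemma not_realizable_real: "\<not> realizable_over TYPE(real) L"
proof
  assume "realizable_over TYPE(real) L"
  then obtain M :: "(nat, real) columns" where "represents M"
    unfolding realizable_over_def using realizations_iff by blast
  then obtain x :: real where "x ^ length s = peval s x" by (rule normal_form)
  then show False using field by (simp add: nonreal_field_def)
qed

lemma realization_proj_equiv_pencil:
  fixes M :: "(nat, complex) columns"
  assumes M: "represents M"
  obtains x t where "x ^ length s = peval s x" "proj_equiv {1..n} (pencil x t) M"
proof -
  obtain g x t where g: "invertible g" "x ^ length s = peval s x"
    "\<And>i. i \<in> {a, b, c, d, e} \<Longrightarrow> parallel (g *v M i) (V x i)"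
    "parallel (g *v M 1) (vector [1, t, 0])" using normal_form[OF M] by blast
  define N where "N i = g *v M i" for i
  have "proj_equiv {1..n} M N"
    unfolding proj_equiv_def N_def using g(1) by (intro exI[of _ g] exI[of _ "\<lambda>_. 1"]) simp
  then have "represents N" using represents_proj_equiv M by blast
  then have detN: "det3 (N i) (N j) (N k) = 0 \<longleftrightarrow> concurrent {i, j, k}"
    if "i \<in> {2..n}" "j \<in> {2..n}" "k \<in> {2..n}" for i j k
    using representsD that[THEN second_to_n] by blast
  have x: "integral_basis s x" using field g(2) by (simp add: nonreal_field_def)
  have K: "i \<in> {2..n} \<and> parallel (N i) (V x i)" if "i \<in> set [a, b, c, d, e]" for i
    using that g(3) frame_range by (auto simp: N_def)
  have "parallel (N i) (V x i)" if "i \<in> {2..n}" for i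
    using determined_imp_parallel[OF detN det3_V[OF x] determined K that] .
  moreover have "i = 1 \<or> i \<in> {2..n}" if "i \<in> {1..n}" for i using that by auto
  ultimately have "parallel (pencil x t i) (N i)" if "i \<in> {1..n}" for i
    using that g(4) parallel_sym pencil_simps by (metis N_def)
  then obtain k where "\<And>i. i \<in> {1..n} \<Longrightarrow> k i \<noteq> 0 \<and> pencil x t i = k i *s (g *v M i)"
    unfolding parallel_def N_def by metis
  then have "proj_equiv {1..n} M (pencil x t)"
    unfolding proj_equiv_def using g(1) by blast
  then show thesis using that g(2) proj_equiv_sym by blast
qed

text \<open>On a realization with frame \<open>a\<close>, \<open>b\<close>, \<open>c\<close>, \<open>d\<close> and a line \<open>i\<close> through the point of \<open>a\<close> and \<open>b\<close>,
  this vanishes if and only if the normalized coordinates of \<open>i\<close> are \<open>(1, y, 0)\<close>. Each line occurs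
  equally often in both products, which makes the zero set invariant under rescaling.\<close>

definition cross_ratio :: "nat \<Rightarrow> 'k::field \<Rightarrow> (nat, 'k) columns \<Rightarrow> 'k" where
  "cross_ratio i y M = det3 (M a) (M i) (M c) * det3 (M d) (M b) (M c)
     - y * (det3 (M i) (M b) (M c) * det3 (M a) (M d) (M c))"

lemma cross_ratio_polynomial:
  assumes "i \<in> {1..n}" shows "cross_ratio i y \<in> polynomial_functions {1..n}"
  unfolding cross_ratio_def[abs_def] using assms frame_range(1-4)[THEN second_to_n]
  by (intro polynomial_functions_diff polynomial_functions.mult polynomial_functions.const
      polynomial_functions_det3)

lemma cross_ratio_eq_0_iff:
  assumes "proj_equiv {1..n} (pencil x t) M" "i \<in> {1..n}" "pencil x t i = vector [1, z, 0]"
  shows "cross_ratio i y M = 0 \<longleftrightarrow> z = y"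
proof -
  obtain g k where g: "invertible g" "\<And>i. i \<in> {1..n} \<Longrightarrow> k i \<noteq> 0 \<and> M i = k i *s (g *v pencil x t i)"
    using assms(1) unfolding proj_equiv_def by metis
  note in_E = frame_range(1-4)[THEN second_to_n]
  have M: "M a = k a *s (g *v vector [1, 0, 0])" "M b = k b *s (g *v vector [0, 1, 0])"
    "M c = k c *s (g *v vector [0, 0, 1])" "M d = k d *s (g *v vector [1, 1, 1])"
    "M i = k i *s (g *v vector [1, z, 0])"
    using g(2) in_E assms(2,3) frame_range(1-4) by (simp_all add: pencil_simps)
  have "cross_ratio i y M = k a * k i * k c * k d * k b * k c * det g * det g * (z - y)"
    unfolding cross_ratio_def M det3_scale det3_matrix_mult
    by (simp add: det3_def dot3_def algebra_simps)
  moreover have "k a \<noteq> 0" "k b \<noteq> 0" "k c \<noteq> 0" "k d \<noteq> 0" "k i \<noteq> 0" "det g \<noteq> 0"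
    using g in_E assms(2) by (simp_all add: invertible_det_nz)
  ultimately show ?thesis by simp
qed

theorem krull_dim_moduli_space: "krull_dim (moduli_space L :: (nat, complex) columns set set topology) = 1"
proof (rule krull_dim_moduli_space_pencils[where \<Omega> = "{x. x ^ length s = peval s x}" and \<psi> = pencil])
  show "finite {x :: complex. x ^ length s = peval s x}" "{x :: complex. x ^ length s = peval s x} \<noteq> {}"
    using field roots_of_monic[of s] by (simp_all add: nonreal_field_def)
  have n1: "1 \<in> {1..n}" using frame_range(1) by auto
  show mat: "pencil x t \<in> matrices (ground L)" for x t :: complex
    unfolding ground_L by (simp add: pencil_def matrices_def)
  show "\<exists>p. \<forall>t. pencil x t i $ j = poly p t" if "i \<in> ground L" for x :: complex and i j
  proof (cases "i = 1")
    case False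
    then have "pencil x t i $ j = poly [:V x i $ j:] t" for t
      using that[unfolded ground_L] pencil_simps(1)[of i x t] by auto
    then show ?thesis by blast
  next
    case True
    have "j = 1 \<or> j = 2 \<or> j = 3" using exhaust_3 by blast
    moreover have "pencil x t i $ 1 = poly [:1:] t" "pencil x t i $ 2 = poly [:0, 1:] t"
      "pencil x t i $ 3 = poly [:0:] t" for t
      unfolding True pencil_simps by simp_all
    ultimately show ?thesis by metis
  qed
  show "finite {t. pencil x t \<notin> realizations L}" if "x \<in> {x. x ^ length s = peval s x}" for x :: complex
  proof -
    have "integral_basis s x" using that field by (simp add: nonreal_field_def)
    moreover have "{t. pencil x t \<notin> realizations L} = {t. \<not> represents (pencil x t)}"
      unfolding realizations_iff using mat[unfolded ground_L] by simp
    ultimately show ?thesis using finite_bad_parameters by simp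
  qed
  show "\<exists>x\<in>{x. x ^ length s = peval s x}. \<exists>t. proj_equiv (ground L) (pencil x t) M"
    if "M \<in> realizations L" for M :: "(nat, complex) columns"
    using realization_proj_equiv_pencil[of M] that realizations_iff[of M] unfolding ground_L by blast
  have e: "e \<in> {1..n}" "pencil x t e = vector [1, x, 0]" for x t :: complex
    using frame_range(5) pencil_simps(1)[of e x t] by auto
  show "\<exists>f\<in>polynomial_functions (ground L). \<forall>\<omega>'\<in>{x. x ^ length s = peval s x}. \<forall>t. \<forall>M\<in>realizations L.
        proj_equiv (ground L) (pencil \<omega>' t) M \<longrightarrow> (f M = 0 \<longleftrightarrow> \<omega>' = \<omega>)" for \<omega> :: complex
    unfolding ground_L
    using cross_ratio_polynomial[OF e(1), of \<omega>] cross_ratio_eq_0_iff[OF _ e] by blast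
  show "\<exists>f\<in>polynomial_functions (ground L). \<forall>\<omega>'\<in>{x. x ^ length s = peval s x}. \<forall>t'. \<forall>M\<in>realizations L.
        proj_equiv (ground L) (pencil \<omega>' t') M \<longrightarrow> (f M = 0 \<longleftrightarrow> t' = t)" for t :: complex
    unfolding ground_L
    using cross_ratio_polynomial[OF n1, of t] cross_ratio_eq_0_iff[OF _ n1 pencil_simps(2)] by blast
qed

end

section \<open>The two number fields\<close>

text \<open>A root is not real, so its imaginary part separates the two coefficients.\<close>

lemma nonreal_field_quadratic: "nonreal_field [- 2, 1]"
proof -
  have real: "x ^ 2 \<noteq> - 2 + x" for x :: real
  proof
    assume "x ^ 2 = - 2 + x"
    then have "(x - 1 / 2) ^ 2 + 7 / 4 = 0" by (simp add: power2_eq_square algebra_simps)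
    then show False using zero_le_power2[of "x - 1 / 2"] by linarith
  qed
  have "integral_basis [- 2, 1] x" if x: "x ^ 2 = - 2 + x" for x :: complex
  proof -
    have "Im x \<noteq> 0"
    proof
      assume "Im x = 0"
      then have "x = of_real (Re x)" by (simp add: complex_eq_iff)
      then have "complex_of_real (Re x ^ 2) = of_real (- 2 + Re x)" using x by (metis of_real_power of_real_add of_real_minus of_real_numeral)
      then show False using real[of "Re x"] by (simp only: of_real_eq_iff)
    qed
    have "is_zero p" if "length p = 2" "peval p x = 0" for p
    proof -
      obtain u v where p: "p = [u, v]" using \<open>length p = 2\<close> by (auto simp: numeral_2_eq_2 length_Suc_conv)
      then have *: "of_int u + x * of_int v = 0" using that(2) by simp
      then have "Im (of_int u + x * of_int v) = 0" by simp
      then have "v = 0" using \<open>Im x \<noteq> 0\<close> by simp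
      then show ?thesis using * by (simp add: p is_zero_def)
    qed
    then show ?thesis using x by (simp add: integral_basis_def numeral_2_eq_2)
  qed
  then show ?thesis using real by (simp add: nonreal_field_def numeral_2_eq_2)
qed

lemma square_eq_5_square:
  fixes m k :: int
  assumes "m ^ 2 = 5 * k ^ 2"
  shows "k = 0"
proof (rule ccontr)
  assume k: "k \<noteq> 0"
  then have m: "m \<noteq> 0" using assms by auto
  have p: "prime_elem (5 :: int)" by simp
  have "multiplicity 5 (m ^ 2) = 2 * multiplicity 5 m"
    using prime_elem_multiplicity_power_distrib[OF p m] .
  moreover have "multiplicity 5 (5 * k ^ 2) = 1 + 2 * multiplicity 5 k"
    using prime_elem_multiplicity_mult_distrib[OF p, of 5 "k ^ 2"] k
      prime_elem_multiplicity_power_distrib[OF p k, of 2] by simp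
  ultimately have "2 * multiplicity 5 m = 1 + 2 * multiplicity 5 k" using assms by simp
  then show False by presburger
qed

lemma cyclotomic_equation:
  "x ^ length [- 1, 1, - 1, 1 :: int] = peval [- 1, 1, - 1, 1] x \<longleftrightarrow>
     x ^ 4 = - 1 + x - x ^ 2 + (x :: 'k::comm_ring_1) ^ 3"
  by (simp add: algebra_simps power2_eq_square power3_eq_cube power4_eq_xxxx)

text \<open>For a root \<open>x\<close>, the number \<open>y = x + 1/x\<close> satisfies \<open>y\<^sup>2 = y + 1\<close>. If \<open>p(x) = 0\<close> then the product
  \<open>p(x) p(1/x) = A + B y\<close> is zero with integers \<open>A\<close> and \<open>B\<close>, so both vanish as \<open>5\<close> is not a square.
  But \<open>2 A + B\<close> is a positive definite quadratic form in the coefficients of \<open>p\<close>.\<close>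

lemma nonreal_field_cyclotomic: "nonreal_field [- 1, 1, - 1, 1]"
proof -
  have real: "x ^ 4 \<noteq> - 1 + x - x ^ 2 + x ^ 3" for x :: real
  proof
    assume "x ^ 4 = - 1 + x - x ^ 2 + x ^ 3"
    then have "(x ^ 2 - x / 2) ^ 2 + 3 / 4 * (x - 2 / 3) ^ 2 + 2 / 3 = 0"
      by (simp add: power2_eq_square power3_eq_cube power4_eq_xxxx algebra_simps)
    moreover have "0 \<le> (x ^ 2 - x / 2) ^ 2" "0 \<le> 3 / 4 * (x - 2 / 3) ^ 2" by simp_all
    ultimately show False by linarith
  qed
  have "integral_basis [- 1, 1, - 1, 1] x" if x: "x ^ 4 = - 1 + x - x ^ 2 + x ^ 3" for x :: complex
  proof -
    have "is_zero p" if "length p = 4" "peval p x = 0" for p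
    proof -
      obtain a b c d where p: "p = [a, b, c, d]"
        using \<open>length p = 4\<close> by (auto simp: eval_nat_numeral length_Suc_conv)
      then have zero: "of_int a + of_int b * x + of_int c * x ^ 2 + of_int d * x ^ 3 = 0"
        using that(2) by (simp add: algebra_simps power2_eq_square power3_eq_cube)
      define A where "A = a ^ 2 + b ^ 2 + c ^ 2 + d ^ 2 - a * c - b * d + a * d"
      define B where "B = a * b + b * c + c * d + a * c + b * d - a * d"
      define A' B' where "A' = (of_int A :: complex)" and "B' = (of_int B :: complex)"
      have "x \<noteq> 0" using x by auto
      have "x ^ 2 * (A' * x + B' * (x ^ 2 + 1)) =
          (of_int a + of_int b * x + of_int c * x ^ 2 + of_int d * x ^ 3) *
          (of_int d + of_int c * x + of_int b * x ^ 2 + of_int a * x ^ 3)"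
        using x unfolding A'_def B'_def A_def B_def of_int_add of_int_diff of_int_mult of_int_power
        by algebra
      then have lin: "A' * x + B' * (x ^ 2 + 1) = 0" using \<open>x \<noteq> 0\<close> zero by simp
      have "x ^ 2 * (A' ^ 2 + A' * B' - B' ^ 2) = 0" using lin x by algebra
      then have "A' ^ 2 + A' * B' - B' ^ 2 = 0" using \<open>x \<noteq> 0\<close> by simp
      then have "of_int (A ^ 2 + A * B - B ^ 2) = (0 :: complex)"
        by (simp add: A'_def B'_def)
      then have AB: "A ^ 2 + A * B - B ^ 2 = 0" by (simp only: of_int_eq_0_iff)
      then have "(2 * A + B) ^ 2 = 5 * B ^ 2" by (simp add: power2_eq_square algebra_simps)
      then have "B = 0" by (rule square_eq_5_square)
      then have "A = 0" using AB by simp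
      have "a ^ 2 + b ^ 2 + c ^ 2 + d ^ 2 + (a + b) ^ 2 + (a - c) ^ 2 + (a + d) ^ 2
          + (b + c) ^ 2 + (b - d) ^ 2 + (c + d) ^ 2 = 2 * (2 * A + B)"
        by (simp add: A_def B_def power2_eq_square algebra_simps)
      then have sum: "a ^ 2 + b ^ 2 + c ^ 2 + d ^ 2 + (a + b) ^ 2 + (a - c) ^ 2 + (a + d) ^ 2
          + (b + c) ^ 2 + (b - d) ^ 2 + (c + d) ^ 2 = 0"
        using \<open>A = 0\<close> \<open>B = 0\<close> by simp
      have "0 \<le> a ^ 2" "0 \<le> b ^ 2" "0 \<le> c ^ 2" "0 \<le> d ^ 2" "0 \<le> (a + b) ^ 2" "0 \<le> (a - c) ^ 2"
          "0 \<le> (a + d) ^ 2" "0 \<le> (b + c) ^ 2" "0 \<le> (b - d) ^ 2" "0 \<le> (c + d) ^ 2" by simp_all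
      then have "a ^ 2 = 0" "b ^ 2 = 0" "c ^ 2 = 0" "d ^ 2 = 0" using sum by linarith+
      then show ?thesis by (simp add: p is_zero_def)
    qed
    moreover have "x ^ length [- 1, 1, - 1, 1 :: int] = peval [- 1, 1, - 1, 1] x"
      using x by (simp only: cyclotomic_equation)
    ultimately show ?thesis by (simp add: integral_basis_def)
  qed
  then show ?thesis unfolding nonreal_field_def cyclotomic_equation using real by blast
qed

section \<open>An isomorphism invariant\<close>

text \<open>Colour refinement on the incidence graph: a point collects the weights of its lines,
  and a line collects the squares of the weights of its points. Squares are written as products
  because these are cheaper to evaluate by rewriting.\<close>

fun line_weight :: "'e matroid \<Rightarrow> nat \<Rightarrow> 'e \<Rightarrow> nat" where
  "line_weight M 0 i = 1"
| "line_weight M (Suc k) i =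
     (\<Sum>v\<in>{v \<in> points M. i \<in> v}. (\<Sum>j\<in>v. line_weight M k j) * (\<Sum>j\<in>v. line_weight M k j))"

definition weight :: "'e matroid \<Rightarrow> nat" where
  "weight M = (\<Sum>i\<in>ground M. line_weight M 2 i * line_weight M 2 i)"

lemma matroid_isomorphic_weight:
  assumes iso: "matroid_isomorphic M M'" and "is_matroid M" "is_matroid M'"
  shows "weight M = weight M'"
proof -
  obtain f where bij: "bij_betw f (ground M) (ground M')"
    and ind: "\<And>X. X \<subseteq> ground M \<Longrightarrow> X \<in> indep M \<longleftrightarrow> f ` X \<in> indep M'"
    using iso unfolding matroid_isomorphic_def by blast
  have sub: "\<And>X. X \<in> indep M \<Longrightarrow> X \<subseteq> ground M" "\<And>X. X \<in> indep M' \<Longrightarrow> X \<subseteq> ground M'"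
    using assms(2,3) by (auto simp: is_matroid_def)
  have inj: "inj_on f (ground M)" and img: "f ` ground M = ground M'"
    using bij by (auto simp: bij_betw_def)
  have pre: "\<exists>X\<subseteq>ground M. Y = f ` X" if "Y \<subseteq> ground M'" for Y
    using that img by (metis subset_imageE)
  have f_sub: "f ` X \<subseteq> f ` S \<longleftrightarrow> X \<subseteq> S" if "X \<subseteq> ground M" "S \<subseteq> ground M" for X S
    using inj_on_image_subset_iff[OF inj that] .
  have f_in: "f i \<in> f ` S \<longleftrightarrow> i \<in> S" if "i \<in> ground M" "S \<subseteq> ground M" for i S
    using inj_on_image_mem_iff[OF inj that] .
  have rk: "rk M' (f ` S) = rk M S" if S: "S \<subseteq> ground M" for S
  proof -
    have "{Y \<in> indep M'. Y \<subseteq> f ` S} = (`) f ` {X \<in> indep M. X \<subseteq> S}"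
    proof (intro equalityI subsetI)
      fix Y assume "Y \<in> {Y \<in> indep M'. Y \<subseteq> f ` S}"
      moreover from this obtain X where "X \<subseteq> S" "Y = f ` X" by (auto elim: subset_imageE)
      ultimately show "Y \<in> (`) f ` {X \<in> indep M. X \<subseteq> S}" using ind[of X] S by auto
    qed (use ind sub in auto)
    moreover have "card (f ` X) = card X" if "X \<in> indep M" for X
      using card_image inj_on_subset[OF inj sub(1)[OF that]] by blast
    ultimately have "card ` {Y \<in> indep M'. Y \<subseteq> f ` S} = card ` {X \<in> indep M. X \<subseteq> S}"
      by (simp add: image_image)
    then show ?thesis by (simp add: rk_def)
  qed
  have flats: "f ` F \<in> flats M' \<longleftrightarrow> F \<in> flats M" if F: "F \<subseteq> ground M" for F
  proof -
    have "(\<forall>y\<in>ground M' - f ` F. rk M' (f ` F) < rk M' (insert y (f ` F)))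
        \<longleftrightarrow> (\<forall>x\<in>ground M - F. rk M' (f ` F) < rk M' (insert (f x) (f ` F)))"
      using f_in[OF _ F] by (auto simp: img[symmetric])
    also have "\<dots> \<longleftrightarrow> (\<forall>x\<in>ground M - F. rk M F < rk M (insert x F))"
    proof (intro ball_cong refl)
      fix x assume "x \<in> ground M - F"
      then show "rk M' (f ` F) < rk M' (insert (f x) (f ` F)) \<longleftrightarrow> rk M F < rk M (insert x F)"
        using rk[OF F] rk[of "insert x F"] F by simp
    qed
    moreover have "f ` F \<subseteq> ground M'" using F img by blast
    ultimately show ?thesis using F by (simp add: flats_def)
  qed
  have points_sub: "\<And>v. v \<in> points M \<Longrightarrow> v \<subseteq> ground M" by (auto simp: points_def flats_def)
  have points: "points M' = (`) f ` points M"
  proof (intro equalityI subsetI)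
    fix w assume w: "w \<in> points M'"
    then have "w \<subseteq> ground M'" by (auto simp: points_def flats_def)
    then obtain v where "v \<subseteq> ground M" "w = f ` v" using pre by blast
    then show "w \<in> (`) f ` points M" using w flats rk by (auto simp: points_def)
  next
    fix w assume "w \<in> (`) f ` points M"
    then show "w \<in> points M'" using flats rk points_sub by (fastforce simp: points_def)
  qed
  have through: "{w \<in> points M'. f i \<in> w} = (`) f ` {v \<in> points M. i \<in> v}" if "i \<in> ground M" for i
  proof -
    have "f i \<in> f ` v \<longleftrightarrow> i \<in> v" if "v \<in> points M" for v
      using f_in[OF \<open>i \<in> ground M\<close> points_sub[OF that]] .
    then show ?thesis unfolding points by blast
  qed
  have inj_img: "inj_on ((`) f) {v \<in> points M. i \<in> v}" for i
    using points_sub by (intro inj_onI) (metis (no_types, lifting) inj inj_on_image_eq_iff mem_Collect_eq)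
  have lw: "line_weight M' k (f i) = line_weight M k i" if "i \<in> ground M" for k i
    using that
  proof (induction k arbitrary: i)
    case (Suc k)
    have "(\<Sum>j\<in>f ` v. line_weight M' k j) = (\<Sum>j\<in>v. line_weight M k j)" if "v \<in> points M" for v
      using Suc.IH points_sub[OF that] inj_on_subset[OF inj points_sub[OF that]]
      by (auto simp: sum.reindex intro!: sum.cong)
    then show ?case
      by (simp add: through[OF Suc.prems] sum.reindex[OF inj_img])
  qed simp
  show ?thesis
    unfolding weight_def img[symmetric] sum.reindex[OF inj] using lw by simp
qed

definition next_weights :: "nat \<Rightarrow> nat list list \<Rightarrow> nat list \<Rightarrow> nat list" where
  "next_weights n Bs ws =
     (let bs = map (\<lambda>B. let w = sum_list (map (\<lambda>j. ws ! (j - 1)) B) in (B, w * w)) Bs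
      in map (\<lambda>i. sum_list (map snd (filter (\<lambda>p. i \<in> set (fst p)) bs))) [1..<Suc n])"

definition list_weight :: "nat \<Rightarrow> nat list list \<Rightarrow> nat" where
  "list_weight n Bs =
     sum_list (map (\<lambda>w. w * w) (next_weights n Bs (next_weights n Bs (replicate n 1))))"

context points_of_lines
begin

lemma next_weights:
  "next_weights n Bs (map (line_weight L k) [1..<Suc n]) = map (line_weight L (Suc k)) [1..<Suc n]"
proof -
  let ?w = "\<lambda>B. \<Sum>j\<in>set B. line_weight L k j"
  have block: "sum_list (map (\<lambda>j. map (line_weight L k) [1..<Suc n] ! (j - 1)) B) = ?w B"
    if "B \<in> set Bs" for B
  proof -
    have "map (line_weight L k) [1..<Suc n] ! (j - 1) = line_weight L k j" if "j \<in> set B" for j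
    proof -
      have "1 \<le> j" "j \<le> n" using block_props(2)[OF \<open>B \<in> set Bs\<close>] that by auto
      then show ?thesis by (subst nth_map) (simp_all add: nth_upt del: upt_Suc)
    qed
    then have "map (\<lambda>j. map (line_weight L k) [1..<Suc n] ! (j - 1)) B = map (line_weight L k) B"
      by simp
    then show ?thesis using block_props(5)[OF that] by (simp only: sum_list_distinct_conv_sum_set)
  qed
  have "map (\<lambda>B. let w = sum_list (map (\<lambda>j. map (line_weight L k) [1..<Suc n] ! (j - 1)) B) in (B, w * w)) Bs
      = map (\<lambda>B. (B, ?w B * ?w B)) Bs"
    by (rule map_cong[OF refl]) (simp only: block Let_def)
  then have "next_weights n Bs (map (line_weight L k) [1..<Suc n]) =
      map (\<lambda>i. sum_list (map (\<lambda>B. ?w B * ?w B) (filter (\<lambda>B. i \<in> set B) Bs))) [1..<Suc n]"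
    unfolding next_weights_def by (simp only: Let_def filter_map map_map o_def fst_conv snd_conv)
  also have "\<dots> = map (line_weight L (Suc k)) [1..<Suc n]"
  proof (rule map_cong[OF refl])
    fix i
    have "inj_on set {B \<in> set Bs. i \<in> set B}" using inj_on_set_Bs by (rule inj_on_subset) auto
    moreover have "{v \<in> points L. i \<in> v} = set ` {B \<in> set Bs. i \<in> set B}"
      unfolding points_L by auto
    ultimately have "line_weight L (Suc k) i = (\<Sum>B\<in>{B \<in> set Bs. i \<in> set B}. ?w B * ?w B)"
      by (simp add: sum.reindex)
    also have "\<dots> = sum_list (map (\<lambda>B. ?w B * ?w B) (filter (\<lambda>B. i \<in> set B) Bs))"
      using distinct_Bs by (simp add: sum_list_distinct_conv_sum_set)
    finally show "sum_list (map (\<lambda>B. ?w B * ?w B) (filter (\<lambda>B. i \<in> set B) Bs)) = line_weight L (Suc k) i" ..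
  qed
  finally show ?thesis .
qed

lemma weight_L: "weight L = list_weight n Bs"
proof -
  have "replicate n 1 = map (line_weight L 0) [1..<Suc n]"
  proof -
    have "line_weight L 0 = (\<lambda>_. 1)" by (rule ext) simp
    then show ?thesis by (simp only: map_replicate_const length_upt) simp
  qed
  then have "list_weight n Bs = sum_list (map (\<lambda>w. w * w) (map (line_weight L 2) [1..<Suc n]))"
    unfolding list_weight_def by (simp only: next_weights numeral_2_eq_2)
  also have "\<dots> = (\<Sum>i\<in>set [1..<Suc n]. line_weight L 2 i * line_weight L 2 i)"
    by (simp only: map_map o_def sum_list_distinct_conv_sum_set[OF distinct_upt])
  also have "\<dots> = weight L"
    unfolding weight_def ground_L by (simp only: set_upt atLeastLessThanSuc_atLeastAtMost)
  finally show ?thesis ..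
qed

end

context certificate
begin

theorem certified:
  "rank_three_matroid (encoded_matroid n D)"
  "combinatorially_simplicial (encoded_matroid n D)"
  "krull_dim (moduli_space (encoded_matroid n D) :: (nat, complex) columns set set topology) = 1"
  "\<not> realizable_over TYPE(real) (encoded_matroid n D)"
  "weight (encoded_matroid n D) = list_weight n Bs"
  unfolding encoded_matroid_eq[OF encodes] combinatorially_simplicial_def sigma_L simplicial
  using rank_three_L krull_dim_moduli_space not_realizable_real weight_L by simp_all

end

section \<open>The eleven certificates\<close>

text \<open>
  For each matroid the lists contain its points and the coordinates of the lines of its rigid part.
  The last two arguments of a certificate are the construction that yields the relation for \<open>x\<close>,
  with the removed factors, and the construction of all lines. Frames are chosen on the point of
  line \<open>1\<close> in such a way that only two polynomials occur as relations.
\<close>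

definition points1 :: "nat list list" where
  "points1 =
    [[1, 2], [1, 3], [1, 4], [1, 5], [1, 6], [1, 7], [1, 8], [1, 9], [1, 10], [1, 11],
     [1, 12, 13, 14, 15, 16], [2, 3, 6, 7, 8], [2, 4, 13], [2, 5, 12], [2, 9, 14], [2, 10, 15],
     [2, 11, 16], [3, 4, 14], [3, 5, 16], [3, 9, 12], [3, 10, 13], [3, 11, 15],
     [4, 5, 9, 10, 11], [4, 6, 12], [4, 7, 16], [4, 8, 15], [5, 6, 15], [5, 7, 13], [5, 8, 14],
     [6, 9, 16], [6, 10, 14], [6, 11, 13], [7, 9, 15], [7, 10, 12], [7, 11, 14], [8, 9, 13],
     [8, 10, 16], [8, 11, 12]]"

definition lines1 :: "(nat \<times> pvec) list" where
  "lines1 =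
    [(2, ([1], [], [0, 0, -1])), (3, ([1], [1, 0, 1], [1])), (4, ([1], [1], [0, 0, -1])),
     (5, ([], [], [1])), (6, ([1, 0, 0, -1], [1], [0, 0, -1])), (7, ([], [1], [1])),
     (8, ([1], [0, 1], [0, 1, -1])), (9, ([1], [1], [0, 1, -1])), (10, ([1], [1], [1])),
     (11, ([1], [1], [1, -1])), (12, ([1], [], [])), (13, ([], [1], [])),
     (14, ([1], [0, 1], [])), (15, ([1, 0, 0, -1], [1], [])), (16, ([1], [1, 0, 1], []))]"

lemma certificate1:
  "certificate 16 points1 D1 [-1, 1, -1, 1] lines1 12 13 5 10 14 (4, 6, 12, 1)
      [((7, 5, 13, 10, 12), [1], ([], [-1], [-1])),
       ((11, 5, 10, 7, 14), [1], ([1], [1], [1, -1])),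
       ((6, 10, 14, 11, 13), [1], ([1], [1, -1, 1], [1, -1])),
       ((2, 6, 7, 5, 12), [1], ([1], [], [0, 0, -1])),
       ((4, 5, 10, 2, 13), [1], ([1], [1], [0, 0, -1]))]
      [(7, 5, 13, 10, 12), (11, 5, 10, 7, 14), (6, 10, 14, 11, 13), (2, 6, 7, 5, 12),
       (3, 2, 6, 10, 13), (4, 5, 10, 2, 13), (8, 2, 3, 5, 14), (9, 4, 5, 2, 14),
       (15, 12, 13, 2, 10), (16, 12, 13, 2, 11)]"
  by (intro certificate.intro points_of_lines.intro certificate_axioms.intro nonreal_field_cyclotomic)
     code_simp+

lemma list_weight1: "list_weight 16 points1 = 3203810104351"
  by code_simp

definition points2 :: "nat list list" where
  "points2 =
    [[1, 2], [1, 3], [1, 4], [1, 5], [1, 6], [1, 7], [1, 8], [1, 9], [1, 10], [1, 11], [1, 12],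
     [1, 13], [1, 14], [1, 15], [1, 16], [1, 17], [1, 18], [1, 19, 20, 21], [2, 3, 7, 12],
     [2, 4, 9, 19], [2, 5, 11, 15], [2, 6, 16, 18], [2, 8, 17], [2, 10], [2, 13, 20],
     [2, 14, 21], [3, 4], [3, 5, 21], [3, 6, 15], [3, 8, 13, 16], [3, 9, 14, 17],
     [3, 10, 11, 20], [3, 18, 19], [4, 5, 16], [4, 6, 17], [4, 7, 8, 21], [4, 10, 13, 18],
     [4, 11, 12], [4, 14, 15, 20], [5, 6, 8, 14], [5, 7, 13], [5, 9, 12], [5, 10, 17, 19],
     [5, 18, 20], [6, 7, 19], [6, 9, 20], [6, 10, 12, 21], [6, 11, 13], [7, 9, 10],
     [7, 11, 14], [7, 15, 18], [7, 16, 17, 20], [8, 9, 18], [8, 10, 15], [8, 11, 19],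
     [8, 12, 20], [9, 11, 16], [9, 13, 15, 21], [10, 14, 16], [11, 17, 18, 21], [12, 13, 17],
     [12, 14, 18], [12, 15, 16, 19], [13, 14, 19], [15, 17], [16, 21]]"

definition lines2 :: "(nat \<times> pvec) list" where
  "lines2 =
    [(2, ([1], [1], [-1, -1])), (3, ([], [], [1])), (4, ([1], [1, 1], [1, -1])),
     (5, ([1], [], [0, -1])), (6, ([1], [-1], [-1])), (7, ([2], [2], [0, -1])),
     (8, ([1], [-1, 1], [1])), (9, ([2], [0, 1], [-2])), (10, ([], [1], [1])),
     (11, ([], [1], [-1])), (12, ([1], [1], [1])), (13, ([1], [-1, 1], [-1, -1])),
     (14, ([1, -1], [1], [-1, -1])), (15, ([1], [-1], [1, -1])),
     (16, ([-1, 1], [-1, -1], [1])), (17, ([2], [0, 1], [0, -1])),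
     (18, ([1], [0, 1], [0, -1])), (19, ([1], [0, 1], [])), (20, ([], [1], [])),
     (21, ([1], [], []))]"

lemma certificate2:
  "certificate 21 points2 D2 [-2, 1] lines2 21 20 3 12 19 (4, 11, 12, -2)
      [((10, 3, 20, 12, 21), [1], ([], [-1], [-1])),
       ((5, 10, 19, 3, 21), [1], ([-1], [], [0, 1])),
       ((18, 3, 19, 5, 20), [1], ([-1], [0, -1], [0, 1])),
       ((11, 3, 10, 18, 21), [0, 1], ([], [-1], [1])),
       ((2, 3, 12, 5, 11), [1], ([1], [1], [-1, -1])),
       ((4, 2, 19, 10, 18), [1], ([2], [0, 3, -1], [0, -1, -1]))]
      [(10, 3, 20, 12, 21), (5, 10, 19, 3, 21), (18, 3, 19, 5, 20), (11, 3, 10, 18, 21),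
       (2, 3, 12, 5, 11), (4, 2, 19, 10, 18), (6, 2, 18, 10, 12), (7, 2, 3, 4, 21),
       (8, 4, 7, 5, 6), (9, 2, 4, 5, 12), (13, 3, 8, 4, 10), (14, 3, 9, 4, 20),
       (15, 2, 5, 4, 14), (16, 2, 6, 3, 8), (17, 3, 9, 5, 10)]"
  by (intro certificate.intro points_of_lines.intro certificate_axioms.intro nonreal_field_quadratic)
     code_simp+

lemma list_weight2: "list_weight 21 points2 = 18276892515821"
  by code_simp

definition points3 :: "nat list list" where
  "points3 =
    [[1, 2], [1, 3], [1, 4], [1, 5], [1, 6], [1, 7], [1, 8], [1, 9], [1, 10], [1, 11], [1, 12],
     [1, 13], [1, 14], [1, 15], [1, 16], [1, 17], [1, 18], [1, 19, 20, 21], [2, 3, 14],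
     [2, 4, 5, 21], [2, 6, 11], [2, 7, 10, 20], [2, 8, 9, 17], [2, 12, 15], [2, 13, 18],
     [2, 16, 19], [3, 4, 11, 17], [3, 5, 13, 20], [3, 6, 21], [3, 7, 8], [3, 9, 18],
     [3, 10, 15, 19], [3, 12, 16], [4, 6, 12, 19], [4, 7, 14, 18], [4, 8, 10], [4, 9, 16],
     [4, 13], [4, 15, 20], [5, 6, 14, 17], [5, 7, 12], [5, 8, 16], [5, 9, 10], [5, 11, 15],
     [5, 18, 19], [6, 7, 9, 15], [6, 8], [6, 10, 13], [6, 16, 18, 20], [7, 11, 13, 16],
     [7, 17, 19], [7, 21], [8, 11, 12, 20], [8, 13, 14, 19], [8, 15, 18, 21], [9, 11, 19],
     [9, 12, 13, 21], [9, 14, 20], [10, 11, 18], [10, 12, 14], [10, 16, 17, 21], [11, 14, 21],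
     [12, 17, 18], [13, 15, 17], [14, 15, 16], [17, 20]]"

definition lines3 :: "(nat \<times> pvec) list" where
  "lines3 =
    [(2, ([0, 1], [], [1])), (3, ([1], [-2, 1], [-1])), (4, ([0, 1], [0, -1], [1])),
     (5, ([0, 1], [0, 1], [1])), (6, ([1], [0, 1], [-1])), (7, ([1], [0, -1], [1, -1])),
     (8, ([1], [1], [1])), (9, ([1], [-1], [0, -1])), (10, ([], [2, -1], [1])),
     (11, ([1], [0, -1], [2, -1])), (12, ([1], [-2, 1], [0, -1])),
     (13, ([1], [0, -1], [0, -1])), (14, ([1], [2, -1], [2, -1])), (15, ([1], [2, -1], [1])),
     (16, ([], [], [1])), (17, ([], [0, -1], [1, -1])), (18, ([1], [0, 1], [1])),
     (19, ([1], [], [])), (20, ([1], [0, 1], [])), (21, ([], [1], []))]"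

lemma certificate3:
  "certificate 21 points3 D3 [-2, 1] lines3 19 21 16 8 20 (3, 6, 21, 1)
      [((18, 16, 20, 8, 21), [1], ([1], [0, 1], [1])),
       ((5, 8, 16, 18, 19), [1], ([0, 1], [0, 1], [1])),
       ((2, 5, 21, 16, 19), [1], ([0, -1], [], [-1])),
       ((10, 2, 20, 16, 21), [1], ([], [0, 0, 1], [-1])),
       ((3, 5, 20, 10, 19), [0, 1], ([-1], [0, 0, -1], [1])),
       ((4, 2, 5, 8, 10), [0, 1], ([0, 1], [0, 1, -1, 1], [1])),
       ((6, 4, 19, 16, 18), [0, 1], ([1, -1, 1], [0, 1, -1, 1], [1]))]
      [(18, 16, 20, 8, 21), (5, 8, 16, 18, 19), (2, 5, 21, 16, 19), (10, 2, 20, 16, 21),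
       (3, 5, 20, 10, 19), (4, 2, 5, 8, 10), (6, 4, 19, 16, 18), (7, 2, 10, 4, 18),
       (9, 2, 8, 6, 7), (11, 3, 4, 7, 16), (12, 4, 6, 8, 11), (13, 3, 5, 7, 11),
       (14, 4, 7, 5, 6), (15, 3, 10, 6, 7), (17, 2, 8, 3, 4)]"
  by (intro certificate.intro points_of_lines.intro certificate_axioms.intro nonreal_field_quadratic)
     code_simp+

lemma list_weight3: "list_weight 21 points3 = 18283143729909"
  by code_simp

definition points4 :: "nat list list" where
  "points4 =
    [[1, 2], [1, 3], [1, 4], [1, 5], [1, 6], [1, 7], [1, 8], [1, 9], [1, 10], [1, 11], [1, 12],
     [1, 13], [1, 14], [1, 15], [1, 16], [1, 17], [1, 18], [1, 19, 20, 21], [2, 3, 8, 9],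
     [2, 4, 7], [2, 5, 19], [2, 6, 13, 15], [2, 10, 16, 21], [2, 11, 18], [2, 12, 14],
     [2, 17, 20], [3, 4, 17], [3, 5, 14, 15], [3, 6], [3, 7, 18, 19], [3, 10, 13], [3, 11, 21],
     [3, 12, 16, 20], [4, 5, 9, 11], [4, 6, 14, 20], [4, 8, 16], [4, 10, 12, 18], [4, 13, 19],
     [4, 15, 21], [5, 6, 7], [5, 8, 12], [5, 10, 20], [5, 13, 18, 21], [5, 16, 17],
     [6, 8, 17, 18], [6, 9, 10], [6, 11, 16, 19], [6, 12, 21], [7, 8, 21], [7, 9, 20],
     [7, 10, 11, 14], [7, 12, 13, 17], [7, 15, 16], [8, 10, 15], [8, 11, 13, 20], [8, 14, 19],
     [9, 12, 15, 19], [9, 13], [9, 14, 17, 21], [9, 16, 18], [10, 17, 19], [11, 12],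
     [11, 15, 17], [13, 14, 16], [14, 18], [15, 18, 20]]"

definition lines4 :: "(nat \<times> pvec) list" where
  "lines4 =
    [(2, ([], [], [1])), (3, ([1], [-1, 1], [1, -1])), (4, ([2], [0, 1], [0, 1])),
     (5, ([1], [], [1])), (6, ([1], [1], [-1, 1])), (7, ([2], [0, 1], [0, -1])),
     (8, ([-1, 1], [-1, -1], [1])), (9, ([1], [-1, 1], [-1])), (10, ([], [0, -1], [1])),
     (11, ([1], [-1], [1, -1])), (12, ([1], [1, 1], [-1, 1])), (13, ([1], [1], [1])),
     (14, ([1], [1, 1], [-1])), (15, ([2], [2], [0, 1])), (16, ([], [1], [-1, 1])),
     (17, ([1], [0, 1], [-1])), (18, ([1], [-1], [1])), (19, ([1], [], [])),
     (20, ([1], [0, 1], [])), (21, ([], [1], []))]"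

lemma certificate4:
  "certificate 21 points4 D4 [-2, 1] lines4 19 21 2 13 20 (6, 16, 19, -1)
      [((5, 13, 21, 2, 19), [1], ([-1], [], [-1])),
       ((10, 2, 21, 5, 20), [1], ([], [0, -1], [1])),
       ((17, 2, 20, 10, 19), [0, 1], ([1], [0, 1], [-1])),
       ((16, 2, 10, 5, 17), [0, 1], ([], [0, 1], [-2])),
       ((3, 16, 20, 10, 13), [1], ([0, -1], [0, 1, -1], [-2])),
       ((4, 3, 17, 13, 19), [1, 1], ([2], [0, 1], [0, 1])),
       ((6, 2, 13, 4, 20), [0, 1], ([1], [1], [-1, 1]))]
      [(5, 13, 21, 2, 19), (10, 2, 21, 5, 20), (17, 2, 20, 10, 19), (16, 2, 10, 5, 17),
       (3, 16, 20, 10, 13), (4, 3, 17, 13, 19), (6, 2, 13, 4, 20), (7, 3, 19, 13, 17),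
       (8, 2, 3, 6, 17), (9, 2, 3, 4, 5), (11, 4, 5, 6, 16), (12, 3, 16, 4, 10),
       (14, 3, 5, 4, 6), (15, 2, 6, 3, 5), (18, 3, 7, 4, 10)]"
  by (intro certificate.intro points_of_lines.intro certificate_axioms.intro nonreal_field_quadratic)
     code_simp+

lemma list_weight4: "list_weight 21 points4 = 18270351019757"
  by code_simp

definition points5 :: "nat list list" where
  "points5 =
    [[1, 2], [1, 3], [1, 4], [1, 5], [1, 6], [1, 7], [1, 8], [1, 9], [1, 10], [1, 11], [1, 12],
     [1, 13], [1, 14], [1, 15], [1, 16], [1, 17], [1, 18], [1, 19, 20, 21], [2, 3],
     [2, 4, 17, 19], [2, 5, 14], [2, 6, 16, 18], [2, 7, 12, 20], [2, 8, 21], [2, 9, 10],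
     [2, 11, 13, 15], [3, 4, 14, 20], [3, 5, 13, 16], [3, 6, 8, 17], [3, 7, 10, 11],
     [3, 9, 12], [3, 15, 19], [3, 18, 21], [4, 5, 9, 18], [4, 6, 12], [4, 7, 8],
     [4, 10, 15, 21], [4, 11, 16], [4, 13], [5, 6, 20], [5, 7, 19], [5, 8, 12, 15],
     [5, 10, 17], [5, 11, 21], [6, 7, 9, 21], [6, 10, 13], [6, 11, 19], [6, 14, 15],
     [7, 13, 18], [7, 14, 16], [7, 15, 17], [8, 9, 13, 19], [8, 10, 16, 20], [8, 11, 14],
     [8, 18], [9, 11, 20], [9, 14, 17], [9, 15, 16], [10, 12], [10, 14, 18, 19],
     [11, 12, 17, 18], [12, 13, 14, 21], [12, 16, 19], [13, 17, 20], [15, 18, 20],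
     [16, 17, 21]]"

definition lines5 :: "(nat \<times> pvec) list" where
  "lines5 =
    [(2, ([1], [2, 1], [0, -1])), (3, ([], [], [1])), (4, ([1], [0, 1], [0, -1])),
     (5, ([1], [1], [-2, 1])), (6, ([1], [-2, 1], [2, 1])), (7, ([1], [0, -1], [-2, 1])),
     (8, ([1], [-2, 1], [1])), (9, ([0, -1], [1], [0, -1])), (10, ([1], [0, -1], [0, 1])),
     (11, ([1], [0, -1], [2, 1])), (12, ([0, -1], [1], [1])), (13, ([1], [1], [1])),
     (14, ([1], [0, 1], [0, 1])), (15, ([], [1], [-1])), (16, ([0, -1], [0, -1], [1])),
     (17, ([1], [-2, 1], [0, -1])), (18, ([1], [], [0, 1])), (19, ([], [1], [])),
     (20, ([1], [0, 1], [])), (21, ([1], [], []))]"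

lemma certificate5:
  "certificate 21 points5 D5 [-2, 1] lines5 21 19 3 13 20 (2, 5, 14, 2)
      [((14, 3, 20, 13, 21), [1], ([-1], [0, -1], [0, -1])),
       ((18, 14, 19, 3, 21), [1], ([1], [], [0, 1])),
       ((15, 3, 19, 18, 20), [0, 1], ([], [1], [-1])),
       ((4, 3, 14, 15, 21), [1], ([1], [0, 1], [0, -1])),
       ((2, 4, 19, 13, 15), [1], ([-1], [-2, -1], [0, 1])),
       ((5, 3, 13, 4, 18), [0, 1], ([-1], [-1], [2, -1]))]
      [(14, 3, 20, 13, 21), (18, 14, 19, 3, 21), (15, 3, 19, 18, 20), (4, 3, 14, 15, 21),
       (2, 4, 19, 13, 15), (5, 3, 13, 4, 18), (6, 2, 18, 5, 20), (7, 2, 20, 6, 21),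
       (8, 3, 6, 5, 15), (9, 4, 5, 6, 7), (10, 3, 7, 4, 15), (11, 2, 13, 3, 7),
       (12, 2, 7, 5, 8), (16, 2, 6, 3, 5), (17, 2, 4, 3, 6)]"
  by (intro certificate.intro points_of_lines.intro certificate_axioms.intro nonreal_field_quadratic)
     code_simp+

lemma list_weight5: "list_weight 21 points5 = 18270353871821"
  by code_simp

definition points6 :: "nat list list" where
  "points6 =
    [[1, 2], [1, 3], [1, 4], [1, 5], [1, 6], [1, 7], [1, 8], [1, 9], [1, 10], [1, 11], [1, 12],
     [1, 13, 22, 23], [1, 14], [1, 15], [1, 16], [1, 17], [1, 18], [1, 19], [1, 20], [1, 21],
     [2, 3], [2, 4], [2, 5], [2, 6], [2, 7], [2, 8], [2, 9], [2, 10], [2, 11, 14, 18, 23],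
     [2, 12, 19, 20, 21], [2, 13], [2, 15, 16, 17, 22], [3, 4, 19, 23], [3, 5, 7, 18],
     [3, 6, 13], [3, 8, 10, 17], [3, 9, 16, 20], [3, 11, 15], [3, 12, 14], [3, 21, 22],
     [4, 5, 13, 21], [4, 6, 10, 15], [4, 7, 8], [4, 9, 14, 22], [4, 11, 20], [4, 12, 17],
     [4, 16, 18], [5, 6, 19, 22], [5, 8, 16, 23], [5, 9, 10], [5, 11, 12], [5, 14, 15],
     [5, 17, 20], [6, 7, 9, 11], [6, 8, 14, 20], [6, 12, 16], [6, 17, 18], [6, 21, 23],
     [7, 10, 13], [7, 12, 15, 23], [7, 14, 17, 21], [7, 16, 19], [7, 20, 22], [8, 9, 12, 13],
     [8, 11, 22], [8, 15, 21], [8, 18, 19], [9, 15, 19], [9, 17, 23], [9, 18, 21],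
     [10, 11, 16, 21], [10, 12, 18, 22], [10, 14, 19], [10, 20, 23], [11, 13, 17, 19],
     [13, 14, 16], [13, 15, 18, 20]]"

definition lines6 :: "(nat \<times> pvec) list" where
  "lines6 =
    [(2, ([1], [0, -1], [1])), (3, ([1], [], [0, 1])), (4, ([1], [0, 1], [0, 1])),
     (5, ([1], [0, 1], [0, -1])), (6, ([], [1], [-1])), (7, ([1], [1], [-2, 1])),
     (8, ([1], [2, 1], [0, -1])), (9, ([0, -1], [1], [1])), (10, ([1], [-2, 1], [2, 1])),
     (11, ([1], [-2, 1], [1])), (12, ([1], [0, -1], [-2, 1])), (13, ([1], [0, 1], [])),
     (14, ([1], [1], [1])), (15, ([1], [2, 1], [-2, 1])), (16, ([1], [-2, 1], [0, -1])),
     (17, ([0, -1], [0, -1], [1])), (18, ([0, -1], [1], [0, -1])),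
     (19, ([1], [0, -1], [0, 1])), (20, ([1], [0, -1], [2, 1])), (21, ([], [], [1])),
     (22, ([1], [], [])), (23, ([], [1], []))]"

lemma certificate6:
  "certificate 23 points6 D6 [-2, 1] lines6 22 23 21 14 13 (4, 7, 8, -2)
      [((4, 13, 21, 14, 22), [1], ([1], [0, 1], [0, 1])),
       ((3, 4, 23, 21, 22), [1], ([-1], [], [0, -1])),
       ((6, 3, 13, 21, 23), [0, 1], ([], [1], [-1])),
       ((5, 4, 13, 6, 22), [0, 1], ([-1], [0, -1], [0, 1])),
       ((7, 3, 5, 14, 21), [0, 1], ([1], [1], [-2, 1])),
       ((8, 5, 23, 6, 14), [1], ([-1], [-2, -1], [0, 1]))]
      [(4, 13, 21, 14, 22), (3, 4, 23, 21, 22), (6, 3, 13, 21, 23), (5, 4, 13, 6, 22),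
       (7, 3, 5, 14, 21), (8, 5, 23, 6, 14), (9, 4, 14, 6, 7), (10, 3, 8, 4, 6),
       (11, 14, 23, 6, 7), (12, 7, 23, 8, 9), (2, 11, 14, 12, 21), (15, 2, 22, 4, 6),
       (16, 2, 15, 3, 9), (17, 2, 15, 3, 8), (18, 2, 11, 3, 5), (19, 2, 12, 3, 4),
       (20, 2, 12, 3, 9)]"
  by (intro certificate.intro points_of_lines.intro certificate_axioms.intro nonreal_field_quadratic)
     code_simp+

lemma list_weight6: "list_weight 23 points6 = 42715073735932"
  by code_simp

definition points7 :: "nat list list" where
  "points7 =
    [[1, 2], [1, 3], [1, 4], [1, 5], [1, 6], [1, 7], [1, 8], [1, 9], [1, 10], [1, 11], [1, 12],
     [1, 13, 22, 23], [1, 14], [1, 15], [1, 16], [1, 17], [1, 18], [1, 19], [1, 20], [1, 21],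
     [2, 3], [2, 4], [2, 5], [2, 6], [2, 7], [2, 8], [2, 9], [2, 10], [2, 11, 16, 17, 19],
     [2, 12, 14, 21, 22], [2, 13], [2, 15, 18, 20, 23], [3, 4, 13], [3, 5, 15, 16],
     [3, 6, 10, 17], [3, 7, 8, 21], [3, 9, 20, 22], [3, 11, 14], [3, 12, 18], [3, 19, 23],
     [4, 5, 10, 18], [4, 6, 8], [4, 7, 9, 23], [4, 11, 15, 21], [4, 12, 16], [4, 14, 17, 20],
     [4, 19, 22], [5, 6, 7], [5, 8, 13, 14], [5, 9, 12, 19], [5, 11, 20], [5, 17, 22],
     [5, 21, 23], [6, 9, 11, 13], [6, 12, 20], [6, 14, 16, 23], [6, 15, 22], [6, 18, 19, 21],
     [7, 10, 16, 22], [7, 11, 12], [7, 13, 19, 20], [7, 14, 18], [7, 15, 17], [8, 9, 10],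
     [8, 11, 18, 22], [8, 12, 17, 23], [8, 15, 19], [8, 16, 20], [9, 14, 15], [9, 16, 21],
     [9, 17, 18], [10, 11, 23], [10, 12, 13, 15], [10, 14, 19], [10, 20, 21], [13, 16, 18],
     [13, 17, 21]]"

definition lines7 :: "(nat \<times> pvec) list" where
  "lines7 =
    [(2, ([1], [1], [0, -1])), (3, ([], [1], [-1])), (4, ([1], [], [0, 1])),
     (5, ([1], [0, -1], [2, 1])), (6, ([1], [-2, 1], [1])), (7, ([1], [0, 1], [0, 1])),
     (8, ([1], [2, 1], [-2, 1])), (9, ([1], [0, -1], [0, 1])), (10, ([0, -1], [1], [1])),
     (11, ([0, -1], [0, -1], [1])), (12, ([1], [0, -1], [-2, 1])), (13, ([1], [0, 1], [])),
     (14, ([0, -1], [1], [0, -1])), (15, ([1], [2, 1], [0, -1])), (16, ([1], [1], [1])),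
     (17, ([1], [1], [-2, 1])), (18, ([1], [-2, 1], [0, -1])), (19, ([], [], [1])),
     (20, ([1], [0, 1], [0, -1])), (21, ([1], [-2, 1], [2, 1])), (22, ([1], [], [])),
     (23, ([], [1], []))]"

lemma certificate7:
  "certificate 23 points7 D7 [-2, 1] lines7 22 23 19 16 13 (5, 6, 7, -2)
      [((7, 16, 22, 13, 19), [1], ([-1], [0, -1], [0, -1])),
       ((4, 7, 23, 19, 22), [1], ([1], [], [0, 1])),
       ((3, 4, 13, 19, 23), [0, 1], ([], [-1], [1])),
       ((9, 3, 22, 4, 7), [0, 1], ([-1], [0, 1], [0, -1])),
       ((5, 3, 16, 9, 19), [1], ([-1], [0, 1], [-2, -1])),
       ((6, 9, 13, 16, 23), [0, 1], ([-1], [2, -1], [-1]))]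
      [(7, 16, 22, 13, 19), (4, 7, 23, 19, 22), (3, 4, 13, 19, 23), (9, 3, 22, 4, 7),
       (5, 3, 16, 9, 19), (6, 9, 13, 16, 23), (8, 3, 7, 5, 13), (10, 3, 6, 4, 5),
       (11, 16, 19, 6, 9), (12, 5, 9, 8, 23), (2, 11, 16, 12, 22), (14, 2, 12, 5, 8),
       (15, 2, 23, 3, 5), (17, 2, 11, 3, 6), (18, 2, 15, 4, 5), (20, 2, 15, 3, 9),
       (21, 2, 12, 3, 7)]"
  by (intro certificate.intro points_of_lines.intro certificate_axioms.intro nonreal_field_quadratic)
     code_simp+

lemma list_weight7: "list_weight 23 points7 = 42714425385860"
  by code_simp

definition points8 :: "nat list list" where
  "points8 =
    [[1, 2], [1, 3], [1, 4], [1, 5], [1, 6], [1, 7], [1, 8], [1, 9], [1, 10], [1, 11],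
     [1, 12, 22, 23], [1, 13], [1, 14], [1, 15], [1, 16], [1, 17], [1, 18], [1, 19], [1, 20],
     [1, 21], [2, 3], [2, 4], [2, 5], [2, 6], [2, 7], [2, 8], [2, 9], [2, 10],
     [2, 11, 14, 15, 18], [2, 12], [2, 13, 16, 19, 23], [2, 17, 20, 21, 22], [3, 4, 8, 14],
     [3, 5, 12, 20], [3, 6, 15, 19], [3, 7, 9], [3, 10, 16, 17], [3, 11, 22], [3, 13, 18],
     [3, 21, 23], [4, 5, 10], [4, 6, 7, 23], [4, 9, 19, 21], [4, 11, 13], [4, 12, 15, 17],
     [4, 16, 20], [4, 18, 22], [5, 6, 9, 22], [5, 7, 8], [5, 11, 17, 23], [5, 13, 14, 21],
     [5, 15, 16], [5, 18, 19], [6, 8, 12], [6, 10, 18, 21], [6, 11, 16], [6, 13, 20],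
     [6, 14, 17], [7, 10, 12, 13], [7, 11, 19, 20], [7, 14, 16, 22], [7, 15, 21], [7, 17, 18],
     [8, 9, 10, 11], [8, 13, 15, 22], [8, 16, 21], [8, 17, 19], [8, 18, 20, 23],
     [9, 12, 16, 18], [9, 13, 17], [9, 14, 20], [9, 15, 23], [10, 14, 23], [10, 15, 20],
     [10, 19, 22], [11, 12, 21], [12, 14, 19]]"

definition lines8 :: "(nat \<times> pvec) list" where
  "lines8 =
    [(2, ([], [1], [1, -1])), (3, ([1], [-1, 1], [-1, -1])), (4, ([2], [2], [0, -1])),
     (5, ([1], [-1], [1, -1])), (6, ([-1, 1], [-1, -1], [1])), (7, ([2], [0, 1], [0, -1])),
     (8, ([1], [1, 1], [-1])), (9, ([1], [1], [1])), (10, ([1], [0, 1], [0, -1])),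
     (11, ([1, -1], [1], [-1, -1])), (12, ([1], [], [])), (13, ([], [1], [-1])),
     (14, ([1], [], [0, -1])), (15, ([1], [-1, 1], [1])), (16, ([], [1], [1])),
     (17, ([1], [1, 1], [1, -1])), (18, ([1], [-1], [-1])), (19, ([], [], [1])),
     (20, ([2], [0, 1], [-2])), (21, ([1], [1], [-1, -1])), (22, ([1], [0, 1], [])),
     (23, ([], [1], []))]"

lemma certificate8:
  "certificate 23 points8 D8 [-2, 1] lines8 12 23 19 9 22 (4, 9, 19, -1)
      [((16, 19, 23, 9, 12), [1], ([], [-1], [-1])),
       ((14, 16, 22, 12, 19), [1], ([1], [], [0, -1])),
       ((10, 14, 23, 19, 22), [1], ([-1], [0, -1], [0, 1])),
       ((7, 10, 12, 14, 16), [0, 1], ([-2], [0, -1], [0, 1])),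
       ((3, 10, 16, 7, 9), [0, 2], ([-1], [1, -1], [1, 1])),
       ((4, 3, 14, 7, 23), [1], ([-2], [0, -1, 1], [0, 1]))]
      [(16, 19, 23, 9, 12), (14, 16, 22, 12, 19), (10, 14, 23, 19, 22), (7, 10, 12, 14, 16),
       (3, 10, 16, 7, 9), (4, 3, 14, 7, 23), (5, 3, 12, 9, 22), (6, 3, 19, 4, 7),
       (8, 3, 4, 9, 10), (11, 5, 23, 7, 19), (2, 11, 14, 16, 19), (13, 2, 16, 5, 14),
       (15, 2, 11, 3, 6), (17, 2, 22, 3, 10), (18, 2, 11, 6, 10), (20, 2, 17, 3, 5),
       (21, 2, 17, 4, 9)]"
  by (intro certificate.intro points_of_lines.intro certificate_axioms.intro nonreal_field_quadratic)
     code_simp+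

lemma list_weight8: "list_weight 23 points8 = 42714447576780"
  by code_simp

definition points9 :: "nat list list" where
  "points9 =
    [[1, 2], [1, 3], [1, 4], [1, 5], [1, 6], [1, 7], [1, 8], [1, 9], [1, 10], [1, 11], [1, 12],
     [1, 13], [1, 14], [1, 15, 20, 22], [1, 16], [1, 17], [1, 18], [1, 19], [1, 21], [1, 23],
     [2, 3], [2, 4], [2, 5], [2, 6], [2, 7], [2, 8], [2, 9, 13, 17, 23], [2, 10, 14, 16, 21],
     [2, 11, 12, 18, 19], [2, 15], [2, 20], [2, 22], [3, 4, 21, 23], [3, 5, 11, 22],
     [3, 6, 13, 18], [3, 7, 20], [3, 8, 14, 15], [3, 9, 12], [3, 10, 17], [3, 16, 19],
     [4, 5, 15], [4, 6, 10, 12], [4, 7, 19, 22], [4, 8, 9, 20], [4, 11, 17], [4, 13, 16],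
     [4, 14, 18], [5, 6, 17, 20], [5, 7, 10, 13], [5, 8, 18, 21], [5, 9, 19], [5, 12, 16],
     [5, 14, 23], [6, 7, 15, 16], [6, 8, 22], [6, 9, 14], [6, 11, 21], [6, 19, 23],
     [7, 8, 12, 23], [7, 9, 21], [7, 11, 14], [7, 17, 18], [8, 10, 19], [8, 11, 13],
     [8, 16, 17], [9, 10, 11, 15], [9, 16, 18, 22], [10, 18, 20], [10, 22, 23],
     [11, 16, 20, 23], [12, 13, 15], [12, 14, 17, 22], [12, 20, 21], [13, 14, 19, 20],
     [13, 21, 22], [15, 17, 19, 21], [15, 18, 23]]"

definition lines9 :: "(nat \<times> pvec) list" where
  "lines9 =
    [(2, ([1], [0, -1], [3])), (3, ([1], [0, 1], [0, 1])), (4, ([1], [-2, 1], [0, -1])),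
     (5, ([1], [0, 1], [0, -1])), (6, ([1], [-1], [1])), (7, ([1], [1], [1])),
     (8, ([1], [2, -1], [0, 1])), (9, ([], [0, -1], [1])), (10, ([], [1], [-1, 1])),
     (11, ([], [], [1])), (12, ([1], [0, -1], [2, 1])), (13, ([1], [2, -1], [2, 1])),
     (14, ([1], [1], [0, 1])), (15, ([], [1], [])), (16, ([1], [], [1])),
     (17, ([1], [-2, 1], [2, -1])), (18, ([1], [0, -1], [2])), (19, ([1], [0, -1], [2, -1])),
     (20, ([1], [], [])), (21, ([1], [-1], [2, -1])), (22, ([1], [0, 1], [])),
     (23, ([1], [], [2]))]"

lemma certificate9:
  "certificate 23 points9 D9 [-2, 1] lines9 20 15 11 7 22 (6, 9, 14, -1)
      [((3, 11, 22, 7, 20), [1], ([-1], [0, -1], [0, -1])),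
       ((14, 3, 15, 7, 11), [1], ([-1], [-1], [0, -1])),
       ((16, 7, 15, 11, 20), [1], ([-1], [], [-1])),
       ((9, 11, 15, 16, 22), [1], ([], [0, -1], [1])),
       ((4, 7, 22, 9, 20), [1], ([1], [0, 0, 1], [0, -1])),
       ((5, 3, 11, 4, 15), [1], ([1], [0, 1], [0, -1])),
       ((6, 5, 20, 7, 15), [0, 1], ([-1], [1], [-1]))]
      [(3, 11, 22, 7, 20), (14, 3, 15, 7, 11), (16, 7, 15, 11, 20), (9, 11, 15, 16, 22),
       (4, 7, 22, 9, 20), (5, 3, 11, 4, 15), (6, 5, 20, 7, 15), (8, 3, 14, 4, 9),
       (10, 14, 16, 4, 6), (12, 4, 6, 7, 8), (2, 10, 14, 11, 12), (13, 2, 9, 3, 6),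
       (17, 2, 9, 5, 6), (18, 2, 11, 3, 6), (19, 2, 11, 4, 7), (21, 2, 10, 3, 4),
       (23, 2, 9, 3, 4)]"
  by (intro certificate.intro points_of_lines.intro certificate_axioms.intro nonreal_field_quadratic)
     code_simp+

lemma list_weight9: "list_weight 23 points9 = 42660390193816"
  by code_simp

definition points10 :: "nat list list" where
  "points10 =
    [[1, 2], [1, 3], [1, 4], [1, 5], [1, 6], [1, 7], [1, 8], [1, 9, 21, 22], [1, 10], [1, 11],
     [1, 12], [1, 13], [1, 14], [1, 15], [1, 16], [1, 17], [1, 18], [1, 19], [1, 20], [1, 23],
     [2, 3], [2, 4], [2, 5], [2, 6], [2, 7], [2, 8], [2, 9], [2, 10, 11, 12, 16],
     [2, 13, 19, 20, 23], [2, 14, 15, 17, 18], [2, 21], [2, 22], [3, 4, 20, 22], [3, 5, 7],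
     [3, 6, 9, 14], [3, 8, 15, 16], [3, 10, 23], [3, 11, 13, 21], [3, 12, 17], [3, 18, 19],
     [4, 5, 12, 21], [4, 6, 8], [4, 7, 11, 17], [4, 9, 13, 15], [4, 10, 19], [4, 14, 16],
     [4, 18, 23], [5, 6, 22], [5, 8, 9, 10], [5, 11, 14, 19], [5, 13, 17], [5, 15, 23],
     [5, 16, 18, 20], [6, 7, 18, 21], [6, 10, 17, 20], [6, 11, 23], [6, 12, 15, 19],
     [6, 13, 16], [7, 8, 19, 22], [7, 9, 16, 23], [7, 10, 15], [7, 12, 13], [7, 14, 20],
     [8, 11, 18], [8, 12, 20], [8, 13, 14], [8, 17, 21, 23], [9, 11, 20], [9, 12, 18],
     [9, 17, 19], [10, 13, 18, 22], [10, 14, 21], [11, 15, 22], [12, 14, 22, 23], [15, 20, 21],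
     [16, 17, 22], [16, 19, 21]]"

definition lines10 :: "(nat \<times> pvec) list" where
  "lines10 =
    [(2, ([-1, -1], [1, -1], [-1, 2])), (3, ([], [1], [1])), (4, ([], [1], [-1])),
     (5, ([1], [-1, 1], [1])), (6, ([1], [1], [1])), (7, ([1], [-1], [1, -1])),
     (8, ([1], [1, 1], [1, -1])), (9, ([1], [], [])), (10, ([2], [2], [0, -1])),
     (11, ([1], [], [0, -1])), (12, ([1], [1, 1], [-1])), (13, ([2], [0, 1], [0, -1])),
     (14, ([1], [-1], [-1])), (15, ([1], [0, 1], [0, -1])), (16, ([1], [-1, 1], [-1, -1])),
     (17, ([1], [1], [-1, -1])), (18, ([-1, 1], [-1, -1], [1])),
     (19, ([1, -1], [1], [-1, -1])), (20, ([], [], [1])), (21, ([1], [0, 1], [])),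
     (22, ([], [1], [])), (23, ([2], [0, 1], [-2]))]"

lemma certificate10:
  "certificate 23 points10 D10 [-2, 1] lines10 9 22 20 6 21 (3, 5, 7, 2)
      [((3, 20, 22, 6, 9), [1], ([], [-1], [-1])),
       ((11, 3, 21, 9, 20), [1], ([1], [], [0, -1])),
       ((15, 11, 22, 20, 21), [1], ([-1], [0, -1], [0, 1])),
       ((4, 3, 20, 9, 15), [0, 1], ([], [-1], [1])),
       ((5, 4, 21, 6, 22), [1], ([1], [-1, 1], [1])),
       ((7, 4, 11, 6, 21), [1], ([-2, 1], [0, 0, -1], [0, 2]))]
      [(3, 20, 22, 6, 9), (11, 3, 21, 9, 20), (15, 11, 22, 20, 21), (4, 3, 20, 9, 15),
       (5, 4, 21, 6, 22), (7, 4, 11, 6, 21), (8, 3, 15, 5, 9), (10, 5, 8, 6, 20),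
       (12, 10, 11, 4, 5), (13, 3, 11, 4, 9), (2, 10, 11, 13, 20), (14, 2, 15, 3, 6),
       (16, 2, 10, 3, 8), (17, 2, 14, 4, 7), (18, 2, 14, 5, 16), (19, 2, 13, 5, 11),
       (23, 2, 13, 7, 9)]"
  by (intro certificate.intro points_of_lines.intro certificate_axioms.intro nonreal_field_quadratic)
     code_simp+

lemma list_weight10: "list_weight 23 points10 = 42659066437432"
  by code_simp

definition points11 :: "nat list list" where
  "points11 =
    [[1, 2, 20, 21, 22, 23], [1, 3], [1, 4], [1, 5], [1, 6], [1, 7], [1, 8], [1, 9], [1, 10],
     [1, 11], [1, 12], [1, 13], [1, 14], [1, 15], [1, 16], [1, 17], [1, 18], [1, 19], [2, 3],
     [2, 4], [2, 5], [2, 6], [2, 7], [2, 8], [2, 9], [2, 10], [2, 11], [2, 12], [2, 13],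
     [2, 14, 16, 17], [2, 15, 18, 19], [3, 4, 5, 12], [3, 6, 18, 20], [3, 7, 14, 19],
     [3, 8, 16], [3, 9, 11], [3, 10, 13, 22], [3, 15, 23], [3, 17, 21], [4, 6, 15, 16],
     [4, 7, 20], [4, 8, 13], [4, 9, 14, 23], [4, 10, 19], [4, 11, 17, 22], [4, 18, 21],
     [5, 6, 17], [5, 7, 10], [5, 8, 18, 23], [5, 9, 13, 21], [5, 11, 14, 15], [5, 16, 22],
     [5, 19, 20], [6, 7, 23], [6, 8, 9, 10], [6, 11, 19, 21], [6, 12, 13], [6, 14, 22],
     [7, 8, 15, 22], [7, 9, 17, 18], [7, 11, 13], [7, 12, 16, 21], [8, 11, 20],
     [8, 12, 17, 19], [8, 14, 21], [9, 12, 15], [9, 16, 20], [9, 19, 22], [10, 11, 16, 18],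
     [10, 12, 14, 20], [10, 15, 21], [10, 17, 23], [11, 12, 23], [12, 18, 22], [13, 14, 18],
     [13, 15, 17, 20], [13, 16, 19, 23]]"

definition lines11 :: "(nat \<times> pvec) list" where
  "lines11 =
    [(2, ([-2, 1], [-1, -1], [])), (3, ([], [0, -1], [1])), (4, ([1], [1, 1], [-1])),
     (5, ([1], [-1], [1, -1])), (6, ([2], [2], [0, 1])), (7, ([1], [-1], [1])),
     (8, ([1], [1], [1])), (9, ([1], [1], [-1, 1])), (10, ([], [], [1])),
     (11, ([1], [-1, 1], [-1])), (12, ([2], [0, 1], [0, -1])), (13, ([], [1], [-1, 1])),
     (14, ([2], [0, 1], [0, 1])), (15, ([1], [], [1])), (16, ([1], [-1, 1], [1, -1])),
     (17, ([1], [0, 1], [-1])), (18, ([-1, 1], [-1, -1], [1])), (19, ([1], [1, 1], [-1, 1])),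
     (20, ([2], [0, 1], [])), (21, ([1], [], [])), (22, ([], [1], [])),
     (23, ([1], [0, 1], []))]"

lemma certificate11:
  "certificate 23 points11 D11 [-2, 1] lines11 21 22 10 8 23 (5, 13, 21, 1)
      [((15, 8, 22, 10, 21), [1], ([-1], [], [-1])),
       ((3, 10, 22, 15, 23), [1], ([], [0, -1], [1])),
       ((17, 3, 21, 10, 23), [0, 1], ([-1], [0, -1], [1])),
       ((13, 3, 10, 15, 17), [0, 1], ([], [0, 1], [-2])),
       ((4, 17, 22, 8, 13), [2], ([1], [1, 1], [-1])),
       ((5, 3, 4, 8, 23), [1], ([-1], [-1, 1, -1], [-1, 1]))]
      [(15, 8, 22, 10, 21), (3, 10, 22, 15, 23), (17, 3, 21, 10, 23), (13, 3, 10, 15, 17),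
       (4, 17, 22, 8, 13), (5, 3, 4, 8, 23), (6, 4, 15, 8, 10), (7, 8, 15, 5, 10),
       (9, 4, 23, 5, 13), (11, 4, 17, 5, 15), (12, 3, 4, 7, 21), (14, 3, 7, 4, 9),
       (2, 21, 22, 14, 17), (16, 2, 14, 4, 6), (18, 2, 15, 3, 6), (19, 2, 15, 3, 7),
       (20, 2, 21, 3, 6)]"
  by (intro certificate.intro points_of_lines.intro certificate_axioms.intro nonreal_field_quadratic)
     code_simp+

lemma list_weight11: "list_weight 23 points11 = 43211564866528"
  by code_simp

section \<open>The theorem\<close>

lemmas certified_all =
    certificate.certified[OF certificate1] certificate.certified[OF certificate2]
    certificate.certified[OF certificate3] certificate.certified[OF certificate4]
    certificate.certified[OF certificate5] certificate.certified[OF certificate6]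
    certificate.certified[OF certificate7] certificate.certified[OF certificate8]
    certificate.certified[OF certificate9] certificate.certified[OF certificate10]
    certificate.certified[OF certificate11]

lemmas list_weights =
    list_weight1 list_weight2 list_weight3 list_weight4 list_weight5 list_weight6
    list_weight7 list_weight8 list_weight9 list_weight10 list_weight11

lemma weights: "map weight matroids =
    [3203810104351, 18276892515821, 18283143729909, 18270351019757, 18270353871821,
     42715073735932, 42714425385860, 42714447576780, 42660390193816, 42659066437432,
     43211564866528]"
  unfolding matroids_def by (simp only: list.map certified_all list_weights)

lemma matroids_pairwise_nonisomorphic:
  assumes "i < 11" "j < 11" "i \<noteq> j"
  shows "\<not> matroid_isomorphic (matroids ! i) (matroids ! j)"
proof
  assume iso: "matroid_isomorphic (matroids ! i) (matroids ! j)"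
  have len: "length matroids = 11" by (simp add: matroids_def)
  have "is_matroid M" if "M \<in> set matroids" for M
    using that certified_all unfolding matroids_def
    by (auto simp: rank_three_matroid_def simple_matroid_def)
  then have "weight (matroids ! i) = weight (matroids ! j)"
    using matroid_isomorphic_weight[OF iso] assms len by simp
  then have "map weight matroids ! i = map weight matroids ! j" using assms len by simp
  moreover have "distinct (map weight matroids)" unfolding weights by simp
  ultimately show False
    using assms len by (simp add: nth_eq_iff_index_eq del: nth_map)
qed

lemma ground_card: "map (\<lambda>M. card (ground M)) matroids = [16, 21, 21, 21, 21, 23, 23, 23, 23, 23, 23]"
  by (simp add: matroids_def encoded_matroid_def)

lemma card_ground_eq:
  "card {i. i < 11 \<and> card (ground (matroids ! i)) = m} =
     length (filter (\<lambda>k. k = m) [16, 21, 21, 21, 21, 23, 23, 23, 23, 23, 23])"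
proof -
  have len: "length matroids = 11" by (simp add: matroids_def)
  have "length (filter (\<lambda>k. k = m) (map (\<lambda>M. card (ground M)) matroids)) =
      card {i. i < 11 \<and> card (ground (matroids ! i)) = m}"
    unfolding length_filter_conv_card by (intro arg_cong[of _ _ card]) (auto simp: len)
  then show ?thesis unfolding ground_card by simp
qed

theorem mainTheorem2:
  shows "(\<forall>L \<in> set matroids. rank_three_matroid L)
    \<and> (\<forall>i < 11. \<forall>j < 11. i \<noteq> j \<longrightarrow> \<not> matroid_isomorphic (matroids ! i) (matroids ! j))
    \<and> card {i. i < 11 \<and> card (ground (matroids ! i)) = 16} = 1
    \<and> card {i. i < 11 \<and> card (ground (matroids ! i)) = 21} = 4
    \<and> card {i. i < 11 \<and> card (ground (matroids ! i)) = 23} = 6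
    \<and> (\<forall>L \<in> set matroids.
          combinatorially_simplicial L
          \<and> krull_dim (moduli_space L :: (nat, complex) columns set set topology) = 1
          \<and> \<not> realizable_over TYPE(real) L)"
proof (intro conjI)
  show "\<forall>L \<in> set matroids. rank_three_matroid L"
    unfolding matroids_def using certified_all by simp
  show "\<forall>i < 11. \<forall>j < 11. i \<noteq> j \<longrightarrow> \<not> matroid_isomorphic (matroids ! i) (matroids ! j)"
    using matroids_pairwise_nonisomorphic by blast
  show "card {i. i < 11 \<and> card (ground (matroids ! i)) = 16} = 1"
    "card {i. i < 11 \<and> card (ground (matroids ! i)) = 21} = 4"
    "card {i. i < 11 \<and> card (ground (matroids ! i)) = 23} = 6"
    unfolding card_ground_eq by simp_all
  show "\<forall>L \<in> set matroids. combinatorially_simplicial L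
          \<and> krull_dim (moduli_space L :: (nat, complex) columns set set topology) = 1
          \<and> \<not> realizable_over TYPE(real) L"
    unfolding matroids_def using certified_all by simp
qed

end
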